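(* Let $(M=M_1\times_f M_2,g^f,\Pi)$ be a compact Riemannian Poisson warped product space and suppose that $f$ is a Casimir function on $M_1$. Let $\eta_1\in\Omega^1(M_1)$ and $\eta_2\in\Omega^1(M_2)$. Then: (1) $\eta=\eta_1^h+\eta_2^v$ is parallel if, for $i=1,2$, the 1-form $\eta_i$ is a 2-Killing 1-form on $M_i$, $Ric_i(\eta_i,\eta_i)\leq 0$ and $\mathcal{D}^i_{\eta_i}\eta_i=0$. (2) $\eta=\eta_1^h$ is parallel if $\eta_1$ is a 2-Killing 1-form on $M_1$, $Ric_1(\eta_1,\eta_1)\leq 0$ and $\mathcal{D}^1_{\eta_1}\eta_1=0$. (3) $\eta=\eta_2^v$ is parallel if $\eta_2$ is a 2-Killing 1-form on $M_2$, $Ric_2(\eta_2,\eta_2)\leq 0$ and $\mathcal{D}^2_{\eta_2}\eta_2=0$.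
   Context: Poisson notation. For a manifold $N$ with a Poisson tensor $\Pi$ (bivector field with $[\Pi,\Pi]_S=0$), the sharp map $\sharp_\Pi$ is defined by $\eta(\sharp_\Pi(\omega))=\Pi(\omega,\eta)$, and the Koszul bracket on 1-forms is $[\omega,\eta]_\Pi=\mathcal{L}_{\sharp_\Pi(\omega)}\eta-\mathcal{L}_{\sharp_\Pi(\eta)}\omega-d(\Pi(\omega,\eta))$. For a cometric $g$ (induced metric on $T^*N$ of a Riemannian metric on $N$), the contravariant Levi-Civita connection $\mathcal{D}$ of $(\Pi,g)$ is the unique contravariant connection on 1-forms ($\mathcal{D}_{\phi\omega}\eta=\phi\mathcal{D}_\omega\eta$, $\mathcal{D}_\omega(\phi\eta)=\phi\mathcal{D}_\omega\eta+\sharp_\Pi(\omega)(\phi)\eta$) with $\mathcal{D}_\omega\eta-\mathcal{D}_\eta\omega=[\omega,\eta]_\Pi$ and $\sharp_\Pi(\omega)g(\eta,\gamma)=g(\mathcal{D}_\omega\eta,\gamma)+g(\eta,\mathcal{D}_\omega\gamma)$. $(N,g,\Pi)$ is a Riemannian Poisson manifold if $\mathcal{D}\Pi=0$, i.e. $\sharp_\Pi(\omega)\Pi(\eta,\gamma)=\Pi(\mathcal{D}_\omega\eta,\gamma)+\Pi(\eta,\mathcal{D}_\omega\gamma)$. Curvature: $\mathcal{R}(\omega,\eta)\gamma=\mathcal{D}_\omega\mathcal{D}_\eta\gamma-\mathcal{D}_\eta\mathcal{D}_\omega\gamma-\mathcal{D}_{[\omega,\eta]_\Pi}\gamma$; Ricci: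 $Ric(\omega,\eta)=\sum_i g(\mathcal{R}(\omega,\theta_i)\theta_i,\eta)$ for any local orthonormal coframe $\{\theta_i\}$. For a bilinear form $T$ on 1-forms, $(\mathcal{L}_\eta T)(\alpha,\beta)=\sharp_\Pi(\eta)(T(\alpha,\beta))-T([\eta,\alpha]_\Pi,\beta)-T(\alpha,[\eta,\beta]_\Pi)$; $\eta$ is a 2-Killing 1-form if $\mathcal{L}_\eta\mathcal{L}_\eta g=0$. $\eta$ is parallel if $\mathcal{D}\eta=0$, i.e. $\mathcal{D}_\alpha\eta=0$ for all 1-forms $\alpha$. Warped product. $(M_1,\tilde g_1)$, $(M_2,\tilde g_2)$ are Riemannian manifolds with cometrics $g_1,g_2$ and Poisson tensors $\Pi_1,\Pi_2$; $f:M_1\to\mathbb{R}^+$ is smooth; $\pi_1,\pi_2$ are the projections of $M=M_1\times M_2$. Lifts: $\phi^h=\phi\circ\pi_1$, $\omega_1^h=\pi_1^*\omega_1$ for functions/1-forms on $M_1$, and $\phi^v=\phi\circ\pi_2$, $\omega_2^v=\pi_2^*\omega_2$ for those on $M_2$. The cometric $g^f$ of $\tilde g^f=\pi_1^*\tilde g_1+(f^h)^2\pi_2^*\tilde g_2$ satisfies $g^f(\omega_1^h,\eta_1^h)=g_1(\omega_1,\eta_1)^h$, $g^f(\omega_1^h,\eta_2^v)=0$, $g^f(\omega_2^v,\eta_2^v)=\frac{1}{(f^h)^2}g_2(\omega_2,\eta_2)^v$. $\Pi=\Pi_1+\Pi_2$ is the product Poisson tensor: $\Pi(\omega_1^h,\eta_1^h)=\Pi_1(\omega_1,\eta_1)^h$,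 $\Pi(\omega_1^h,\eta_2^v)=0$, $\Pi(\omega_2^v,\eta_2^v)=\Pi_2(\omega_2,\eta_2)^v$. $(M_1\times_f M_2,g^f,\Pi)$ is a Riemannian Poisson warped product space if it is a Riemannian Poisson manifold. $f$ is a Casimir function on $M_1$ if $\Pi_1(d\phi,df)=0$ for all $\phi\in\mathcal{C}^\infty(M_1)$. $\mathcal{D}^i$, $Ric_i$ and "2-Killing on $M_i$" refer to $(M_i,g_i,\Pi_i)$; "parallel" refers to the contravariant Levi-Civita connection $\mathcal{D}$ of $(\Pi,g^f)$ on $M$. *)

theory Defs
  imports "HOL-Analysis.Analysis"
begin

text \<open>
  Manifolds are second countable Hausdorff spaces with a smooth atlas modelled on a Euclidean space.
  Tangent vectors at a point are derivations of the algebra of smooth functions, vector fields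
  and 1-forms are smooth families of tangent vectors and of linear functionals on the tangent
  spaces.
  A smooth function is a total function whose restriction to the manifold is smooth; a functional
  on a set V of functions is normalised to be 0 outside V, so that tangent vectors, covectors,
  vector fields and 1-forms are equal in HOL iff they are equal as mathematical objects.
\<close>

section \<open>Smooth manifolds and smooth functions\<close>

primrec Ck_on :: "nat \<Rightarrow> 'e::real_normed_vector set \<Rightarrow> ('e \<Rightarrow> 'f::real_normed_vector) \<Rightarrow> bool" where
  "Ck_on 0 S f \<longleftrightarrow> continuous_on S f"
| "Ck_on (Suc k) S f \<longleftrightarrow>
     (\<forall>x\<in>S. f differentiable (at x)) \<and> (\<forall>v. Ck_on k S (\<lambda>x. frechet_derivative f (at x) v))"

definition smooth_on :: "'e::real_normed_vector set \<Rightarrow> ('e \<Rightarrow> 'f::real_normed_vector) \<Rightarrow> bool" where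
  "smooth_on S f \<longleftrightarrow> (\<forall>k. Ck_on k S f)"

text \<open>A chart is a pair of its domain and its coordinate map; the atlas need not be maximal.\<close>

record ('a, 'e) manifold =
  mtop :: "'a topology"
  atlas :: "('a set \<times> ('a \<Rightarrow> 'e)) set"

abbreviation points :: "('a, 'e) manifold \<Rightarrow> 'a set" where
  "points M \<equiv> topspace (mtop M)"

definition smooth_manifold :: "('a, 'e::euclidean_space) manifold \<Rightarrow> bool" where
  "smooth_manifold M \<longleftrightarrow>
     Hausdorff_space (mtop M) \<and> second_countable (mtop M) \<and>
     (\<Union>(U, \<phi>)\<in>atlas M. U) = points M \<and>
     (\<forall>(U, \<phi>)\<in>atlas M. openin (mtop M) U \<and> open (\<phi> ` U) \<and>
        homeomorphic_map (subtopology (mtop M) U) (top_of_set (\<phi> ` U)) \<phi>) \<and>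
     (\<forall>(U, \<phi>)\<in>atlas M. \<forall>(V, \<psi>)\<in>atlas M. smooth_on (\<phi> ` (U \<inter> V)) (\<psi> \<circ> inv_into U \<phi>))"

definition smooth_functions :: "('a, 'e::euclidean_space) manifold \<Rightarrow> ('a \<Rightarrow> real) set" where
  "smooth_functions M = {h. \<forall>(U, \<phi>)\<in>atlas M. smooth_on (\<phi> ` U) (h \<circ> inv_into U \<phi>)}"

definition product_manifold ::
    "('a, 'e::euclidean_space) manifold \<Rightarrow> ('b, 'f::euclidean_space) manifold \<Rightarrow> ('a \<times> 'b, 'e \<times> 'f) manifold" where
  "product_manifold M N =
     \<lparr>mtop = prod_topology (mtop M) (mtop N),
      atlas = {(U \<times> V, map_prod \<phi> \<psi>) | U \<phi> V \<psi>. (U, \<phi>) \<in> atlas M \<and> (V, \<psi>) \<in> atlas N}\<rparr>"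

section \<open>Tangent vectors, vector fields and 1-forms\<close>

type_synonym 'a tangent = "('a \<Rightarrow> real) \<Rightarrow> real"
type_synonym 'a cotangent = "'a tangent \<Rightarrow> real"
type_synonym 'a vfield = "'a \<Rightarrow> 'a tangent"
type_synonym 'a form = "'a \<Rightarrow> 'a cotangent"
type_synonym 'a cov_tensor = "'a \<Rightarrow> 'a tangent \<Rightarrow> 'a tangent \<Rightarrow> real"
type_synonym 'a contra_tensor = "'a \<Rightarrow> 'a cotangent \<Rightarrow> 'a cotangent \<Rightarrow> real"

definition linear_functional_on :: "('x \<Rightarrow> real) set \<Rightarrow> (('x \<Rightarrow> real) \<Rightarrow> real) \<Rightarrow> bool" where
  "linear_functional_on V L \<longleftrightarrow>
     (\<forall>u\<in>V. \<forall>w\<in>V. \<forall>a b. L (\<lambda>x. a * u x + b * w x) = a * L u + b * L w)"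

definition dual :: "('x \<Rightarrow> real) set \<Rightarrow> (('x \<Rightarrow> real) \<Rightarrow> real) set" where
  "dual V = {L. linear_functional_on V L \<and> (\<forall>u. u \<notin> V \<longrightarrow> L u = 0)}"

definition bilinear_form_on ::
    "('x \<Rightarrow> real) set \<Rightarrow> (('x \<Rightarrow> real) \<Rightarrow> ('x \<Rightarrow> real) \<Rightarrow> real) \<Rightarrow> bool" where
  "bilinear_form_on V B \<longleftrightarrow>
     (\<forall>u\<in>V. linear_functional_on V (B u) \<and> linear_functional_on V (\<lambda>w. B w u))"

definition tangent_space :: "('a, 'e::euclidean_space) manifold \<Rightarrow> 'a \<Rightarrow> 'a tangent set" where
  "tangent_space M p = {v \<in> dual (smooth_functions M).
     \<forall>h\<in>smooth_functions M. \<forall>k\<in>smooth_functions M. v (\<lambda>x. h x * k x) = h p * v k + k p * v h}"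

definition cotangent_space :: "('a, 'e::euclidean_space) manifold \<Rightarrow> 'a \<Rightarrow> 'a cotangent set" where
  "cotangent_space M p = dual (tangent_space M p)"

text \<open>Off the manifold every function is smooth, so the following definitions make fields vanish there
  (see \<open>tangent_space_outside\<close> below).\<close>

definition vector_fields :: "('a, 'e::euclidean_space) manifold \<Rightarrow> 'a vfield set" where
  "vector_fields M = {X. (\<forall>p. X p \<in> tangent_space M p) \<and>
     (\<forall>h\<in>smooth_functions M. (\<lambda>p. X p h) \<in> smooth_functions M)}"

definition one_forms :: "('a, 'e::euclidean_space) manifold \<Rightarrow> 'a form set" where
  "one_forms M = {\<omega>. (\<forall>p. \<omega> p \<in> cotangent_space M p) \<and>
     (\<forall>X\<in>vector_fields M. (\<lambda>p. \<omega> p (X p)) \<in> smooth_functions M)}"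

definition zero_form :: "'a form" where
  "zero_form = (\<lambda>p v. 0)"

definition form_add :: "'a form \<Rightarrow> 'a form \<Rightarrow> 'a form" where
  "form_add \<omega> \<eta> = (\<lambda>p v. \<omega> p v + \<eta> p v)"

definition form_diff :: "'a form \<Rightarrow> 'a form \<Rightarrow> 'a form" where
  "form_diff \<omega> \<eta> = (\<lambda>p v. \<omega> p v - \<eta> p v)"

definition form_scale :: "('a \<Rightarrow> real) \<Rightarrow> 'a form \<Rightarrow> 'a form" where
  "form_scale h \<omega> = (\<lambda>p v. h p * \<omega> p v)"

definition differential :: "('a, 'e::euclidean_space) manifold \<Rightarrow> ('a \<Rightarrow> real) \<Rightarrow> 'a form" where
  "differential M h = (\<lambda>p v. if v \<in> tangent_space M p then v h else 0)"

definition lie_bracket :: "'a vfield \<Rightarrow> 'a vfield \<Rightarrow> 'a vfield" where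
  "lie_bracket X Y = (\<lambda>p h. X p (\<lambda>q. Y q h) - Y p (\<lambda>q. X q h))"

text \<open>The Lie derivative of a 1-form, characterised by
  \<open>(L\<^sub>X \<eta>)(Y) = X(\<eta>(Y)) - \<eta>([X, Y])\<close> for all vector fields \<open>Y\<close>.\<close>

definition lie_derivative :: "('a, 'e::euclidean_space) manifold \<Rightarrow> 'a vfield \<Rightarrow> 'a form \<Rightarrow> 'a form" where
  "lie_derivative M X \<eta> = (THE \<zeta>. \<zeta> \<in> one_forms M \<and>
     (\<forall>Y\<in>vector_fields M. \<forall>p\<in>points M.
        \<zeta> p (Y p) = X p (\<lambda>q. \<eta> q (Y q)) - \<eta> p (lie_bracket X Y p)))"

definition push_forward ::
    "('b, 'f::euclidean_space) manifold \<Rightarrow> ('a \<Rightarrow> 'b) \<Rightarrow> 'a tangent \<Rightarrow> 'b tangent" where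
  "push_forward N F v = (\<lambda>h. if h \<in> smooth_functions N then v (h \<circ> F) else 0)"

definition pull_back_at ::
    "('a, 'e::euclidean_space) manifold \<Rightarrow> ('b, 'f::euclidean_space) manifold \<Rightarrow> ('a \<Rightarrow> 'b) \<Rightarrow> 'a \<Rightarrow>
     'b cotangent \<Rightarrow> 'a cotangent" where
  "pull_back_at M N F p \<xi> = (\<lambda>v. if v \<in> tangent_space M p then \<xi> (push_forward N F v) else 0)"

definition pull_back ::
    "('a, 'e::euclidean_space) manifold \<Rightarrow> ('b, 'f::euclidean_space) manifold \<Rightarrow> ('a \<Rightarrow> 'b) \<Rightarrow>
     'b form \<Rightarrow> 'a form" where
  "pull_back M N F \<omega> = (\<lambda>p. pull_back_at M N F p (\<omega> (F p)))"

section \<open>Riemannian metrics and cometrics\<close>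

definition riemannian_metric :: "('a, 'e::euclidean_space) manifold \<Rightarrow> 'a cov_tensor \<Rightarrow> bool" where
  "riemannian_metric M gt \<longleftrightarrow>
     (\<forall>p\<in>points M. bilinear_form_on (tangent_space M p) (gt p) \<and>
        (\<forall>v\<in>tangent_space M p. \<forall>w\<in>tangent_space M p. gt p v w = gt p w v) \<and>
        (\<forall>v\<in>tangent_space M p. v \<noteq> (\<lambda>h. 0) \<longrightarrow> gt p v v > 0)) \<and>
     (\<forall>X\<in>vector_fields M. \<forall>Y\<in>vector_fields M. (\<lambda>p. gt p (X p) (Y p)) \<in> smooth_functions M)"

definition riesz :: "('a, 'e::euclidean_space) manifold \<Rightarrow> 'a cov_tensor \<Rightarrow> 'a \<Rightarrow> 'a cotangent \<Rightarrow> 'a tangent" where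
  "riesz M gt p \<xi> = (THE v. v \<in> tangent_space M p \<and> (\<forall>w\<in>tangent_space M p. gt p v w = \<xi> w))"

definition cometric :: "('a, 'e::euclidean_space) manifold \<Rightarrow> 'a cov_tensor \<Rightarrow> 'a contra_tensor" where
  "cometric M gt = (\<lambda>p \<xi> \<zeta>. gt p (riesz M gt p \<xi>) (riesz M gt p \<zeta>))"

definition app2 :: "'a contra_tensor \<Rightarrow> 'a form \<Rightarrow> 'a form \<Rightarrow> 'a \<Rightarrow> real" where
  "app2 T \<omega> \<eta> = (\<lambda>p. T p (\<omega> p) (\<eta> p))"

section \<open>Poisson tensors\<close>

definition bivector_field :: "('a, 'e::euclidean_space) manifold \<Rightarrow> 'a contra_tensor \<Rightarrow> bool" where
  "bivector_field M P \<longleftrightarrow>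
     (\<forall>p\<in>points M. bilinear_form_on (cotangent_space M p) (P p) \<and>
        (\<forall>\<xi>\<in>cotangent_space M p. P p \<xi> \<xi> = 0)) \<and>
     (\<forall>\<omega>\<in>one_forms M. \<forall>\<eta>\<in>one_forms M. app2 P \<omega> \<eta> \<in> smooth_functions M)"

text \<open>The Schouten bracket of two bivector fields, as a trivector field regarded as a
  skew-symmetric triderivation of the algebra of smooth functions: with \<open>P[F, G] = P(dF, dG)\<close>,
  \<open>[P, Q]\<^sub>S[F, G, H]\<close> is the sum over the cyclic permutations of \<open>F, G, H\<close> of
  \<open>P[Q[F, G], H] + Q[P[F, G], H]\<close>.\<close>

definition biderivation ::
    "('a, 'e::euclidean_space) manifold \<Rightarrow> 'a contra_tensor \<Rightarrow> ('a \<Rightarrow> real) \<Rightarrow> ('a \<Rightarrow> real) \<Rightarrow> 'a \<Rightarrow> real" where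
  "biderivation M P F G = app2 P (differential M F) (differential M G)"

definition schouten_bracket ::
    "('a, 'e::euclidean_space) manifold \<Rightarrow> 'a contra_tensor \<Rightarrow> 'a contra_tensor \<Rightarrow>
     ('a \<Rightarrow> real) \<Rightarrow> ('a \<Rightarrow> real) \<Rightarrow> ('a \<Rightarrow> real) \<Rightarrow> 'a \<Rightarrow> real" where
  "schouten_bracket M P Q F G H = (\<lambda>p.
       biderivation M P (biderivation M Q F G) H p + biderivation M Q (biderivation M P F G) H p
     + biderivation M P (biderivation M Q G H) F p + biderivation M Q (biderivation M P G H) F p
     + biderivation M P (biderivation M Q H F) G p + biderivation M Q (biderivation M P H F) G p)"

definition poisson_tensor :: "('a, 'e::euclidean_space) manifold \<Rightarrow> 'a contra_tensor \<Rightarrow> bool" where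
  "poisson_tensor M P \<longleftrightarrow> bivector_field M P \<and>
     (\<forall>F\<in>smooth_functions M. \<forall>G\<in>smooth_functions M. \<forall>H\<in>smooth_functions M. \<forall>p\<in>points M.
        schouten_bracket M P P F G H p = 0)"

definition sharp :: "('a, 'e::euclidean_space) manifold \<Rightarrow> 'a contra_tensor \<Rightarrow> 'a form \<Rightarrow> 'a vfield" where
  "sharp M P \<omega> = (THE X. X \<in> vector_fields M \<and>
     (\<forall>\<eta>\<in>one_forms M. \<forall>p\<in>points M. \<eta> p (X p) = app2 P \<omega> \<eta> p))"

definition koszul_bracket ::
    "('a, 'e::euclidean_space) manifold \<Rightarrow> 'a contra_tensor \<Rightarrow> 'a form \<Rightarrow> 'a form \<Rightarrow> 'a form" where
  "koszul_bracket M P \<omega> \<eta> =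
     form_diff (form_diff (lie_derivative M (sharp M P \<omega>) \<eta>) (lie_derivative M (sharp M P \<eta>) \<omega>))
       (differential M (app2 P \<omega> \<eta>))"

definition casimir :: "('a, 'e::euclidean_space) manifold \<Rightarrow> 'a contra_tensor \<Rightarrow> ('a \<Rightarrow> real) \<Rightarrow> bool" where
  "casimir M P f \<longleftrightarrow> f \<in> smooth_functions M \<and>
     (\<forall>h\<in>smooth_functions M. \<forall>p\<in>points M. app2 P (differential M h) (differential M f) p = 0)"

section \<open>Contravariant connections\<close>

definition contravariant_connection ::
    "('a, 'e::euclidean_space) manifold \<Rightarrow> 'a contra_tensor \<Rightarrow> ('a form \<Rightarrow> 'a form \<Rightarrow> 'a form) \<Rightarrow> bool" where
  "contravariant_connection M P D \<longleftrightarrow>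
     (\<forall>\<omega>\<in>one_forms M. \<forall>\<eta>\<in>one_forms M. D \<omega> \<eta> \<in> one_forms M) \<and>
     (\<forall>\<omega>\<in>one_forms M. \<forall>\<omega>'\<in>one_forms M. \<forall>\<eta>\<in>one_forms M.
        D (form_add \<omega> \<omega>') \<eta> = form_add (D \<omega> \<eta>) (D \<omega>' \<eta>) \<and>
        D \<eta> (form_add \<omega> \<omega>') = form_add (D \<eta> \<omega>) (D \<eta> \<omega>')) \<and>
     (\<forall>h\<in>smooth_functions M. \<forall>\<omega>\<in>one_forms M. \<forall>\<eta>\<in>one_forms M.
        D (form_scale h \<omega>) \<eta> = form_scale h (D \<omega> \<eta>) \<and>
        D \<omega> (form_scale h \<eta>) =
          form_add (form_scale h (D \<omega> \<eta>)) (form_scale (\<lambda>p. sharp M P \<omega> p h) \<eta>))"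

definition contravariant_levi_civita ::
    "('a, 'e::euclidean_space) manifold \<Rightarrow> 'a contra_tensor \<Rightarrow> 'a contra_tensor \<Rightarrow>
     ('a form \<Rightarrow> 'a form \<Rightarrow> 'a form) \<Rightarrow> bool" where
  "contravariant_levi_civita M P g D \<longleftrightarrow> contravariant_connection M P D \<and>
     (\<forall>\<omega>\<in>one_forms M. \<forall>\<eta>\<in>one_forms M.
        form_diff (D \<omega> \<eta>) (D \<eta> \<omega>) = koszul_bracket M P \<omega> \<eta>) \<and>
     (\<forall>\<omega>\<in>one_forms M. \<forall>\<eta>\<in>one_forms M. \<forall>\<gamma>\<in>one_forms M. \<forall>p\<in>points M.
        sharp M P \<omega> p (app2 g \<eta> \<gamma>) = app2 g (D \<omega> \<eta>) \<gamma> p + app2 g \<eta> (D \<omega> \<gamma>) p)"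

definition riemannian_poisson_manifold ::
    "('a, 'e::euclidean_space) manifold \<Rightarrow> 'a cov_tensor \<Rightarrow> 'a contra_tensor \<Rightarrow>
     ('a form \<Rightarrow> 'a form \<Rightarrow> 'a form) \<Rightarrow> bool" where
  "riemannian_poisson_manifold M gt P D \<longleftrightarrow>
     smooth_manifold M \<and> riemannian_metric M gt \<and> poisson_tensor M P \<and>
     contravariant_levi_civita M P (cometric M gt) D \<and>
     (\<forall>\<omega>\<in>one_forms M. \<forall>\<eta>\<in>one_forms M. \<forall>\<gamma>\<in>one_forms M. \<forall>p\<in>points M.
        sharp M P \<omega> p (app2 P \<eta> \<gamma>) = app2 P (D \<omega> \<eta>) \<gamma> p + app2 P \<eta> (D \<omega> \<gamma>) p)"

definition parallel :: "('a, 'e::euclidean_space) manifold \<Rightarrow> ('a form \<Rightarrow> 'a form \<Rightarrow> 'a form) \<Rightarrow> 'a form \<Rightarrow> bool" where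
  "parallel M D \<eta> \<longleftrightarrow> (\<forall>\<alpha>\<in>one_forms M. D \<alpha> \<eta> = zero_form)"

definition curvature ::
    "('a, 'e::euclidean_space) manifold \<Rightarrow> 'a contra_tensor \<Rightarrow> ('a form \<Rightarrow> 'a form \<Rightarrow> 'a form) \<Rightarrow>
     'a form \<Rightarrow> 'a form \<Rightarrow> 'a form \<Rightarrow> 'a form" where
  "curvature M P D \<omega> \<eta> \<gamma> =
     form_diff (form_diff (D \<omega> (D \<eta> \<gamma>)) (D \<eta> (D \<omega> \<gamma>))) (D (koszul_bracket M P \<omega> \<eta>) \<gamma>)"

text \<open>Local coframes near \<open>p\<close> are represented by global 1-forms that are orthonormal on some open
  neighbourhood of \<open>p\<close>; every local orthonormal coframe is of this form after shrinking its domain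
  (multiply by a cut-off function), and the curvature at \<open>p\<close> only depends on the forms near \<open>p\<close>.
  As the trace does not depend on the coframe, an arbitrary one is chosen at each point.\<close>

definition local_orthonormal_coframe ::
    "('a, 'e::euclidean_space) manifold \<Rightarrow> 'a contra_tensor \<Rightarrow> 'a \<Rightarrow> ('e \<Rightarrow> 'a form) \<Rightarrow> bool" where
  "local_orthonormal_coframe M g p \<theta> \<longleftrightarrow> (\<forall>i\<in>Basis. \<theta> i \<in> one_forms M) \<and>
     (\<exists>U. openin (mtop M) U \<and> p \<in> U \<and>
        (\<forall>q\<in>U. \<forall>i\<in>Basis. \<forall>j\<in>Basis. app2 g (\<theta> i) (\<theta> j) q = (if i = j then 1 else 0)))"

definition ricci ::
    "('a, 'e::euclidean_space) manifold \<Rightarrow> 'a contra_tensor \<Rightarrow> 'a contra_tensor \<Rightarrow>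
     ('a form \<Rightarrow> 'a form \<Rightarrow> 'a form) \<Rightarrow> 'a form \<Rightarrow> 'a form \<Rightarrow> 'a \<Rightarrow> real" where
  "ricci M P g D \<omega> \<eta> p =
     (let \<theta> = (SOME \<theta>. local_orthonormal_coframe M g p \<theta>)
      in \<Sum>i\<in>Basis. app2 g (curvature M P D \<omega> (\<theta> i) (\<theta> i)) \<eta> p)"

definition lie_derivative2 ::
    "('a, 'e::euclidean_space) manifold \<Rightarrow> 'a contra_tensor \<Rightarrow> 'a form \<Rightarrow>
     ('a form \<Rightarrow> 'a form \<Rightarrow> 'a \<Rightarrow> real) \<Rightarrow> 'a form \<Rightarrow> 'a form \<Rightarrow> 'a \<Rightarrow> real" where
  "lie_derivative2 M P \<eta> T \<alpha> \<beta> = (\<lambda>p.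
     sharp M P \<eta> p (T \<alpha> \<beta>) - T (koszul_bracket M P \<eta> \<alpha>) \<beta> p - T \<alpha> (koszul_bracket M P \<eta> \<beta>) p)"

definition two_killing ::
    "('a, 'e::euclidean_space) manifold \<Rightarrow> 'a contra_tensor \<Rightarrow> 'a contra_tensor \<Rightarrow> 'a form \<Rightarrow> bool" where
  "two_killing M P g \<eta> \<longleftrightarrow> (\<forall>\<alpha>\<in>one_forms M. \<forall>\<beta>\<in>one_forms M. \<forall>p\<in>points M.
     lie_derivative2 M P \<eta> (lie_derivative2 M P \<eta> (app2 g)) \<alpha> \<beta> p = 0)"

section \<open>Products\<close>

definition lift_h ::
    "('a, 'e::euclidean_space) manifold \<Rightarrow> ('b, 'f::euclidean_space) manifold \<Rightarrow> 'a form \<Rightarrow> ('a \<times> 'b) form" where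
  "lift_h M N \<omega> = pull_back (product_manifold M N) M fst \<omega>"

definition lift_v ::
    "('a, 'e::euclidean_space) manifold \<Rightarrow> ('b, 'f::euclidean_space) manifold \<Rightarrow> 'b form \<Rightarrow> ('a \<times> 'b) form" where
  "lift_v M N \<omega> = pull_back (product_manifold M N) N snd \<omega>"

definition warped_metric ::
    "('a, 'e::euclidean_space) manifold \<Rightarrow> ('b, 'f::euclidean_space) manifold \<Rightarrow>
     'a cov_tensor \<Rightarrow> 'b cov_tensor \<Rightarrow> ('a \<Rightarrow> real) \<Rightarrow> ('a \<times> 'b) cov_tensor" where
  "warped_metric M N gt1 gt2 f = (\<lambda>(p, q) v w.
     gt1 p (push_forward M fst v) (push_forward M fst w)
     + (f p)\<^sup>2 * gt2 q (push_forward N snd v) (push_forward N snd w))"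

text \<open>At \<open>(p, q)\<close> the product bivector is the sum of the push-forwards of the two bivectors along
  the slice inclusions \<open>x \<mapsto> (x, q)\<close> and \<open>y \<mapsto> (p, y)\<close>.\<close>

definition product_bivector ::
    "('a, 'e::euclidean_space) manifold \<Rightarrow> ('b, 'f::euclidean_space) manifold \<Rightarrow>
     'a contra_tensor \<Rightarrow> 'b contra_tensor \<Rightarrow> ('a \<times> 'b) contra_tensor" where
  "product_bivector M N P1 P2 = (\<lambda>(p, q) \<xi> \<zeta>.
     (let h = pull_back_at M (product_manifold M N) (\<lambda>x. (x, q)) p;
          v = pull_back_at N (product_manifold M N) (\<lambda>y. (p, y)) q
      in P1 p (h \<xi>) (h \<zeta>) + P2 q (v \<xi>) (v \<zeta>)))"

section \<open>Fields vanish off the manifold\<close>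

lemma Ck_on_const_on:
  assumes "open S" and "\<And>x. x \<in> S \<Longrightarrow> f x = c"
  shows "Ck_on k S f"
  using assms(2)
proof (induction k arbitrary: f c)
  case 0
  have "continuous_on S f \<longleftrightarrow> continuous_on S (\<lambda>x. c)"
    by (rule continuous_on_cong[OF refl]) (rule 0)
  then show ?case by simp
next
  case (Suc k)
  have der: "(f has_derivative (\<lambda>v. 0)) (at x)" if "x \<in> S" for x
  proof (rule has_derivative_transform_within_open[OF _ \<open>open S\<close> that])
    show "((\<lambda>x. c) has_derivative (\<lambda>v. 0)) (at x)" by (rule has_derivative_const)
    show "c = f y" if "y \<in> S" for y by (rule Suc.prems[OF that, symmetric])
  qed
  have "Ck_on k S (\<lambda>x. frechet_derivative f (at x) v)" for v
  proof (rule Suc.IH)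
    show "frechet_derivative f (at x) v = 0" if "x \<in> S" for x
      by (simp only: frechet_derivative_at[OF der[OF that], symmetric])
  qed
  moreover have "f differentiable (at x)" if "x \<in> S" for x
    by (rule differentiableI) (rule der[OF that])
  ultimately show ?case by simp
qed

lemma smooth_functions_if_const_on:
  assumes "smooth_manifold M" and h: "\<And>x. x \<in> points M \<Longrightarrow> h x = c"
  shows "h \<in> smooth_functions M"
proof -
  have "smooth_on (\<phi> ` U) (h \<circ> inv_into U \<phi>)" if "(U, \<phi>) \<in> atlas M" for U \<phi>
  proof -
    have "\<forall>(U, \<phi>)\<in>atlas M. openin (mtop M) U \<and> open (\<phi> ` U) \<and>
        homeomorphic_map (subtopology (mtop M) U) (top_of_set (\<phi> ` U)) \<phi>"
      using assms(1) unfolding smooth_manifold_def by (elim conjE)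
    then have oU: "openin (mtop M) U" and o: "open (\<phi> ` U)"
      using bspec[OF _ that] by fast+
    have U: "U \<subseteq> points M" by (rule openin_subset[OF oU])
    have "(h \<circ> inv_into U \<phi>) y = c" if "y \<in> \<phi> ` U" for y
      using h[OF subsetD[OF U inv_into_into[OF that]]] by (simp only: o_apply)
    then show ?thesis
      unfolding smooth_on_def using Ck_on_const_on[OF o] by blast
  qed
  then show ?thesis unfolding smooth_functions_def by blast
qed

lemma tangent_space_outside:
  assumes M: "smooth_manifold M" and p: "p \<notin> points M"
  shows "tangent_space M p = {\<lambda>h. 0}"
proof -
  have "v h = 0" if v: "v \<in> tangent_space M p" for v h
  proof (cases "h \<in> smooth_functions M")
    case False
    have "\<forall>u. u \<notin> smooth_functions M \<longrightarrow> v u = 0"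
      using v unfolding tangent_space_def dual_def by (elim CollectE conjE)
    then show ?thesis using False by blast
  next
    case True
    define e :: "'a \<Rightarrow> real" where "e = (\<lambda>x. if x = p then 0 else 1)"
    define d :: "'a \<Rightarrow> real" where "d = (\<lambda>x. if x = p then 1 else 0)"
    have e: "e \<in> smooth_functions M" and d: "d \<in> smooth_functions M"
      unfolding e_def d_def
      by (rule smooth_functions_if_const_on[OF M, where c = 1], use p in auto,
          rule smooth_functions_if_const_on[OF M, where c = 0], use p in auto)
    have lin: "linear_functional_on (smooth_functions M) v"
      using v unfolding tangent_space_def dual_def by (elim CollectE conjE)
    have leibniz: "v (\<lambda>x. a x * b x) = a p * v b + b p * v a"
      if "a \<in> smooth_functions M" "b \<in> smooth_functions M" for a b
    proof -
      have "\<forall>h\<in>smooth_functions M. \<forall>k\<in>smooth_functions M.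
          v (\<lambda>x. h x * k x) = h p * v k + k p * v h"
        using v unfolding tangent_space_def by (elim CollectE conjE)
      then show ?thesis by (rule bspec[OF bspec[OF _ that(1)] that(2)])
    qed
    have *: "(\<lambda>x. e x * e x) = e" "e p = 0" "(\<lambda>x. d x * d x) = d" "d p = 1"
      by (auto simp: e_def d_def)
    then have ee: "v e = 0" and dd: "v d = 0"
      using leibniz[OF e e] leibniz[OF d d] by simp_all
    have he: "v (\<lambda>x. h x * e x) = 0"
      using leibniz[OF True e] ee *(2) by simp
    have hes: "(\<lambda>x. 1 * h x + (- h p) * d x) = (\<lambda>x. h x * e x)"
      by (auto simp: e_def d_def)
    have "v (\<lambda>x. 1 * h x + (- h p) * d x) = 1 * v h + (- h p) * v d"
      by (rule lin[unfolded linear_functional_on_def, rule_format, OF True d])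
    then show ?thesis using he dd unfolding hes by simp
  qed
  then have "tangent_space M p \<subseteq> {\<lambda>h. 0}"
    unfolding subset_iff singleton_iff fun_eq_iff by (intro allI impI)
  moreover have "linear_functional_on V (\<lambda>h. 0)" for V :: "('a \<Rightarrow> real) set"
    unfolding linear_functional_on_def by simp
  then have "(\<lambda>h. 0) \<in> tangent_space M p"
    unfolding tangent_space_def dual_def by simp
  ultimately show ?thesis by (intro equalityI) simp_all
qed

end

(* On M_i write R for the curvature.  If eta is 2-Killing and D_eta eta = 0, then expanding
   L_eta L_eta g (alpha, alpha) = 0 gives g(R(eta, alpha) eta, alpha) = - |D_alpha eta|^2.  As R(eta, alpha) is
   skew-symmetric (the anchor sharp is a homomorphism of brackets), the trace is Ric(eta, eta) = sum_i |D_theta_i eta|^2,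
   so Ric(eta, eta) <= 0 forces D eta = 0.

   On the warped product the Koszul formula, evaluated on lifts of exact forms, shows that D is the lift of D^1 and D^2
   and that the mixed terms vanish; the derivatives of the warping function drop out because f is a Casimir function.
   Tensoriality extends this from exact forms to all forms, so lifts of parallel forms are parallel. *)

theory Submission
  imports Defs
begin

section \<open>Smooth maps between Euclidean spaces\<close>

text \<open>Vector fields, 1-forms and \<open>D\<close> exist only as global objects, while the
  arguments are pointwise or in a chart. Cut-off functions bridge the two: they make derivations
  local, provide global fields that restrict to a given local frame, and show that an expression
  linear over the smooth functions sees a form only through its value at the point. This is what the
  calculus at the beginning is for. Exact forms are singled out for two reasons. Every covector is
  the value of a differential, so tensorial identities need only be checked on differentials. And
  \<open>koszul_bracket\<close> rests on definite descriptions, which for differentials can be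
  evaluated and give d{F, G}; for other forms torsion-freeness rewrites the bracket as a difference
  of two values of \<open>D\<close>. The warped cometric contains f only as the factor f^-2 on pairs
  of vertical lifts. Hence f can disturb the Koszul formula only through the derivative of f^-2
  along a horizontal sharp, and this is what the Casimir condition annihilates.\<close>

lemma Ck_on_SucD: "Ck_on (Suc k) S f \<Longrightarrow> Ck_on k S f"
proof (induction k arbitrary: f)
  case 0
  then show ?case
    by (auto intro!: continuous_at_imp_continuous_on differentiable_imp_continuous_within)
qed auto

lemma Ck_on_imp_continuous_on: "Ck_on k S f \<Longrightarrow> continuous_on S f"
proof (induction k)
  case (Suc k)
  then show ?case using Ck_on_SucD by blast
qed simp

lemma Ck_on_subset: "Ck_on k T f \<Longrightarrow> S \<subseteq> T \<Longrightarrow> Ck_on k S f"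
  by (induction k arbitrary: f) (auto intro: continuous_on_subset)

lemma frechet_derivative_eqI:
  "(f has_derivative f') (at x) \<Longrightarrow> frechet_derivative f (at x) v = f' v"
  using frechet_derivative_at by metis

text \<open>Openness of \<open>S\<close> is essential: a derivative at a point of \<open>S\<close>
  depends on the values in a whole neighbourhood.\<close>

lemma Ck_on_cong:
  assumes "open S" and "\<And>x. x \<in> S \<Longrightarrow> f x = g x" and "Ck_on k S f"
  shows "Ck_on k S g"
  using assms(2,3)
proof (induction k arbitrary: f g)
  case 0
  then show ?case using continuous_on_cong by fastforce
next
  case (Suc k)
  have "(g has_derivative frechet_derivative f (at x)) (at x)" if "x \<in> S" for x
    using has_derivative_transform_within_open[OF _ \<open>open S\<close> that, of f _ UNIV g]
      Suc.prems that frechet_derivative_works[of f "at x"] by auto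
  then have "g differentiable (at x) \<and> frechet_derivative g (at x) = frechet_derivative f (at x)"
    if "x \<in> S" for x
    using that by (auto intro: differentiableI simp: frechet_derivative_eqI)
  then show ?case
    using Suc.prems(2) Suc.IH[of "\<lambda>x. frechet_derivative f (at x) v" "\<lambda>x. frechet_derivative g (at x) v" for v]
    by simp
qed

text \<open>Lets the inductions below work with an explicit derivative \<open>f'\<close>; uniqueness
  of derivatives identifies it with the chosen \<open>frechet_derivative\<close> on
  \<open>S\<close>.\<close>

lemma Ck_on_has_derivativeI:
  assumes "open S" "\<And>x. x \<in> S \<Longrightarrow> (f has_derivative f' x) (at x)"
    and "\<And>v. Ck_on k S (\<lambda>x. f' x v)"
  shows "Ck_on (Suc k) S f"
proof -
  have "Ck_on k S (\<lambda>x. frechet_derivative f (at x) v)" for v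
    by (rule Ck_on_cong[OF assms(1) _ assms(3)[of v]]) (simp add: assms(2)[THEN frechet_derivative_eqI])
  then show ?thesis using assms(2) by (auto intro: differentiableI)
qed

lemma Ck_on_has_derivative:
  "Ck_on (Suc k) S f \<Longrightarrow> x \<in> S \<Longrightarrow> (f has_derivative frechet_derivative f (at x)) (at x)"
  using frechet_derivative_works by auto

lemma Ck_on_local:
  assumes "\<And>x. x \<in> S \<Longrightarrow> \<exists>T. open T \<and> x \<in> T \<and> Ck_on k T f"
  shows "Ck_on k S f"
  using assms
proof (induction k arbitrary: f)
  case 0
  then show ?case
    using continuous_on_eq_continuous_at by (fastforce intro!: continuous_at_imp_continuous_on)
next
  case (Suc k)
  have "Ck_on k S (\<lambda>x. frechet_derivative f (at x) v)" for v
    using Suc.prems by (intro Suc.IH) (fastforce simp: Ck_on.simps(2))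
  then show ?case using Suc.prems by fastforce
qed

lemma Ck_on_const: "Ck_on k S (\<lambda>x. c)"
  by (induction k arbitrary: c) auto

lemma Ck_on_bounded_linear:
  assumes "bounded_linear f"
  shows "Ck_on k S f"
proof (cases k)
  case 0
  then show ?thesis using assms linear_continuous_on by auto
next
  case (Suc m)
  have "(\<lambda>x. frechet_derivative f (at x) v) = (\<lambda>x. f v)" for v
    using bounded_linear_imp_has_derivative[OF assms] by (auto simp: frechet_derivative_eqI)
  then show ?thesis
    using assms Suc by (auto simp: Ck_on_const intro: bounded_linear_imp_differentiable)
qed

lemma Ck_on_add:
  assumes "open S" "Ck_on k S f" "Ck_on k S g"
  shows "Ck_on k S (\<lambda>x. f x + g x)"
  using assms(2,3)
proof (induction k arbitrary: f g)
  case 0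
  then show ?case by (auto intro: continuous_intros)
next
  case (Suc k)
  show ?case
  proof (rule Ck_on_has_derivativeI[OF \<open>open S\<close>])
    show "((\<lambda>x. f x + g x) has_derivative
        (\<lambda>v. frechet_derivative f (at x) v + frechet_derivative g (at x) v)) (at x)" if "x \<in> S" for x
      using Suc.prems that by (auto intro!: has_derivative_add Ck_on_has_derivative simp del: Ck_on.simps)
  qed (use Suc in auto)
qed

text \<open>By the Leibniz rule the derivative is a sum of two products of the same kind, one order
  lower, so the induction closes. Multiplication, scaling and the inner product are all
  instances.\<close>

lemma (in bounded_bilinear) Ck_on:
  assumes "open S" "Ck_on k S f" "Ck_on k S g"
  shows "Ck_on k S (\<lambda>x. prod (f x) (g x))"
  using assms(2,3)
proof (induction k arbitrary: f g)
  case 0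
  then show ?case by (auto intro: continuous_on)
next
  case (Suc k)
  show ?case
  proof (rule Ck_on_has_derivativeI[OF \<open>open S\<close>])
    show "((\<lambda>x. prod (f x) (g x)) has_derivative
        (\<lambda>v. prod (f x) (frechet_derivative g (at x) v) + prod (frechet_derivative f (at x) v) (g x))) (at x)"
      if "x \<in> S" for x
      using Suc.prems that by (auto intro!: FDERIV Ck_on_has_derivative simp del: Ck_on.simps)
    show "Ck_on k S (\<lambda>x. prod (f x) (frechet_derivative g (at x) v) + prod (frechet_derivative f (at x) v) (g x))" for v
      using Suc.prems Suc.prems[THEN Ck_on_SucD] by (intro Ck_on_add[OF \<open>open S\<close>] Suc.IH) auto
  qed
qed

lemmas Ck_on_mult = bounded_bilinear.Ck_on[OF bounded_bilinear_mult]
lemmas Ck_on_scaleR = bounded_bilinear.Ck_on[OF bounded_bilinear_scaleR]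

lemma Ck_on_sum:
  assumes "open S" "\<And>i. i \<in> A \<Longrightarrow> Ck_on k S (f i)"
  shows "Ck_on k S (\<lambda>x. \<Sum>i\<in>A. f i x)"
  using assms(2)
  by (induction A rule: infinite_finite_induct) (auto intro: Ck_on_const Ck_on_add[OF assms(1)])

lemma Ck_on_compose:
  fixes f :: "'a::real_normed_vector \<Rightarrow> 'b::euclidean_space"
    and g :: "'b \<Rightarrow> 'c::real_normed_vector"
  assumes "open S" "open T" "f ` S \<subseteq> T" "Ck_on k S f" "Ck_on k T g"
  shows "Ck_on k S (\<lambda>x. g (f x))"
  using assms(4,5)
proof (induction k arbitrary: g)
  case 0
  then show ?case using assms(3) continuous_on_compose2 by auto
next
  case (Suc k)
  have der: "((\<lambda>x. g (f x)) has_derivative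
      (\<lambda>v. frechet_derivative g (at (f x)) (frechet_derivative f (at x) v))) (at x)"
    if "x \<in> S" for x
    using that assms(3)
    by (intro has_derivative_compose[of f _ x UNIV g] Ck_on_has_derivative[OF Suc.prems(1)]
        Ck_on_has_derivative[OF Suc.prems(2)]) auto
  \<comment> \<open>\<open>Ck_on\<close> controls derivatives in a fixed direction only, but here
    the direction moves with \<open>x\<close>. Expanding it in \<open>Basis\<close> leaves
    derivatives of \<open>g\<close> in constant directions, composed with \<open>f\<close>, to which
    the induction hypothesis applies.\<close>
  have eq: "frechet_derivative g (at (f x)) (frechet_derivative f (at x) v) =
      (\<Sum>b\<in>Basis. (frechet_derivative f (at x) v \<bullet> b) *\<^sub>R frechet_derivative g (at (f x)) b)"
    if "x \<in> S" for x v
  proof -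
    have "linear (frechet_derivative g (at (f x)))"
      using Suc.prems(2) that assms(3) by (auto intro: linear_frechet_derivative)
    then have "frechet_derivative g (at (f x)) (\<Sum>b\<in>Basis. (frechet_derivative f (at x) v \<bullet> b) *\<^sub>R b) =
        (\<Sum>b\<in>Basis. (frechet_derivative f (at x) v \<bullet> b) *\<^sub>R frechet_derivative g (at (f x)) b)"
      by (simp only: linear_sum linear_cmul)
    then show ?thesis by (simp only: euclidean_representation)
  qed
  show ?case
  proof (rule Ck_on_has_derivativeI[OF \<open>open S\<close> der])
    fix v
    have "Ck_on k S (\<lambda>x. frechet_derivative f (at x) v \<bullet> b)" for b
      using Suc.prems(1) by (intro bounded_bilinear.Ck_on[OF bounded_bilinear_inner] assms Ck_on_const) auto
    moreover have "Ck_on k S (\<lambda>x. frechet_derivative g (at (f x)) b)" for b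
      using Suc.prems Suc.prems(1)[THEN Ck_on_SucD] by (intro Suc.IH) auto
    ultimately have "Ck_on k S (\<lambda>x. \<Sum>b\<in>Basis.
        (frechet_derivative f (at x) v \<bullet> b) *\<^sub>R frechet_derivative g (at (f x)) b)"
      using assms by (intro Ck_on_sum Ck_on_scaleR)
    then show "Ck_on k S (\<lambda>x. frechet_derivative g (at (f x)) (frechet_derivative f (at x) v))"
      by (rule Ck_on_cong[OF assms(1), rotated]) (simp add: eq)
  qed
qed

lemma smooth_on_subset: "smooth_on T f \<Longrightarrow> S \<subseteq> T \<Longrightarrow> smooth_on S f"
  unfolding smooth_on_def using Ck_on_subset by blast

lemma smooth_on_cong: "open S \<Longrightarrow> (\<And>x. x \<in> S \<Longrightarrow> f x = g x) \<Longrightarrow> smooth_on S f \<Longrightarrow> smooth_on S g"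
  unfolding smooth_on_def using Ck_on_cong by blast

lemma smooth_on_local:
  assumes "\<And>x. x \<in> S \<Longrightarrow> \<exists>T. open T \<and> x \<in> T \<and> smooth_on T f"
  shows "smooth_on S f"
proof -
  have "Ck_on k S f" for k
    by (rule Ck_on_local) (use assms[unfolded smooth_on_def] in meson)
  then show ?thesis unfolding smooth_on_def ..
qed

lemma smooth_on_const: "smooth_on S (\<lambda>x. c)"
  unfolding smooth_on_def using Ck_on_const by blast

lemma smooth_on_bounded_linear: "bounded_linear f \<Longrightarrow> smooth_on S f"
  unfolding smooth_on_def using Ck_on_bounded_linear by blast

lemma smooth_on_add: "open S \<Longrightarrow> smooth_on S f \<Longrightarrow> smooth_on S g \<Longrightarrow> smooth_on S (\<lambda>x. f x + g x)"
  unfolding smooth_on_def using Ck_on_add by blast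

lemma smooth_on_mult:
  fixes f g :: "'a::real_normed_vector \<Rightarrow> real"
  shows "open S \<Longrightarrow> smooth_on S f \<Longrightarrow> smooth_on S g \<Longrightarrow> smooth_on S (\<lambda>x. f x * g x)"
  unfolding smooth_on_def using Ck_on_mult by blast

lemma smooth_on_compose:
  fixes f :: "'a::real_normed_vector \<Rightarrow> 'b::euclidean_space"
    and g :: "'b \<Rightarrow> 'c::real_normed_vector"
  shows "open S \<Longrightarrow> open T \<Longrightarrow> f ` S \<subseteq> T \<Longrightarrow> smooth_on S f \<Longrightarrow> smooth_on T g \<Longrightarrow>
    smooth_on S (\<lambda>x. g (f x))"
  unfolding smooth_on_def using Ck_on_compose by blast

lemma smooth_on_frechet_derivative: "smooth_on S f \<Longrightarrow> smooth_on S (\<lambda>x. frechet_derivative f (at x) v)"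
  unfolding smooth_on_def by (metis Ck_on.simps(2))

lemma smooth_on_has_derivative:
  "smooth_on S f \<Longrightarrow> x \<in> S \<Longrightarrow> (f has_derivative frechet_derivative f (at x)) (at x)"
  unfolding smooth_on_def by (metis Ck_on_has_derivative)

lemma smooth_on_imp_continuous_on: "smooth_on S f \<Longrightarrow> continuous_on S f"
  unfolding smooth_on_def using Ck_on_imp_continuous_on by blast

section \<open>Special smooth functions of one variable\<close>

lemma Ck_on_has_real_derivativeI:
  fixes f :: "real \<Rightarrow> real"
  assumes "open S" "\<And>x. x \<in> S \<Longrightarrow> (f has_real_derivative f' x) (at x)" "Ck_on k S f'"
  shows "Ck_on (Suc k) S f"
proof (rule Ck_on_has_derivativeI[OF assms(1)])
  show "(f has_derivative (*) (f' x)) (at x)" if "x \<in> S" for x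
    using assms(2)[OF that] by (simp add: has_field_derivative_def)
  show "Ck_on k S (\<lambda>x. f' x * v)" for v
    using assms(1,3) by (rule Ck_on_mult) (rule Ck_on_const)
qed

text \<open>The derivative is a polynomial in the function itself, -1 times its square, so each
  order of differentiability yields the next. The same device works for
  \<open>inverse (sqrt x)\<close>, whose derivative is -1/2 times its cube.\<close>

lemma smooth_on_inverse: "smooth_on (- {0}) (inverse :: real \<Rightarrow> real)"
proof -
  have "Ck_on k (- {0}) (inverse :: real \<Rightarrow> real)" for k
  proof (induction k)
    case 0
    then show ?case by (auto intro: continuous_intros)
  next
    case (Suc k)
    have "Ck_on k (- {0}) (\<lambda>x::real. (-1) * (inverse x * inverse x))"
      using Suc by (intro Ck_on_mult Ck_on_const) auto
    then show ?case
      by (rule Ck_on_has_real_derivativeI[rotated 2]) (auto intro!: derivative_eq_intros simp: power2_eq_square)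
  qed
  then show ?thesis unfolding smooth_on_def by blast
qed

lemma smooth_on_inverse_sqrt: "smooth_on {0<..} (\<lambda>x::real. inverse (sqrt x))"
proof -
  have "Ck_on k {0<..} (\<lambda>x::real. inverse (sqrt x))" for k
  proof (induction k)
    case 0
    then show ?case by (auto intro!: continuous_intros)
  next
    case (Suc k)
    have "Ck_on k {0<..} (\<lambda>x::real. (-1/2) * (inverse (sqrt x) * (inverse (sqrt x) * inverse (sqrt x))))"
      using Suc by (intro Ck_on_mult Ck_on_const) auto
    then show ?case
      by (rule Ck_on_has_real_derivativeI[rotated 2])
        (auto intro!: derivative_eq_intros simp: field_simps)
  qed
  then show ?thesis unfolding smooth_on_def by blast
qed

text \<open>The classical function exp(-1/t), flat at 0, with additional weights t^-n. The weights
  make the family closed under differentiation up to linear combinations, so that one induction over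
  all \<open>n\<close> gives smoothness.\<close>

definition flat :: "nat \<Rightarrow> real \<Rightarrow> real" where
  "flat n t = (if t \<le> 0 then 0 else inverse t ^ n * exp (- inverse t))"

text \<open>With u = 1/t this is the growth comparison u^n / exp u -> 0 at infinity.\<close>

lemma flat_tendsto_0: "(flat n \<longlongrightarrow> 0) (at_right 0)"
proof -
  have "((\<lambda>t. inverse t ^ n / exp (inverse t)) \<longlongrightarrow> (0::real)) (at_right 0)"
    by (rule filterlim_compose[OF tendsto_power_div_exp_0 filterlim_inverse_at_top_right])
  then show ?thesis
    by (rule tendsto_cong[THEN iffD1, rotated])
      (auto simp: flat_def eventually_at_filter exp_minus divide_inverse)
qed

lemma flat_has_derivative:
  "(flat n has_real_derivative flat (n + 2) t - real n * flat (n + 1) t) (at t)"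
proof -
  consider "t < 0" | "t = 0" | "t > 0" by linarith
  then show ?thesis
  proof cases
    case 1
    have "((\<lambda>t. 0) has_real_derivative flat (n + 2) t - real n * flat (n + 1) t) (at t)"
      using 1 by (simp add: flat_def)
    then show ?thesis
      by (rule has_field_derivative_transform_within_open[where S = "{..<0}"]) (use 1 in \<open>auto simp: flat_def\<close>)
  next
    case 2
    \<comment> \<open>For positive \<open>h\<close> the difference quotient at 0 is again a member
      of the family, \<open>flat (Suc n) h\<close>; for negative \<open>h\<close> it is 0.\<close>
    have "((\<lambda>h. (flat n (0 + h) - flat n 0) / h) \<longlongrightarrow> 0) (at 0)"
      unfolding filterlim_at_split
    proof
      show "((\<lambda>h. (flat n (0 + h) - flat n 0) / h) \<longlongrightarrow> 0) (at_left 0)"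
        by (rule tendsto_eventually) (auto simp: flat_def eventually_at_filter)
      show "((\<lambda>h. (flat n (0 + h) - flat n 0) / h) \<longlongrightarrow> 0) (at_right 0)"
        by (rule tendsto_cong[THEN iffD1, OF _ flat_tendsto_0[of "Suc n"]])
          (auto simp: flat_def eventually_at_filter divide_inverse)
    qed
    then show ?thesis using 2 by (simp add: DERIV_def flat_def)
  next
    case 3
    have "((\<lambda>t. inverse t ^ n * exp (- inverse t)) has_real_derivative
        inverse t ^ n * (exp (- inverse t) * (inverse t * inverse t))
        - real n * inverse t ^ (n - 1) * (inverse t * inverse t) * exp (- inverse t)) (at t)"
      using 3 by (auto intro!: derivative_eq_intros)
    \<comment> \<open>For \<open>n = 0\<close> the truncated exponent \<open>n - 1\<close> is 0
      instead of -1, which the factor \<open>real n\<close> makes harmless.\<close>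
    also have "real n * inverse t ^ (n - 1) * (inverse t * inverse t) = real n * inverse t ^ (n + 1)"
      by (cases n) auto
    also have "inverse t ^ n * (exp (- inverse t) * (inverse t * inverse t)) - real n * inverse t ^ (n + 1) * exp (- inverse t) =
        flat (n + 2) t - real n * flat (n + 1) t"
      using 3 by (simp add: flat_def)
    finally have "((\<lambda>t. inverse t ^ n * exp (- inverse t)) has_real_derivative
        flat (n + 2) t - real n * flat (n + 1) t) (at t)" .
    then show ?thesis
      by (rule has_field_derivative_transform_within_open[where S = "{0<..}"]) (use 3 in \<open>auto simp: flat_def\<close>)
  qed
qed

lemma smooth_on_flat: "smooth_on UNIV (flat n)"
proof -
  have "Ck_on k UNIV (flat n)" for k
  proof (induction k arbitrary: n)
    case 0
    then show ?case
      using flat_has_derivative by (auto intro!: continuous_at_imp_continuous_on dest: DERIV_isCont)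
  next
    case (Suc k)
    have "Ck_on k UNIV (\<lambda>t. flat (n + 2) t + (- real n) * flat (n + 1) t)"
      using Suc by (intro Ck_on_add Ck_on_mult Ck_on_const) auto
    then show ?case
      using flat_has_derivative by (intro Ck_on_has_real_derivativeI[where f' = "\<lambda>t. flat (n + 2) t + (- real n) * flat (n + 1) t"]) auto
  qed
  then show ?thesis unfolding smooth_on_def by blast
qed

text \<open>The quotient a/(a + b) with a = exp(-1/(1 - t)) and b = exp(-1/(t - 1/2)), each
  continued by 0. The denominator never vanishes, since 1 - t or t - 1/2 is positive for every
  t.\<close>

lemma smooth_step_exists:
  "\<exists>\<beta>::real \<Rightarrow> real. smooth_on UNIV \<beta> \<and> (\<forall>t\<le>1/2. \<beta> t = 1) \<and> (\<forall>t\<ge>1. \<beta> t = 0)"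
proof (intro exI[of _ "\<lambda>t. flat 0 (1 - t) * inverse (flat 0 (1 - t) + flat 0 (t - 1/2))"] conjI)
  have s: "smooth_on UNIV (\<lambda>t. flat 0 (a + b * t))" for a b
    by (rule smooth_on_compose[OF _ _ _ _ smooth_on_flat])
      (intro smooth_on_add smooth_on_const smooth_on_bounded_linear bounded_linear_mult_right | simp)+
  have s1: "smooth_on UNIV (\<lambda>t. flat 0 (1 - t))" using s[of 1 "-1"] by simp
  have s2: "smooth_on UNIV (\<lambda>t. flat 0 (t - 1/2))" using s[of "-1/2" 1] by simp
  have "flat 0 (1 - t) + flat 0 (t - 1/2) \<noteq> 0" for t
    by (auto simp: flat_def add_pos_pos less_imp_neq[symmetric])
  then have "smooth_on UNIV (\<lambda>t. inverse (flat 0 (1 - t) + flat 0 (t - 1/2)))"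
    by (intro smooth_on_compose[OF _ _ _ _ smooth_on_inverse] smooth_on_add s1 s2) auto
  then show "smooth_on UNIV (\<lambda>t. flat 0 (1 - t) * inverse (flat 0 (1 - t) + flat 0 (t - 1/2)))"
    by (intro smooth_on_mult s1) auto
qed (auto simp: flat_def)

section \<open>Hadamard's lemma\<close>

lemma convex_segment:
  assumes "convex S" "a \<in> S" "y \<in> S" "t \<in> {0..1}"
  shows "a + t *\<^sub>R (y - a) \<in> S"
proof -
  have "(1 - t) *\<^sub>R a + t *\<^sub>R y \<in> S" using assms by (intro convexD) auto
  then show ?thesis by (simp add: algebra_simps)
qed

lemma continuous_on_segment:
  fixes F :: "'e::real_normed_vector \<Rightarrow> 'b::real_normed_vector"
  assumes "convex S" "a \<in> S" "continuous_on {0..1} w" "continuous_on S F"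
  shows "continuous_on (S \<times> {0..1}) (\<lambda>(y, t). w t *\<^sub>R F (a + t *\<^sub>R (y - a)))"
proof -
  have "continuous_on (S \<times> {0..1}) (\<lambda>z. F (a + snd z *\<^sub>R (fst z - a)))"
    by (rule continuous_on_compose2[OF assms(4)])
      (auto intro!: continuous_intros convex_segment[OF assms(1,2), simplified])
  moreover have "continuous_on (S \<times> {0..1}) (\<lambda>z. w (snd z))"
    by (rule continuous_on_compose2[OF assms(3)]) (auto intro!: continuous_intros)
  ultimately show ?thesis
    unfolding split_def by (intro continuous_on_scaleR)
qed

lemma integrable_on_segment:
  fixes F :: "'e::real_normed_vector \<Rightarrow> 'b::banach"
  assumes "convex S" "a \<in> S" "continuous_on {0..1} w" "continuous_on S F" "y \<in> S"
  shows "(\<lambda>t. w t *\<^sub>R F (a + t *\<^sub>R (y - a))) integrable_on {0..1}"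
proof -
  have "continuous_on {0..1} (\<lambda>t. case (y, t) of (y, t) \<Rightarrow> w t *\<^sub>R F (a + t *\<^sub>R (y - a)))"
    by (rule continuous_on_compose2[OF continuous_on_segment[OF assms(1-4)]])
      (use assms(5) in \<open>auto intro!: continuous_intros\<close>)
  then show ?thesis by (simp add: integrable_continuous_real)
qed

text \<open>The weight \<open>w\<close> is needed for the induction: differentiating under the integral produces a factor \<open>t\<close>.\<close>

lemma Ck_on_segment_integral:
  fixes F :: "'e::euclidean_space \<Rightarrow> real"
  assumes "open S" "convex S" "a \<in> S" "continuous_on {0..1} w" "Ck_on k S F"
  shows "Ck_on k S (\<lambda>y. integral {0..1} (\<lambda>t. w t * F (a + t *\<^sub>R (y - a))))"
  using assms(4,5)
proof (induction k arbitrary: w F)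
  case (0 w F)
  then have "continuous_on (S \<times> cbox 0 1) (\<lambda>(y, t). w t * F (a + t *\<^sub>R (y - a)))"
    using continuous_on_segment[OF assms(2,3), of w F] by simp
  from integral_continuous_on_param[OF this] show ?case by simp
next
  case (Suc k w F)
  note seg = convex_segment[OF assms(2,3)]
  have cont: "continuous_on S F"
    using Suc.prems(2) by (rule Ck_on_imp_continuous_on)
  have contD: "continuous_on S (\<lambda>y. frechet_derivative F (at y) v)" for v
    using Suc.prems(2) by (auto intro: Ck_on_imp_continuous_on)
  have F: "(F has_derivative frechet_derivative F (at z)) (at z)" if "z \<in> S" for z
    using Ck_on_has_derivative[OF Suc.prems(2) that] .
  \<comment> \<open>\<open>leibniz_rule\<close> asks for a derivative that depends continuously on
    the point as a bounded linear map. In finite dimension this follows from continuity in each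
    fixed direction, which is what \<open>Ck_on\<close> provides.\<close>
  define dF where "dF z = Blinfun (frechet_derivative F (at z))" for z
  have dF: "blinfun_apply (dF z) = frechet_derivative F (at z)" if "z \<in> S" for z
    unfolding dF_def using F[OF that] has_derivative_bounded_linear bounded_linear_Blinfun_apply by blast
  have cdF: "continuous_on S dF"
    by (rule continuous_on_blinfun_componentwise)
      (rule continuous_on_cong[THEN iffD1, OF refl _ contD], simp add: dF)
  show ?case
  proof (rule Ck_on_has_derivativeI[OF \<open>open S\<close>])
    fix y assume y: "y \<in> S"
    have "((\<lambda>y. integral (cbox 0 1) (\<lambda>t. w t * F (a + t *\<^sub>R (y - a)))) has_derivative
        integral (cbox 0 1) (\<lambda>t. (w t * t) *\<^sub>R dF (a + t *\<^sub>R (y - a)))) (at y within S)"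
    proof (rule leibniz_rule[OF _ _ _ y \<open>convex S\<close>])
      fix z and t :: real assume z: "z \<in> S" "t \<in> cbox 0 1"
      show "((\<lambda>z. w t * F (a + t *\<^sub>R (z - a))) has_derivative
          blinfun_apply ((w t * t) *\<^sub>R dF (a + t *\<^sub>R (z - a)))) (at z within S)"
      proof -
        have zz: "a + t *\<^sub>R (z - a) \<in> S" using seg z by auto
        have lin: "linear (frechet_derivative F (at (a + t *\<^sub>R (z - a))))"
          using F[OF zz] has_derivative_linear by blast
        have "((\<lambda>z. F (a + t *\<^sub>R (z - a))) has_derivative
            (\<lambda>v. frechet_derivative F (at (a + t *\<^sub>R (z - a))) (t *\<^sub>R v))) (at z within S)"
          by (rule has_derivative_compose[of "\<lambda>z. a + t *\<^sub>R (z - a)" _ z _ F, OF _ F[OF zz]])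
            (auto intro!: derivative_eq_intros)
        then have "((\<lambda>z. w t * F (a + t *\<^sub>R (z - a))) has_derivative
            (\<lambda>v. w t * frechet_derivative F (at (a + t *\<^sub>R (z - a))) (t *\<^sub>R v))) (at z within S)"
          by (rule has_derivative_mult_right)
        then show ?thesis
          by (rule has_derivative_eq_rhs)
            (auto simp: fun_eq_iff blinfun.scaleR_left dF[OF zz] linear_cmul[OF lin])
      qed
    next
      fix z assume "z \<in> S"
      then show "(\<lambda>t. w t * F (a + t *\<^sub>R (z - a))) integrable_on cbox 0 1"
        using integrable_on_segment[OF assms(2,3) Suc.prems(1) cont] by simp
    next
      show "continuous_on (S \<times> cbox 0 1) (\<lambda>(z, t). (w t * t) *\<^sub>R dF (a + t *\<^sub>R (z - a)))"
        using continuous_on_segment[OF assms(2,3) _ cdF, of "\<lambda>t. w t * t"] Suc.prems(1)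
        by (simp add: continuous_intros)
    qed
    then show "((\<lambda>y. integral {0..1} (\<lambda>t. w t * F (a + t *\<^sub>R (y - a)))) has_derivative
        blinfun_apply (integral {0..1} (\<lambda>t. (w t * t) *\<^sub>R dF (a + t *\<^sub>R (y - a))))) (at y)"
      using at_within_open[OF y \<open>open S\<close>] by (simp add: box_real)
  next
    fix v
    have "Ck_on k S (\<lambda>y. integral {0..1} (\<lambda>t. (w t * t) * frechet_derivative F (at (a + t *\<^sub>R (y - a))) v))"
      using Suc.prems by (intro Suc.IH continuous_intros) auto
    then show "Ck_on k S (\<lambda>y. blinfun_apply (integral {0..1} (\<lambda>t. (w t * t) *\<^sub>R dF (a + t *\<^sub>R (y - a)))) v)"
    proof (rule Ck_on_cong[OF \<open>open S\<close>, rotated])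
      fix y assume y: "y \<in> S"
      have "(\<lambda>t. (w t * t) *\<^sub>R dF (a + t *\<^sub>R (y - a))) integrable_on {0..1}"
        using Suc.prems(1) y by (intro integrable_on_segment[OF assms(2,3) _ cdF] continuous_intros) auto
      then have "blinfun_apply (integral {0..1} (\<lambda>t. (w t * t) *\<^sub>R dF (a + t *\<^sub>R (y - a)))) v =
          integral {0..1} (\<lambda>t. blinfun_apply ((w t * t) *\<^sub>R dF (a + t *\<^sub>R (y - a))) v)"
        by (rule blinfun_apply_integral)
      also have "\<dots> = integral {0..1} (\<lambda>t. (w t * t) * frechet_derivative F (at (a + t *\<^sub>R (y - a))) v)"
        using seg[OF y] by (intro integral_cong) (simp add: blinfun.scaleR_left dF)
      finally show "integral {0..1} (\<lambda>t. (w t * t) * frechet_derivative F (at (a + t *\<^sub>R (y - a))) v) =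
          blinfun_apply (integral {0..1} (\<lambda>t. (w t * t) *\<^sub>R dF (a + t *\<^sub>R (y - a)))) v" by simp
    qed
  qed
qed

text \<open>Integrate the derivative of \<open>F\<close> along the segment from \<open>a\<close> to
  \<open>y\<close> and expand the direction \<open>y - a\<close> in \<open>Basis\<close>:
  \<open>H i\<close> is the mean of the i-th partial derivative over the segment. This is the reason
  why a derivation sees only first partial derivatives.\<close>

lemma hadamard:
  fixes F :: "'e::euclidean_space \<Rightarrow> real"
  assumes "open S" "convex S" "a \<in> S" "smooth_on S F"
  obtains H where "\<And>i. smooth_on S (H i)"
    and "\<And>y. y \<in> S \<Longrightarrow> F y = F a + (\<Sum>i\<in>Basis. ((y - a) \<bullet> i) * H i y)"
    and "\<And>i. H i a = frechet_derivative F (at a) i"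
proof
  define H where "H i y = integral {0..1} (\<lambda>t. 1 * frechet_derivative F (at (a + t *\<^sub>R (y - a))) i)" for i y
  show "smooth_on S (H i)" for i
    unfolding H_def smooth_on_def
    using smooth_on_frechet_derivative[OF assms(4), of i] assms unfolding smooth_on_def
    by (intro allI Ck_on_segment_integral continuous_intros) auto
  show "H i a = frechet_derivative F (at a) i" for i
    by (simp add: H_def)
  fix y assume y: "y \<in> S"
  note seg = convex_segment[OF assms(2,3) y]
  let ?D = "\<lambda>t. frechet_derivative F (at (a + t *\<^sub>R (y - a)))"
  have ftc: "((\<lambda>t. ?D t (y - a)) has_integral (F (a + 1 *\<^sub>R (y - a)) - F (a + 0 *\<^sub>R (y - a)))) {0..1}"
  proof (rule fundamental_theorem_of_calculus)
    fix t :: real assume t: "t \<in> {0..1}"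
    have F: "(F has_derivative ?D t) (at (a + t *\<^sub>R (y - a)))"
      using smooth_on_has_derivative[OF assms(4) seg[OF t]] .
    have "((\<lambda>t. F (a + t *\<^sub>R (y - a))) has_derivative (\<lambda>s. ?D t (s *\<^sub>R (y - a)))) (at t within {0..1})"
      by (rule has_derivative_compose[of "\<lambda>t. a + t *\<^sub>R (y - a)" _ t _ F, OF _ F])
        (auto intro!: derivative_eq_intros)
    then show "((\<lambda>t. F (a + t *\<^sub>R (y - a))) has_vector_derivative ?D t (y - a)) (at t within {0..1})"
      unfolding has_vector_derivative_def
      by (rule has_derivative_eq_rhs) (simp add: fun_eq_iff linear_cmul[OF has_derivative_linear[OF F]])
  qed simp
  have exp: "?D t (y - a) = (\<Sum>i\<in>Basis. ((y - a) \<bullet> i) * ?D t i)" if "t \<in> {0..1}" for t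
  proof -
    have lin: "linear (?D t)"
      using smooth_on_has_derivative[OF assms(4) seg[OF that]] has_derivative_linear by blast
    have "?D t (y - a) = ?D t (\<Sum>i\<in>Basis. ((y - a) \<bullet> i) *\<^sub>R i)" by (simp only: euclidean_representation)
    also have "\<dots> = (\<Sum>i\<in>Basis. ((y - a) \<bullet> i) * ?D t i)"
      by (simp only: linear_sum[OF lin] linear_cmul[OF lin] real_scaleR_def)
    finally show ?thesis .
  qed
  have int: "(\<lambda>t. ?D t i) integrable_on {0..1}" for i
    using integrable_on_segment[OF assms(2,3) continuous_on_const
      smooth_on_imp_continuous_on[OF smooth_on_frechet_derivative[OF assms(4)]] y, of 1] by simp
  have "F y - F a = integral {0..1} (\<lambda>t. ?D t (y - a))"
    using integral_unique[OF ftc] by simp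
  also have "\<dots> = integral {0..1} (\<lambda>t. \<Sum>i\<in>Basis. ((y - a) \<bullet> i) * ?D t i)"
    using exp by (intro integral_cong) simp
  also have "\<dots> = (\<Sum>i\<in>Basis. ((y - a) \<bullet> i) * H i y)"
    using int by (subst integral_sum) (auto simp: H_def intro!: integrable_on_mult_right)
  finally show "F y = F a + (\<Sum>i\<in>Basis. ((y - a) \<bullet> i) * H i y)" by simp
qed

lemma smooth_on_inner:
  "open S \<Longrightarrow> smooth_on S f \<Longrightarrow> smooth_on S g \<Longrightarrow> smooth_on S (\<lambda>x. f x \<bullet> g x)"
  unfolding smooth_on_def using bounded_bilinear.Ck_on[OF bounded_bilinear_inner] by blast

section \<open>Smooth functions on a manifold\<close>

locale smooth_mfd =
  fixes M :: "('a, 'e::euclidean_space) manifold"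
  assumes smooth_manifold: "smooth_manifold M"
begin

abbreviation "\<F> \<equiv> smooth_functions M"
abbreviation "\<T> \<equiv> tangent_space M"
abbreviation "\<C> \<equiv> cotangent_space M"
abbreviation "\<X> \<equiv> vector_fields M"
abbreviation "\<Omega> \<equiv> one_forms M"

lemma chart:
  assumes "(U, \<phi>) \<in> atlas M"
  shows chart_openin: "openin (mtop M) U" and chart_open: "open (\<phi> ` U)"
    and chart_homeo: "homeomorphic_map (subtopology (mtop M) U) (top_of_set (\<phi> ` U)) \<phi>"
  using smooth_manifold assms unfolding smooth_manifold_def by auto

lemma chart_subset: "(U, \<phi>) \<in> atlas M \<Longrightarrow> U \<subseteq> points M"
  using chart_openin openin_subset by blast

lemma chart_topspace: "(U, \<phi>) \<in> atlas M \<Longrightarrow> topspace (subtopology (mtop M) U) = U"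
  using chart_subset by auto

lemma chart_inj: "(U, \<phi>) \<in> atlas M \<Longrightarrow> inj_on \<phi> U"
  using homeomorphic_imp_injective_map[OF chart_homeo] chart_topspace by metis

lemma chart_inv: "(U, \<phi>) \<in> atlas M \<Longrightarrow> q \<in> U \<Longrightarrow> inv_into U \<phi> (\<phi> q) = q"
  using chart_inj inv_into_f_f by metis

lemma chart_cover: "p \<in> points M \<Longrightarrow> \<exists>U \<phi>. (U, \<phi>) \<in> atlas M \<and> p \<in> U"
  using smooth_manifold unfolding smooth_manifold_def by blast

lemma chart_image_open:
  assumes "(U, \<phi>) \<in> atlas M" "openin (mtop M) W"
  shows "open (\<phi> ` (U \<inter> W))"
proof -
  have "openin (subtopology (mtop M) U) (U \<inter> W)"
    using assms(2) by (auto simp: openin_subtopology)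
  then have "openin (top_of_set (\<phi> ` U)) (\<phi> ` (U \<inter> W))"
    using homeomorphic_imp_open_map[OF chart_homeo[OF assms(1)]] unfolding open_map_def by blast
  then show ?thesis using chart_open[OF assms(1)] openin_open_trans by blast
qed

lemma chart_preimage_openin:
  assumes "(U, \<phi>) \<in> atlas M" "open T"
  shows "openin (mtop M) {q \<in> U. \<phi> q \<in> T}"
proof -
  have "openin (subtopology (mtop M) U) {q \<in> U. \<phi> q \<in> \<phi> ` U \<inter> T}"
    using openin_continuous_map_preimage[OF homeomorphic_imp_continuous_map[OF chart_homeo[OF assms(1)]],
      of "\<phi> ` U \<inter> T"] assms(2) unfolding chart_topspace[OF assms(1)] by (auto simp: openin_open)
  moreover have "{q \<in> U. \<phi> q \<in> \<phi> ` U \<inter> T} = {q \<in> U. \<phi> q \<in> T}" by auto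
  ultimately show ?thesis using openin_trans_full chart_openin[OF assms(1)] by metis
qed

text \<open>The Hausdorff axiom enters here: a compact subset of a chart domain is closed in the
  whole manifold. Extension by 0 outside such a set therefore creates no new boundary
  points.\<close>

lemma chart_preimage_closedin:
  assumes "(U, \<phi>) \<in> atlas M" "compact K" "K \<subseteq> \<phi> ` U"
  shows "closedin (mtop M) {q \<in> U. \<phi> q \<in> K}"
proof -
  have "\<phi> ` {q \<in> U. \<phi> q \<in> K} = K" using assms(3) by auto
  then have "compactin (top_of_set (\<phi> ` U)) (\<phi> ` {q \<in> U. \<phi> q \<in> K})"
    using assms(2,3) by (simp add: compactin_subtopology)
  then have "compactin (subtopology (mtop M) U) {q \<in> U. \<phi> q \<in> K}"
    using homeomorphic_map_compactness[OF chart_homeo[OF assms(1)], of "{q \<in> U. \<phi> q \<in> K}"]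
      chart_topspace[OF assms(1)] by auto
  then have "compactin (mtop M) {q \<in> U. \<phi> q \<in> K}" by (simp add: compactin_subtopology)
  moreover have "Hausdorff_space (mtop M)" using smooth_manifold unfolding smooth_manifold_def by (elim conjE)
  ultimately show ?thesis by (simp only: compactin_imp_closedin)
qed

lemma transition_smooth:
  "(U, \<phi>) \<in> atlas M \<Longrightarrow> (V, \<psi>) \<in> atlas M \<Longrightarrow> smooth_on (\<phi> ` (U \<inter> V)) (\<lambda>y. \<psi> (inv_into U \<phi> y))"
  using smooth_manifold unfolding smooth_manifold_def comp_def by (elim conjE) (drule (1) bspec; simp)+

lemma smooth_functionsI:
  "(\<And>U \<phi>. (U, \<phi>) \<in> atlas M \<Longrightarrow> smooth_on (\<phi> ` U) (\<lambda>y. h (inv_into U \<phi> y))) \<Longrightarrow> h \<in> \<F>"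
  unfolding smooth_functions_def comp_def by auto

lemma smooth_functionsD:
  "h \<in> \<F> \<Longrightarrow> (U, \<phi>) \<in> atlas M \<Longrightarrow> smooth_on (\<phi> ` U) (\<lambda>y. h (inv_into U \<phi> y))"
  unfolding smooth_functions_def comp_def by auto

text \<open>Smoothness near a point is expressed as agreement with some globally smooth function.
  Later proofs can then glue functions without returning to charts.\<close>

definition locally_smooth :: "'a set \<Rightarrow> ('a \<Rightarrow> real) \<Rightarrow> bool" where
  "locally_smooth U h \<longleftrightarrow> (\<forall>p\<in>U. \<exists>W k. openin (mtop M) W \<and> p \<in> W \<and> k \<in> \<F> \<and> (\<forall>q\<in>W. h q = k q))"

lemma smooth_if_locally_smooth:
  assumes "locally_smooth (points M) h"
  shows "h \<in> \<F>"
proof (rule smooth_functionsI)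
  fix U \<phi> assume U: "(U, \<phi>) \<in> atlas M"
  show "smooth_on (\<phi> ` U) (\<lambda>y. h (inv_into U \<phi> y))"
  proof (rule smooth_on_local)
    fix y assume "y \<in> \<phi> ` U"
    then obtain p where p: "p \<in> U" "y = \<phi> p" by blast
    then obtain W k where W: "openin (mtop M) W" "p \<in> W" "k \<in> \<F>" "\<forall>q\<in>W. h q = k q"
      using assms chart_subset[OF U] unfolding locally_smooth_def by blast
    have "smooth_on (\<phi> ` (U \<inter> W)) (\<lambda>y. h (inv_into U \<phi> y))"
    proof (rule smooth_on_cong[OF chart_image_open[OF U W(1)]])
      show "smooth_on (\<phi> ` (U \<inter> W)) (\<lambda>y. k (inv_into U \<phi> y))"
        using smooth_functionsD[OF W(3) U] by (rule smooth_on_subset) auto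
    qed (use W(4) chart_inv[OF U] in auto)
    then show "\<exists>T. open T \<and> y \<in> T \<and> smooth_on T (\<lambda>y. h (inv_into U \<phi> y))"
      using chart_image_open[OF U W(1)] p W(2) by blast
  qed
qed

text \<open>Smooth functions are total, but their values off the manifold are unconstrained.\<close>

lemma smooth_cong:
  assumes "h \<in> \<F>" "\<And>p. p \<in> points M \<Longrightarrow> h p = k p"
  shows "k \<in> \<F>"
proof (rule smooth_if_locally_smooth, unfold locally_smooth_def, intro ballI)
  show "\<exists>W k'. openin (mtop M) W \<and> p \<in> W \<and> k' \<in> \<F> \<and> (\<forall>q\<in>W. k q = k' q)" if "p \<in> points M" for p
    using that assms by (intro exI[of _ "points M"] exI[of _ h]) auto
qed

lemma smooth_const: "(\<lambda>x. c) \<in> \<F>"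
  by (rule smooth_functionsI) (rule smooth_on_const)

lemma smooth_add: "h \<in> \<F> \<Longrightarrow> k \<in> \<F> \<Longrightarrow> (\<lambda>x. h x + k x) \<in> \<F>"
  by (rule smooth_functionsI, rule smooth_on_add) (blast intro: chart_open smooth_functionsD)+

lemma smooth_mult: "h \<in> \<F> \<Longrightarrow> k \<in> \<F> \<Longrightarrow> (\<lambda>x. h x * k x) \<in> \<F>"
  by (rule smooth_functionsI, rule smooth_on_mult) (blast intro: chart_open smooth_functionsD)+

lemma smooth_lincomb: "h \<in> \<F> \<Longrightarrow> k \<in> \<F> \<Longrightarrow> (\<lambda>x. a * h x + b * k x) \<in> \<F>"
  by (intro smooth_add smooth_mult smooth_const)

lemma smooth_diff: "h \<in> \<F> \<Longrightarrow> k \<in> \<F> \<Longrightarrow> (\<lambda>x. h x - k x) \<in> \<F>"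
  using smooth_lincomb[of h k 1 "-1"] by simp

lemma smooth_sum: "(\<And>i. i \<in> A \<Longrightarrow> h i \<in> \<F>) \<Longrightarrow> (\<lambda>x. \<Sum>i\<in>A. h i x) \<in> \<F>"
  by (induction A rule: infinite_finite_induct) (auto intro: smooth_const smooth_add)

lemma smooth_compose:
  assumes "h \<in> \<F>" "open T" "h ` points M \<subseteq> T" "smooth_on T u"
  shows "(\<lambda>x. u (h x)) \<in> \<F>"
proof (rule smooth_functionsI)
  fix U \<phi> assume U: "(U, \<phi>) \<in> atlas M"
  have "(\<lambda>y. h (inv_into U \<phi> y)) ` \<phi> ` U \<subseteq> T"
    using assms(3) chart_inv[OF U] chart_subset[OF U] by fastforce
  then show "smooth_on (\<phi> ` U) (\<lambda>y. u (h (inv_into U \<phi> y)))"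
    using smooth_on_compose[OF chart_open[OF U] assms(2) _ smooth_functionsD[OF assms(1) U] assms(4)] by blast
qed

text \<open>Tangent vectors act on globally smooth functions only, so a function given in a chart
  has to be replaced by a global one with the same germ. The replacement is \<open>u\<close> times a
  step function of the squared coordinate distance, continued by 0.\<close>

lemma chart_extension:
  assumes V: "(V, \<phi>) \<in> atlas M" and p: "p \<in> V" and S: "open S" "\<phi> p \<in> S" and u: "smooth_on S u"
  obtains k W C where "k \<in> \<F>" "openin (mtop M) W" "p \<in> W" "W \<subseteq> C" "closedin (mtop M) C" "C \<subseteq> V"
    "\<phi> ` C \<subseteq> S" "\<And>q. q \<in> W \<Longrightarrow> k q = u (\<phi> q)" "\<And>q. q \<notin> C \<Longrightarrow> k q = 0"
proof -
  let ?c = "\<phi> p"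
  have "open (S \<inter> \<phi> ` V)" "?c \<in> S \<inter> \<phi> ` V" using S p chart_open[OF V] by auto
  then obtain r where r: "r > 0" "cball ?c r \<subseteq> S \<inter> \<phi> ` V" using open_contains_cball by meson
  \<comment> \<open>The cut-off is 1 within \<rho>/2 and 0 beyond \<rho>. Since \<rho> < r, the
    support is a closed ball inside the open ball of radius r on which \<open>G\<close> is known to
    be smooth.\<close>
  define \<rho> where "\<rho> = r / 2"
  have \<rho>: "0 < \<rho>" "\<rho> < r" using r(1) by (auto simp: \<rho>_def)
  obtain \<beta> :: "real \<Rightarrow> real" where \<beta>: "smooth_on UNIV \<beta>" "\<And>t. t \<le> 1/2 \<Longrightarrow> \<beta> t = 1" "\<And>t. t \<ge> 1 \<Longrightarrow> \<beta> t = 0"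
    using smooth_step_exists by blast
  define G where "G y = \<beta> (((y - ?c) \<bullet> (y - ?c)) * inverse (\<rho>\<^sup>2)) * u y" for y
  have sub: "smooth_on (ball ?c r) (\<lambda>y. y - ?c)"
    using smooth_on_add[OF open_ball smooth_on_bounded_linear[OF bounded_linear_ident] smooth_on_const, of ?c r "- ?c"] by simp
  have "smooth_on (ball ?c r) (\<lambda>y. ((y - ?c) \<bullet> (y - ?c)) * inverse (\<rho>\<^sup>2))"
    by (intro smooth_on_mult smooth_on_inner sub smooth_on_const open_ball)
  then have "smooth_on (ball ?c r) (\<lambda>y. \<beta> (((y - ?c) \<bullet> (y - ?c)) * inverse (\<rho>\<^sup>2)))"
    by (intro smooth_on_compose[OF _ _ _ _ \<beta>(1)]) auto
  moreover have "smooth_on (ball ?c r) u"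
    using u by (rule smooth_on_subset) (use r(2) in auto)
  ultimately have G: "smooth_on (ball ?c r) G"
    unfolding G_def by (intro smooth_on_mult) auto
  have dd: "(y - ?c) \<bullet> (y - ?c) = (dist ?c y)\<^sup>2" for y
    by (metis dist_commute dist_norm power2_norm_eq_inner)
  have G1: "G y = u y" if "dist ?c y < \<rho> / 2" for y
  proof -
    have "(dist ?c y)\<^sup>2 \<le> (\<rho> / 2)\<^sup>2" using that by (intro power_mono) auto
    then have "4 * (dist ?c y)\<^sup>2 \<le> \<rho>\<^sup>2" by (simp add: power_divide)
    moreover have "0 \<le> (dist ?c y)\<^sup>2" by simp
    ultimately have "2 * (dist ?c y)\<^sup>2 \<le> \<rho>\<^sup>2" by linarith
    then have "((y - ?c) \<bullet> (y - ?c)) * inverse (\<rho>\<^sup>2) \<le> 1/2"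
      using \<rho> unfolding dd by (simp add: field_simps)
    then show ?thesis by (simp add: G_def \<beta>(2))
  qed
  have G0: "G y = 0" if "dist ?c y \<ge> \<rho>" for y
  proof -
    have "\<rho>\<^sup>2 \<le> (dist ?c y)\<^sup>2" using that \<rho> by (intro power_mono) auto
    then have "((y - ?c) \<bullet> (y - ?c)) * inverse (\<rho>\<^sup>2) \<ge> 1"
      using \<rho> unfolding dd by (simp add: field_simps)
    then show ?thesis by (simp add: G_def \<beta>(3))
  qed
  define k where "k q = (if q \<in> V \<and> \<phi> q \<in> ball ?c r then G (\<phi> q) else 0)" for q
  define W where "W = {q \<in> V. \<phi> q \<in> ball ?c (\<rho> / 2)}"
  define C where "C = {q \<in> V. \<phi> q \<in> cball ?c \<rho>}"
  have W: "openin (mtop M) W" unfolding W_def by (rule chart_preimage_openin[OF V open_ball])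
  have WC: "p \<in> W" "W \<subseteq> C" using p \<rho> by (auto simp: W_def C_def)
  have "cball ?c \<rho> \<subseteq> cball ?c r" using \<rho> by auto
  with r(2) have \<rho>r: "cball ?c \<rho> \<subseteq> S" "cball ?c \<rho> \<subseteq> \<phi> ` V" by blast+
  have C: "closedin (mtop M) C"
    unfolding C_def by (rule chart_preimage_closedin[OF V compact_cball \<rho>r(2)])
  have kC: "k q = 0" if "q \<notin> C" for q
    using that G0 by (auto simp: k_def C_def)
  have "k \<in> \<F>"
  proof (rule smooth_functionsI, rule smooth_on_local)
    fix U \<psi> y assume U: "(U, \<psi>) \<in> atlas M" and "y \<in> \<psi> ` U"
    then obtain q where q: "q \<in> U" "y = \<psi> q" by blast
    \<comment> \<open>Near a point of \<open>C\<close> the function is \<open>G\<close> read through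
      a transition map; the complement of \<open>C\<close> is open and the function is 0
      there.\<close>
    show "\<exists>T. open T \<and> y \<in> T \<and> smooth_on T (\<lambda>y. k (inv_into U \<psi> y))"
    proof (cases "q \<in> C")
      case True
      let ?B = "{q \<in> V. \<phi> q \<in> ball ?c r}"
      have B: "openin (mtop M) ?B" by (rule chart_preimage_openin[OF V open_ball])
      have oB: "open (\<psi> ` (U \<inter> ?B))" by (rule chart_image_open[OF U B])
      have tr: "smooth_on (\<psi> ` (U \<inter> ?B)) (\<lambda>y. \<phi> (inv_into U \<psi> y))"
        by (rule smooth_on_subset[OF transition_smooth[OF U V]]) auto
      have "smooth_on (\<psi> ` (U \<inter> ?B)) (\<lambda>y. G (\<phi> (inv_into U \<psi> y)))"
        by (rule smooth_on_compose[OF oB open_ball _ tr G]) (use chart_inv[OF U] in auto)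
      then have "smooth_on (\<psi> ` (U \<inter> ?B)) (\<lambda>y. k (inv_into U \<psi> y))"
        by (rule smooth_on_cong[OF oB, rotated]) (use chart_inv[OF U] in \<open>auto simp: k_def\<close>)
      moreover have "q \<in> ?B" using True \<rho> by (auto simp: C_def)
      ultimately show ?thesis using oB q by blast
    next
      case False
      have o: "openin (mtop M) (points M - C)" using C by blast
      have oB: "open (\<psi> ` (U \<inter> (points M - C)))" by (rule chart_image_open[OF U o])
      have "smooth_on (\<psi> ` (U \<inter> (points M - C))) (\<lambda>y. k (inv_into U \<psi> y))"
        by (rule smooth_on_cong[OF oB _ smooth_on_const[of _ 0]]) (use chart_inv[OF U] kC in auto)
      then show ?thesis using oB q False chart_subset[OF U] by blast
    qed
  qed
  moreover have "k q = u (\<phi> q)" if "q \<in> W" for q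
    using that G1 \<rho> by (auto simp: W_def k_def)
  moreover have "C \<subseteq> V" "\<phi> ` C \<subseteq> S" using \<rho>r by (auto simp: C_def)
  ultimately show ?thesis using that[of k W C] W WC C kC by blast
qed

lemma bump:
  assumes "openin (mtop M) U" "p \<in> U"
  obtains \<tau> W C where "\<tau> \<in> \<F>" "openin (mtop M) W" "p \<in> W" "W \<subseteq> C" "closedin (mtop M) C" "C \<subseteq> U"
    "\<And>q. q \<in> W \<Longrightarrow> \<tau> q = 1" "\<And>q. q \<notin> C \<Longrightarrow> \<tau> q = 0"
proof -
  obtain V \<phi> where V: "(V, \<phi>) \<in> atlas M" "p \<in> V"
    using chart_cover openin_subset[OF assms(1)] assms(2) by blast
  obtain k W C where *: "k \<in> \<F>" "openin (mtop M) W" "p \<in> W" "W \<subseteq> C" "closedin (mtop M) C" "C \<subseteq> V"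
    "\<phi> ` C \<subseteq> \<phi> ` (V \<inter> U)" "\<And>q. q \<in> W \<Longrightarrow> k q = 1" "\<And>q. q \<notin> C \<Longrightarrow> k q = 0"
    using chart_extension[OF V chart_image_open[OF V(1) assms(1)] _ smooth_on_const[of _ 1]] V(2) assms(2) by blast
  have "C \<subseteq> U" using *(6,7) chart_inj[OF V(1)] unfolding inj_on_def by blast
  then show ?thesis using that * by blast
qed

text \<open>It suffices that \<open>h\<close> is smooth near the points of the closed set
  \<open>C\<close>; off \<open>C\<close> the product is 0 on an open set.\<close>

lemma smooth_cutoff:
  assumes "\<tau> \<in> \<F>" "closedin (mtop M) C" "\<And>q. q \<notin> C \<Longrightarrow> \<tau> q = 0" "locally_smooth C h"
  shows "(\<lambda>q. \<tau> q * h q) \<in> \<F>"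
proof (rule smooth_if_locally_smooth, unfold locally_smooth_def, intro ballI)
  fix p assume p: "p \<in> points M"
  show "\<exists>W k. openin (mtop M) W \<and> p \<in> W \<and> k \<in> \<F> \<and> (\<forall>q\<in>W. \<tau> q * h q = k q)"
  proof (cases "p \<in> C")
    case True
    then obtain W k where "openin (mtop M) W" "p \<in> W" "k \<in> \<F>" "\<forall>q\<in>W. h q = k q"
      using assms(4) unfolding locally_smooth_def by blast
    then show ?thesis using smooth_mult[OF assms(1)]
      by (intro exI[of _ W] exI[of _ "\<lambda>q. \<tau> q * k q"]) auto
  next
    case False
    have "openin (mtop M) (points M - C)" using assms(2) by blast
    then show ?thesis using False p assms(3) smooth_const[of 0]
      by (intro exI[of _ "points M - C"] exI[of _ "\<lambda>q. 0"]) auto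
  qed
qed

text \<open>\<open>N\<close> may vanish away from \<open>p\<close>, so the normalising factor exists
  only as a germ. It is needed as a global function to rescale a global vector field in the
  Gram-Schmidt process.\<close>

lemma inverse_sqrt_near:
  assumes N: "N \<in> \<F>" and p: "p \<in> points M" "N p > 0"
  obtains s W where "s \<in> \<F>" "openin (mtop M) W" "p \<in> W"
    "\<And>q. q \<in> W \<Longrightarrow> N q > 0" "\<And>q. q \<in> W \<Longrightarrow> s q = inverse (sqrt (N q))"
proof -
  obtain V \<phi> where V: "(V, \<phi>) \<in> atlas M" "p \<in> V" using chart_cover p by blast
  let ?N = "\<lambda>y. N (inv_into V \<phi> y)"
  let ?S = "\<phi> ` V \<inter> ?N -` {0<..}"
  have N': "smooth_on (\<phi> ` V) ?N" using smooth_functionsD[OF N V(1)] .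
  have O: "open ?S"
    using continuous_open_preimage[OF smooth_on_imp_continuous_on[OF N'] chart_open[OF V(1)]] by auto
  have "smooth_on ?S (\<lambda>y. inverse (sqrt (?N y)))"
    by (rule smooth_on_compose[OF O _ _ _ smooth_on_inverse_sqrt])
      (auto intro: smooth_on_subset[OF N'])
  moreover have "\<phi> p \<in> ?S" using V p chart_inv[OF V(1)] by auto
  ultimately obtain k W C where "k \<in> \<F>" "openin (mtop M) W" "p \<in> W" "W \<subseteq> C" "C \<subseteq> V"
    "\<phi> ` C \<subseteq> ?S" "\<And>q. q \<in> W \<Longrightarrow> k q = inverse (sqrt (?N (\<phi> q)))"
    using chart_extension[OF V O] by metis
  then show ?thesis using that[of k W] chart_inv[OF V(1)] by force
qed

section \<open>Tangent vectors in charts\<close>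

lemma tangent_out: "v \<in> \<T> p \<Longrightarrow> h \<notin> \<F> \<Longrightarrow> v h = 0"
  unfolding tangent_space_def dual_def by blast

lemma tangent_lincomb: "v \<in> \<T> p \<Longrightarrow> h \<in> \<F> \<Longrightarrow> k \<in> \<F> \<Longrightarrow> v (\<lambda>x. a * h x + b * k x) = a * v h + b * v k"
  unfolding tangent_space_def dual_def linear_functional_on_def by blast

lemma tangent_mult: "v \<in> \<T> p \<Longrightarrow> h \<in> \<F> \<Longrightarrow> k \<in> \<F> \<Longrightarrow> v (\<lambda>x. h x * k x) = h p * v k + k p * v h"
  unfolding tangent_space_def by blast

lemma tangentI:
  assumes "\<And>h. h \<notin> \<F> \<Longrightarrow> v h = 0"
    and "\<And>h k a b. h \<in> \<F> \<Longrightarrow> k \<in> \<F> \<Longrightarrow> v (\<lambda>x. a * h x + b * k x) = a * v h + b * v k"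
    and "\<And>h k. h \<in> \<F> \<Longrightarrow> k \<in> \<F> \<Longrightarrow> v (\<lambda>x. h x * k x) = h p * v k + k p * v h"
  shows "v \<in> \<T> p"
  using assms unfolding tangent_space_def dual_def linear_functional_on_def by blast

lemma tangent_add: "v \<in> \<T> p \<Longrightarrow> h \<in> \<F> \<Longrightarrow> k \<in> \<F> \<Longrightarrow> v (\<lambda>x. h x + k x) = v h + v k"
  using tangent_lincomb[of v p h k 1 1] by simp

lemma tangent_diff: "v \<in> \<T> p \<Longrightarrow> h \<in> \<F> \<Longrightarrow> k \<in> \<F> \<Longrightarrow> v (\<lambda>x. h x - k x) = v h - v k"
  using tangent_lincomb[of v p h k 1 "-1"] by simp

lemma tangent_scale: "v \<in> \<T> p \<Longrightarrow> h \<in> \<F> \<Longrightarrow> v (\<lambda>x. a * h x) = a * v h"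
  using tangent_lincomb[of v p h h a 0] by simp

lemma tangent_const: "v \<in> \<T> p \<Longrightarrow> v (\<lambda>x. c) = 0"
proof -
  assume v: "v \<in> \<T> p"
  have "v (\<lambda>x. 1) = 0" using tangent_mult[OF v smooth_const smooth_const, of 1 1] by simp
  then show ?thesis using tangent_scale[OF v smooth_const, of c 1] by simp
qed

lemma tangent_sum:
  assumes "v \<in> \<T> p" "\<And>i. i \<in> A \<Longrightarrow> h i \<in> \<F>"
  shows "v (\<lambda>x. \<Sum>i\<in>A. h i x) = (\<Sum>i\<in>A. v (h i))"
  using assms(2) by (induction A rule: infinite_finite_induct)
    (auto simp: tangent_const[OF assms(1)] tangent_add[OF assms(1)] smooth_sum)

text \<open>With a bump function \<tau> supported in \<open>W\<close>, the product \<tau> (h - k) is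
  identically 0. The Leibniz rule at \<open>p\<close>, where \<tau> is 1 and h - k is 0, turns this
  into v (h - k) = 0.\<close>

lemma tangent_local:
  assumes v: "v \<in> \<T> p" and W: "openin (mtop M) W" "p \<in> W" and hk: "h \<in> \<F>" "k \<in> \<F>"
    and eq: "\<And>q. q \<in> W \<Longrightarrow> h q = k q"
  shows "v h = v k"
proof -
  obtain \<tau> C where \<tau>: "\<tau> \<in> \<F>" "\<tau> p = 1" "C \<subseteq> W" "\<And>q. q \<notin> C \<Longrightarrow> \<tau> q = 0"
    using bump[OF W] by metis
  have "(\<lambda>x. \<tau> x * (h x - k x)) = (\<lambda>x. 0)"
    using \<tau>(3,4) eq by fastforce
  then have "v (\<lambda>x. \<tau> x * (h x - k x)) = 0" using tangent_const[OF v] by simp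
  then show ?thesis
    using tangent_mult[OF v \<tau>(1) smooth_diff[OF hk]] \<tau>(2) tangent_diff[OF v hk] eq[OF W(2)] by simp
qed

lemma tangent_cong:
  "v \<in> \<T> p \<Longrightarrow> p \<in> points M \<Longrightarrow> h \<in> \<F> \<Longrightarrow> (\<And>q. q \<in> points M \<Longrightarrow> h q = k q) \<Longrightarrow> v h = v k"
  using tangent_local[of v p "points M" h k] smooth_cong[of h k] by auto

lemma tangent_zero: "(\<lambda>h. 0) \<in> \<T> p"
  by (rule tangentI) auto

lemma tangent_closed_lincomb:
  assumes "v \<in> \<T> p" "w \<in> \<T> p"
  shows "(\<lambda>h. a * v h + b * w h) \<in> \<T> p"
  by (rule tangentI)
    (simp_all add: tangent_out[OF assms(1)] tangent_out[OF assms(2)] tangent_lincomb[OF assms(1)]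
      tangent_lincomb[OF assms(2)] tangent_mult[OF assms(1)] tangent_mult[OF assms(2)] algebra_simps)

lemma tangent_closed_sum:
  assumes "\<And>i. i \<in> A \<Longrightarrow> v i \<in> \<T> p"
  shows "(\<lambda>h. \<Sum>i\<in>A. c i * v i h) \<in> \<T> p"
  using assms
proof (induction A rule: infinite_finite_induct)
  case (insert i A)
  then show ?case using tangent_closed_lincomb[of "v i" p "\<lambda>h. \<Sum>i\<in>A. c i * v i h" "c i" 1] by simp
qed (auto simp: tangent_zero)

lemma chart_smooth_derivative:
  assumes "(V, \<phi>) \<in> atlas M" "q \<in> V" "h \<in> \<F>"
  shows "((\<lambda>y. h (inv_into V \<phi> y)) has_derivative
    frechet_derivative (\<lambda>y. h (inv_into V \<phi> y)) (at (\<phi> q))) (at (\<phi> q))"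
  using smooth_on_has_derivative[OF smooth_functionsD[OF assms(3,1)]] assms(2) by blast

text \<open>Hadamard's lemma writes \<open>h\<close> near \<open>p\<close> as a constant plus a sum
  of products of centred coordinates and smooth functions. A derivation then retains only its values
  on the coordinates, which are the coefficients \<open>c\<close>.\<close>

lemma chart_tangent:
  assumes V: "(V, \<phi>) \<in> atlas M" "p \<in> V" and v: "v \<in> \<T> p"
  obtains c where "\<And>h. h \<in> \<F> \<Longrightarrow>
    v h = (\<Sum>i\<in>Basis. c i * frechet_derivative (\<lambda>y. h (inv_into V \<phi> y)) (at (\<phi> p)) i)"
proof -
  let ?a = "\<phi> p"
  obtain r where r: "r > 0" "ball ?a r \<subseteq> \<phi> ` V"
    using chart_open[OF V(1)] V(2) open_contains_ball by blast
  have ext: "\<exists>k W. k \<in> \<F> \<and> openin (mtop M) W \<and> p \<in> W \<and> W \<subseteq> V \<and> \<phi> ` W \<subseteq> ball ?a r \<and> (\<forall>q\<in>W. k q = u (\<phi> q))"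
    if u: "smooth_on (ball ?a r) u" for u
  proof -
    have "?a \<in> ball ?a r" using r(1) by simp
    from chart_extension[OF V open_ball this u] obtain k W C where
      "k \<in> \<F>" "openin (mtop M) W" "p \<in> W" "W \<subseteq> C" "C \<subseteq> V" "\<phi> ` C \<subseteq> ball ?a r" "\<And>q. q \<in> W \<Longrightarrow> k q = u (\<phi> q)"
      by metis
    then show ?thesis by (intro exI[of _ k] exI[of _ W]) blast
  qed
  have "\<exists>k W. k \<in> \<F> \<and> openin (mtop M) W \<and> p \<in> W \<and> W \<subseteq> V \<and> \<phi> ` W \<subseteq> ball ?a r \<and> (\<forall>q\<in>W. k q = \<phi> q \<bullet> i)" for i
    by (rule ext) (rule smooth_on_bounded_linear[OF bounded_linear_inner_left])
  then obtain x W where x: "\<And>i. x i \<in> \<F>" and W: "\<And>i. openin (mtop M) (W i)" "\<And>i. p \<in> W i"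
    and xW: "\<And>i q. q \<in> W i \<Longrightarrow> x i q = \<phi> q \<bullet> i"
    by metis
  show thesis
  proof (rule that[of "\<lambda>i. v (x i)"])
    fix h assume h: "h \<in> \<F>"
    let ?h = "\<lambda>y. h (inv_into V \<phi> y)"
    obtain H where H: "\<And>i. smooth_on (ball ?a r) (H i)"
      and h_eq: "\<And>y. y \<in> ball ?a r \<Longrightarrow> ?h y = ?h ?a + (\<Sum>i\<in>Basis. ((y - ?a) \<bullet> i) * H i y)"
      and Ha: "\<And>i. H i ?a = frechet_derivative ?h (at ?a) i"
      using hadamard[OF open_ball convex_ball _ smooth_on_subset[OF smooth_functionsD[OF h V(1)] r(2)], of ?a] r(1)
      by auto
    from ext[OF H] obtain k W' where k: "\<And>i. k i \<in> \<F>" and W': "\<And>i. openin (mtop M) (W' i)" "\<And>i. p \<in> W' i"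
      "\<And>i. W' i \<subseteq> V" "\<And>i. \<phi> ` W' i \<subseteq> ball ?a r"
      and kW: "\<And>i q. q \<in> W' i \<Longrightarrow> k i q = H i (\<phi> q)"
      by metis
    \<comment> \<open>The globalised coordinates and Hadamard factors are correct only near
      \<open>p\<close>; the intersection is open because \<open>Basis\<close> is finite.\<close>
    let ?U = "\<Inter>i\<in>Basis. W i \<inter> W' i"
    have U: "openin (mtop M) ?U" "p \<in> ?U"
      using W W' by (auto intro!: openin_INT2 finite_Basis nonempty_Basis)
    have f: "(\<lambda>q. (x i q - ?a \<bullet> i) * k i q) \<in> \<F>" for i
      by (intro smooth_mult smooth_diff x k smooth_const)
    have "v h = v (\<lambda>q. h p + (\<Sum>i\<in>Basis. (x i q - ?a \<bullet> i) * k i q))"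
    proof (rule tangent_local[OF v U h smooth_add[OF smooth_const smooth_sum[OF f]]])
      fix q assume q: "q \<in> ?U"
      obtain i0 :: 'e where "i0 \<in> Basis" using nonempty_Basis by blast
      then have "q \<in> W' i0" using q by blast
      then have "q \<in> V" "\<phi> q \<in> ball ?a r" using W'(3)[of i0] W'(4)[of i0] by (blast, blast)
      then have "h q = h p + (\<Sum>i\<in>Basis. ((\<phi> q - ?a) \<bullet> i) * H i (\<phi> q))"
        using h_eq[of "\<phi> q"] by (simp only: chart_inv[OF V(1)] V(2))
      also have "(\<Sum>i\<in>Basis. ((\<phi> q - ?a) \<bullet> i) * H i (\<phi> q)) = (\<Sum>i\<in>Basis. (x i q - ?a \<bullet> i) * k i q)"
        using q xW kW by (intro sum.cong) (auto simp: inner_diff_left)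
      finally show "h q = h p + (\<Sum>i\<in>Basis. (x i q - ?a \<bullet> i) * k i q)" .
    qed
    also have "\<dots> = (\<Sum>i\<in>Basis. v (\<lambda>q. (x i q - ?a \<bullet> i) * k i q))"
      using f by (simp add: tangent_add[OF v] tangent_const[OF v] tangent_sum[OF v] smooth_const smooth_sum)
    also have "\<dots> = (\<Sum>i\<in>Basis. v (x i) * frechet_derivative ?h (at ?a) i)"
    proof (rule sum.cong[OF refl])
      fix i :: 'e assume "i \<in> Basis"
      \<comment> \<open>In the Leibniz rule the first factor vanishes at \<open>p\<close>, so only
        its derivative survives, multiplied by \<open>H i\<close> at the centre, the partial
        derivative of \<open>h\<close>.\<close>
      show "v (\<lambda>q. (x i q - ?a \<bullet> i) * k i q) = v (x i) * frechet_derivative ?h (at ?a) i"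
        using tangent_mult[OF v smooth_diff[OF x smooth_const] k, of i "?a \<bullet> i" i] W(2) W'(2) xW kW
        by (simp add: tangent_diff[OF v x smooth_const] tangent_const[OF v] Ha)
    qed
    finally show "v h = (\<Sum>i\<in>Basis. v (x i) * frechet_derivative ?h (at ?a) i)" .
  qed
qed

text \<open>The coordinate functions and coordinate fields of a chart, made global by cut-offs and
  kept unchanged on \<open>W\<close>. Nearly all later local arguments use this frame in place of
  charts.\<close>

lemma frame:
  assumes p: "p \<in> points M"
  obtains x :: "'e \<Rightarrow> 'a \<Rightarrow> real" and X :: "'e \<Rightarrow> 'a vfield" and W where
    "openin (mtop M) W" "p \<in> W" "\<And>i. x i \<in> \<F>" "\<And>i. X i \<in> \<X>"
    "\<And>q i j. q \<in> W \<Longrightarrow> i \<in> Basis \<Longrightarrow> j \<in> Basis \<Longrightarrow> X i q (x j) = (if i = j then 1 else 0)"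
    "\<And>q v h. q \<in> W \<Longrightarrow> v \<in> \<T> q \<Longrightarrow> v h = (\<Sum>i\<in>Basis. v (x i) * X i q h)"
proof -
  obtain V \<phi> where V: "(V, \<phi>) \<in> atlas M" "p \<in> V" using chart_cover p by blast
  have a: "\<phi> p \<in> \<phi> ` V" using V by blast
  have "\<exists>k W. k \<in> \<F> \<and> openin (mtop M) W \<and> p \<in> W \<and> W \<subseteq> V \<and> (\<forall>q\<in>W. k q = \<phi> q \<bullet> i)" for i
    using chart_extension[OF V chart_open[OF V(1)] a smooth_on_bounded_linear[OF bounded_linear_inner_left[of i]]]
    by (metis order_trans)
  then obtain x W where x: "\<And>i. x i \<in> \<F>" and W: "\<And>i. openin (mtop M) (W i)" "\<And>i. p \<in> W i"
    and xW: "\<And>i q. q \<in> W i \<Longrightarrow> x i q = \<phi> q \<bullet> i"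
    by metis
  obtain \<tau> W0 C where \<tau>: "\<tau> \<in> \<F>" and W0: "openin (mtop M) W0" "p \<in> W0" "W0 \<subseteq> C"
    and C: "closedin (mtop M) C" "C \<subseteq> V"
    and \<tau>1: "\<And>q. q \<in> W0 \<Longrightarrow> \<tau> q = 1" and \<tau>0: "\<And>q. q \<notin> C \<Longrightarrow> \<tau> q = 0"
    using bump[OF chart_openin[OF V(1)] V(2)] by metis
  define \<delta> where "\<delta> i h q = frechet_derivative (\<lambda>y. h (inv_into V \<phi> y)) (at (\<phi> q)) i"
    for i :: 'e and h :: "'a \<Rightarrow> real" and q
  \<comment> \<open>The factor \<open>\<tau>\<close> allows continuation of the coordinate
    derivation by 0, and the value 0 on non-smooth \<open>h\<close> is the normalisation that
    \<open>tangent_space\<close> demands.\<close>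
  define X where "X i q h = (if h \<in> \<F> then \<tau> q * \<delta> i h q else 0)" for i q h
  define U where "U = W0 \<inter> (\<Inter>i\<in>Basis. W i)"
  have U: "openin (mtop M) U" "p \<in> U" 
    using W W0 by (auto simp: U_def intro!: openin_INT2 finite_Basis nonempty_Basis)
  have UV: "q \<in> V" "\<tau> q = 1" if "q \<in> U" for q using that W0 C \<tau>1 by (auto simp: U_def)
  have \<delta>_lin: "\<delta> i (\<lambda>x. a * h x + b * k x) q = a * \<delta> i h q + b * \<delta> i k q"
    if "q \<in> V" "h \<in> \<F>" "k \<in> \<F>" for i h k a b q
    unfolding \<delta>_def
    by (rule frechet_derivative_eqI)
      (auto intro!: derivative_eq_intros chart_smooth_derivative[OF V(1) that(1)] that)
  have \<delta>_mult: "\<delta> i (\<lambda>x. h x * k x) q = h q * \<delta> i k q + k q * \<delta> i h q"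
    if "q \<in> V" "h \<in> \<F>" "k \<in> \<F>" for i h k q
    unfolding \<delta>_def
    by (rule frechet_derivative_eqI[THEN trans, OF has_derivative_mult[OF
        chart_smooth_derivative[OF V(1) that(1,2)] chart_smooth_derivative[OF V(1) that(1,3)]]])
      (simp add: chart_inv[OF V(1) that(1)])
  have \<tau>V: "\<tau> q = 0" if "q \<notin> V" for q using that \<tau>0 C by blast
  have tangent: "X i q \<in> \<T> q" for i q
    by (rule tangentI; cases "q \<in> V")
      (auto simp: X_def smooth_lincomb smooth_mult \<delta>_lin \<delta>_mult \<tau>V algebra_simps)
  have "X i \<in> \<X>" for i
    unfolding vector_fields_def
  proof (intro CollectI conjI allI ballI tangent)
    fix h assume h: "h \<in> \<F>"
    have "locally_smooth V (\<delta> i h)"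
      unfolding locally_smooth_def
    proof
      fix q assume q: "q \<in> V"
      then have "\<phi> q \<in> \<phi> ` V" by blast
      from chart_extension[OF V(1) q chart_open[OF V(1)] this
          smooth_on_frechet_derivative[OF smooth_functionsD[OF h V(1)], of i]]
      show "\<exists>W k. openin (mtop M) W \<and> q \<in> W \<and> k \<in> \<F> \<and> (\<forall>q\<in>W. \<delta> i h q = k q)"
        unfolding \<delta>_def by metis
    qed
    then have "locally_smooth C (\<delta> i h)" using C(2) unfolding locally_smooth_def by blast
    from smooth_cutoff[OF \<tau> C(1) \<tau>0 this] show "(\<lambda>p. X i p h) \<in> \<F>"
      using h by (simp add: X_def)
  qed
  moreover have Xx: "X i q (x j) = (if i = j then 1 else 0)" if "q \<in> U" "i \<in> Basis" "j \<in> Basis" for q i j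
  proof -
    have V': "open (\<phi> ` (V \<inter> W j))" by (rule chart_image_open[OF V(1) W(1)])
    have "((\<lambda>y. x j (inv_into V \<phi> y)) has_derivative (\<lambda>y. y \<bullet> j)) (at (\<phi> q))"
      by (rule has_derivative_transform_within_open[OF bounded_linear_imp_has_derivative[OF bounded_linear_inner_left] V'])
        (use that UV xW chart_inv[OF V(1)] in \<open>auto simp: U_def\<close>)
    then show ?thesis
      using that x UV by (simp add: X_def \<delta>_def frechet_derivative_eqI inner_Basis)
  qed
  moreover have "v h = (\<Sum>i\<in>Basis. v (x i) * X i q h)" if q: "q \<in> U" and v: "v \<in> \<T> q" for q v h
  proof (cases "h \<in> \<F>")
    case True
    obtain c where c: "\<And>h. h \<in> \<F> \<Longrightarrow> v h = (\<Sum>i\<in>Basis. c i * X i q h)"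
    proof -
      obtain c where "\<And>h. h \<in> \<F> \<Longrightarrow> v h = (\<Sum>i\<in>Basis. c i * \<delta> i h q)"
        using chart_tangent[OF V(1) UV(1)[OF q] v] unfolding \<delta>_def by metis
      then show thesis using that[of c] UV(2)[OF q] by (simp add: X_def)
    qed
    \<comment> \<open>Evaluating on the coordinate functions, which are dual to the frame,
      identifies the coefficients.\<close>
    have "v (x j) = c j" if "j \<in> Basis" for j
      using c[OF x, of j] that Xx[OF q] by (simp add: if_distrib[of "(*) _"] sum.delta cong: if_cong)
    then show ?thesis using c[OF True] by simp
  qed (use tangent_out[OF v] tangent_out[OF tangent] in simp)
  ultimately show ?thesis using that[OF U, of x X] x by simp
qed

end

section \<open>Vector fields and 1-forms\<close>

context smooth_mfd
begin

lemma cotangent_out: "\<xi> \<in> \<C> p \<Longrightarrow> v \<notin> \<T> p \<Longrightarrow> \<xi> v = 0"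
  unfolding cotangent_space_def dual_def by blast

lemma cotangent_lincomb:
  "\<xi> \<in> \<C> p \<Longrightarrow> v \<in> \<T> p \<Longrightarrow> w \<in> \<T> p \<Longrightarrow> \<xi> (\<lambda>h. a * v h + b * w h) = a * \<xi> v + b * \<xi> w"
  unfolding cotangent_space_def dual_def linear_functional_on_def by blast

lemma cotangentI:
  assumes "\<And>v. v \<notin> \<T> p \<Longrightarrow> \<xi> v = 0"
    and "\<And>v w a b. v \<in> \<T> p \<Longrightarrow> w \<in> \<T> p \<Longrightarrow> \<xi> (\<lambda>h. a * v h + b * w h) = a * \<xi> v + b * \<xi> w"
  shows "\<xi> \<in> \<C> p"
  using assms unfolding cotangent_space_def dual_def linear_functional_on_def by blast

lemma cotangent_at_zero: "\<xi> \<in> \<C> p \<Longrightarrow> \<xi> (\<lambda>h. 0) = 0"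
  using cotangent_lincomb[of \<xi> p "\<lambda>h. 0" "\<lambda>h. 0" 0 0] tangent_zero by simp

lemma cotangent_sum:
  assumes "\<xi> \<in> \<C> p" "\<And>i. i \<in> A \<Longrightarrow> v i \<in> \<T> p"
  shows "\<xi> (\<lambda>h. \<Sum>i\<in>A. c i * v i h) = (\<Sum>i\<in>A. c i * \<xi> (v i))"
  using assms(2)
proof (induction A rule: infinite_finite_induct)
  case (insert i A)
  then show ?case
    using cotangent_lincomb[OF assms(1), of "v i" "\<lambda>h. \<Sum>i\<in>A. c i * v i h" "c i" 1]
      tangent_closed_sum[of A v p c] by simp
qed (auto simp: cotangent_at_zero[OF assms(1)])

lemma cotangent_eqI: "\<xi> \<in> \<C> p \<Longrightarrow> \<zeta> \<in> \<C> p \<Longrightarrow> (\<And>v. v \<in> \<T> p \<Longrightarrow> \<xi> v = \<zeta> v) \<Longrightarrow> \<xi> = \<zeta>"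
  using cotangent_out by (metis ext)

lemma cotangent_zero: "(\<lambda>v. 0) \<in> \<C> p"
  by (rule cotangentI) auto

lemma cotangent_closed_lincomb:
  assumes "\<xi> \<in> \<C> p" "\<zeta> \<in> \<C> p"
  shows "(\<lambda>v. a * \<xi> v + b * \<zeta> v) \<in> \<C> p"
  by (rule cotangentI)
    (simp_all add: cotangent_out[OF assms(1)] cotangent_out[OF assms(2)] cotangent_lincomb[OF assms(1)]
      cotangent_lincomb[OF assms(2)] algebra_simps)

lemma cotangent_outside:
  assumes "p \<notin> points M" "\<xi> \<in> \<C> p"
  shows "\<xi> = (\<lambda>v. 0)"
proof (rule cotangent_eqI[OF assms(2) cotangent_zero])
  fix v assume "v \<in> \<T> p"
  then have "v = (\<lambda>h. 0)" using tangent_space_outside[OF smooth_manifold assms(1)] by blast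
  then show "\<xi> v = 0" using cotangent_at_zero[OF assms(2)] by simp
qed

lemma fields_tangent: "X \<in> \<X> \<Longrightarrow> X p \<in> \<T> p"
  unfolding vector_fields_def by blast

lemma fields_smooth: "X \<in> \<X> \<Longrightarrow> h \<in> \<F> \<Longrightarrow> (\<lambda>p. X p h) \<in> \<F>"
  unfolding vector_fields_def by blast

lemma fieldsI:
  "(\<And>p. X p \<in> \<T> p) \<Longrightarrow> (\<And>h. h \<in> \<F> \<Longrightarrow> (\<lambda>p. X p h) \<in> \<F>) \<Longrightarrow> X \<in> \<X>"
  unfolding vector_fields_def by blast

lemma fields_lincomb:
  assumes "X \<in> \<X>" "Y \<in> \<X>" "h \<in> \<F>" "k \<in> \<F>"
  shows "(\<lambda>p f. h p * X p f + k p * Y p f) \<in> \<X>"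
proof (rule fieldsI)
  show "(\<lambda>f. h p * X p f + k p * Y p f) \<in> \<T> p" for p
    by (rule tangent_closed_lincomb[OF fields_tangent[OF assms(1)] fields_tangent[OF assms(2)]])
  show "(\<lambda>p. h p * X p f + k p * Y p f) \<in> \<F>" if "f \<in> \<F>" for f
    by (rule smooth_add[OF smooth_mult[OF assms(3) fields_smooth[OF assms(1) that]]
        smooth_mult[OF assms(4) fields_smooth[OF assms(2) that]]])
qed

lemma fields_sum:
  assumes "\<And>i. i \<in> A \<Longrightarrow> X i \<in> \<X>" "\<And>i. i \<in> A \<Longrightarrow> c i \<in> \<F>"
  shows "(\<lambda>p f. \<Sum>i\<in>A. c i p * X i p f) \<in> \<X>"
proof (rule fieldsI)
  show "(\<lambda>f. \<Sum>i\<in>A. c i p * X i p f) \<in> \<T> p" for p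
    using tangent_closed_sum[of A "\<lambda>i. X i p" p "\<lambda>i. c i p"] fields_tangent[OF assms(1)] by simp
  show "(\<lambda>p. \<Sum>i\<in>A. c i p * X i p f) \<in> \<F>" if "f \<in> \<F>" for f
    by (rule smooth_sum) (rule smooth_mult[OF assms(2) fields_smooth[OF assms(1) that]])
qed

lemma forms_cotangent: "\<omega> \<in> \<Omega> \<Longrightarrow> \<omega> p \<in> \<C> p"
  unfolding one_forms_def by blast

lemma forms_smooth: "\<omega> \<in> \<Omega> \<Longrightarrow> X \<in> \<X> \<Longrightarrow> (\<lambda>p. \<omega> p (X p)) \<in> \<F>"
  unfolding one_forms_def by blast

lemma formsI:
  "(\<And>p. \<omega> p \<in> \<C> p) \<Longrightarrow> (\<And>X. X \<in> \<X> \<Longrightarrow> (\<lambda>p. \<omega> p (X p)) \<in> \<F>) \<Longrightarrow> \<omega> \<in> \<Omega>"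
  unfolding one_forms_def by blast

lemma forms_lincomb:
  assumes "\<omega> \<in> \<Omega>" "\<eta> \<in> \<Omega>" "h \<in> \<F>" "k \<in> \<F>"
  shows "(\<lambda>p v. h p * \<omega> p v + k p * \<eta> p v) \<in> \<Omega>"
proof (rule formsI)
  show "(\<lambda>v. h p * \<omega> p v + k p * \<eta> p v) \<in> \<C> p" for p
    by (rule cotangent_closed_lincomb[OF forms_cotangent[OF assms(1)] forms_cotangent[OF assms(2)]])
  show "(\<lambda>p. h p * \<omega> p (X p) + k p * \<eta> p (X p)) \<in> \<F>" if "X \<in> \<X>" for X
    by (rule smooth_add[OF smooth_mult[OF assms(3) forms_smooth[OF assms(1) that]]
        smooth_mult[OF assms(4) forms_smooth[OF assms(2) that]]])
qed

lemma form_add_in: "\<omega> \<in> \<Omega> \<Longrightarrow> \<eta> \<in> \<Omega> \<Longrightarrow> form_add \<omega> \<eta> \<in> \<Omega>"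
  using forms_lincomb[of \<omega> \<eta> "\<lambda>p. 1" "\<lambda>p. 1"] by (simp add: form_add_def smooth_const)

lemma form_scale_in: "h \<in> \<F> \<Longrightarrow> \<omega> \<in> \<Omega> \<Longrightarrow> form_scale h \<omega> \<in> \<Omega>"
  using forms_lincomb[of \<omega> \<omega> h "\<lambda>p. 0"] by (simp add: form_scale_def smooth_const)

lemma zero_form_in: "zero_form \<in> \<Omega>"
  by (rule formsI) (auto simp: zero_form_def cotangent_zero smooth_const)

lemma forms_sum:
  assumes "\<And>i. i \<in> A \<Longrightarrow> c i \<in> \<F>" "\<And>i. i \<in> A \<Longrightarrow> \<theta> i \<in> \<Omega>"
  shows "(\<lambda>p v. \<Sum>i\<in>A. c i p * \<theta> i p v) \<in> \<Omega>"
  using assms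
proof (induction A rule: infinite_finite_induct)
  case (insert i A)
  then show ?case
    using forms_lincomb[of "\<theta> i" "\<lambda>p v. \<Sum>i\<in>A. c i p * \<theta> i p v" "c i" "\<lambda>p. 1"] by (simp add: smooth_const)
qed (use zero_form_in in \<open>simp_all add: zero_form_def\<close>)

lemma differential_apply: "v \<in> \<T> p \<Longrightarrow> differential M h p v = v h"
  by (simp add: differential_def)

lemma differential_cotangent: "differential M h p \<in> \<C> p"
  by (rule cotangentI) (auto simp: differential_def tangent_closed_lincomb)

lemma differential_in: "h \<in> \<F> \<Longrightarrow> differential M h \<in> \<Omega>"
  by (rule formsI) (auto simp: differential_cotangent differential_apply fields_tangent fields_smooth)

lemma differential_cong:
  assumes "h \<in> \<F>" "\<And>p. p \<in> points M \<Longrightarrow> h p = k p"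
  shows "differential M h = differential M k"
proof (intro ext)
  fix p v
  show "differential M h p v = differential M k p v"
  proof (cases "p \<in> points M")
    case True
    then show ?thesis using tangent_cong[OF _ True assms(1), of v k] assms(2) by (simp add: differential_def)
  next
    case False
    then show ?thesis using tangent_space_outside[OF smooth_manifold False] by (simp add: differential_def)
  qed
qed

lemma differential_mult:
  assumes "h \<in> \<F>" "k \<in> \<F>"
  shows "differential M (\<lambda>x. h x * k x) p = (\<lambda>v. h p * differential M k p v + k p * differential M h p v)"
  using tangent_mult[OF _ assms] by (auto simp: differential_def)

lemma differential_lincomb:
  assumes "h \<in> \<F>" "k \<in> \<F>"
  shows "differential M (\<lambda>x. a * h x + b * k x) p = (\<lambda>v. a * differential M h p v + b * differential M k p v)"
  using tangent_lincomb[OF _ assms] by (auto simp: differential_def)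

text \<open>Freeze the frame coefficients of \<open>v\<close> as constants. Identities between forms
  can then be tested on vector fields.\<close>

lemma field_through:
  assumes "p \<in> points M" "v \<in> \<T> p"
  obtains X where "X \<in> \<X>" "X p = v"
proof -
  obtain x :: "'e \<Rightarrow> 'a \<Rightarrow> real" and X W where W: "openin (mtop M) W" "p \<in> W" and x: "\<And>i. x i \<in> \<F>" and X: "\<And>i. X i \<in> \<X>"
    and v: "\<And>q v h. q \<in> W \<Longrightarrow> v \<in> \<T> q \<Longrightarrow> v h = (\<Sum>i\<in>Basis. v (x i) * X i q h)"
    by (rule frame[OF assms(1)], rule that)
  let ?X = "\<lambda>q h. \<Sum>i\<in>Basis. v (x i) * X i q h"
  have "?X \<in> \<X>" using fields_sum[of Basis X "\<lambda>i q. v (x i)"] X smooth_const by simp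
  moreover have "?X p = v" by (rule ext) (rule v[OF W(2) assms(2), symmetric])
  ultimately show ?thesis by (rule that)
qed

lemma forms_eqI:
  assumes "\<omega> \<in> \<Omega>" "\<eta> \<in> \<Omega>" "\<And>X p. X \<in> \<X> \<Longrightarrow> p \<in> points M \<Longrightarrow> \<omega> p (X p) = \<eta> p (X p)"
  shows "\<omega> = \<eta>"
proof
  fix p
  show "\<omega> p = \<eta> p"
  proof (cases "p \<in> points M")
    case True
    show ?thesis
      by (rule cotangent_eqI[OF forms_cotangent[OF assms(1)] forms_cotangent[OF assms(2)]])
        (use field_through[OF True] assms(3)[OF _ True] in metis)
  next
    case False
    then show ?thesis
      by (simp only: cotangent_outside[OF False forms_cotangent[OF assms(1)]]
          cotangent_outside[OF False forms_cotangent[OF assms(2)]])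
  qed
qed

lemma forms_zeroI:
  assumes "\<omega> \<in> \<Omega>" "\<And>p. p \<in> points M \<Longrightarrow> \<omega> p = (\<lambda>v. 0)"
  shows "\<omega> = zero_form"
proof (rule ext)
  show "\<omega> p = zero_form p" for p
    using assms(2)[of p] cotangent_outside[OF _ forms_cotangent[OF assms(1)], of p] unfolding zero_form_def by blast
qed

text \<open>The function whose coefficients in the coordinates are the components of \<xi> has
  differential \<xi> at \<open>p\<close>. This holds at the single point \<open>p\<close> only,
  which is enough for tensorial expressions.\<close>

lemma cotangent_exact:
  assumes "p \<in> points M" "\<xi> \<in> \<C> p"
  obtains F where "F \<in> \<F>" "\<xi> = differential M F p"
proof -
  obtain x :: "'e \<Rightarrow> 'a \<Rightarrow> real" and X W where W: "openin (mtop M) W" "p \<in> W" and x: "\<And>i. x i \<in> \<F>" and X: "\<And>i. X i \<in> \<X>"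
    and v: "\<And>q v h. q \<in> W \<Longrightarrow> v \<in> \<T> q \<Longrightarrow> v h = (\<Sum>i\<in>Basis. v (x i) * X i q h)"
    by (rule frame[OF assms(1)], rule that)
  let ?F = "\<lambda>q. \<Sum>i\<in>Basis. \<xi> (X i p) * x i q"
  have f: "(\<lambda>q. \<xi> (X i p) * x i q) \<in> \<F>" for i by (intro smooth_mult smooth_const x)
  have "\<xi> = differential M ?F p"
  proof (rule cotangent_eqI[OF assms(2) differential_cotangent])
    fix w assume w: "w \<in> \<T> p"
    have "\<xi> w = \<xi> (\<lambda>h. \<Sum>i\<in>Basis. w (x i) * X i p h)"
      using v[OF W(2) w] by (metis ext)
    also have "\<dots> = (\<Sum>i\<in>Basis. w (x i) * \<xi> (X i p))"
      using cotangent_sum[OF assms(2), of Basis "\<lambda>i. X i p"] fields_tangent[OF X] by simp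
    also have "\<dots> = w ?F"
      unfolding tangent_sum[OF w f] tangent_scale[OF w x] by (simp add: mult.commute)
    finally show "\<xi> w = differential M ?F p w" using differential_apply[OF w] by simp
  qed
  then show ?thesis using that[of ?F] smooth_sum[of Basis "\<lambda>i q. \<xi> (X i p) * x i q", OF f] by blast
qed

text \<open>Linearity over the ring of smooth functions, stated for the value at a single point: a
  factor \<open>h\<close> comes out as the number \<open>h p\<close>.\<close>

definition tensorial_at :: "'a \<Rightarrow> ('a form \<Rightarrow> real) \<Rightarrow> bool" where
  "tensorial_at p Q \<longleftrightarrow> (\<forall>\<omega>\<in>\<Omega>. \<forall>\<eta>\<in>\<Omega>. Q (form_add \<omega> \<eta>) = Q \<omega> + Q \<eta>) \<and>
    (\<forall>h\<in>\<F>. \<forall>\<omega>\<in>\<Omega>. Q (form_scale h \<omega>) = h p * Q \<omega>)"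

lemma tensorial_atI:
  assumes "\<And>\<omega> \<eta>. \<omega> \<in> \<Omega> \<Longrightarrow> \<eta> \<in> \<Omega> \<Longrightarrow> Q (form_add \<omega> \<eta>) = Q \<omega> + Q \<eta>"
    and "\<And>h \<omega>. h \<in> \<F> \<Longrightarrow> \<omega> \<in> \<Omega> \<Longrightarrow> Q (form_scale h \<omega>) = h p * Q \<omega>"
  shows "tensorial_at p Q"
  using assms unfolding tensorial_at_def by blast

lemma tensorial_sum:
  assumes Q: "tensorial_at p Q" and "finite A" "\<And>i. i \<in> A \<Longrightarrow> c i \<in> \<F>" "\<And>i. i \<in> A \<Longrightarrow> \<theta> i \<in> \<Omega>"
  shows "Q (\<lambda>q v. \<Sum>i\<in>A. c i q * \<theta> i q v) = (\<Sum>i\<in>A. c i p * Q (\<theta> i))"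
  using assms(2-)
proof (induction A rule: finite_induct)
  case empty
  have "Q (form_scale (\<lambda>q. 0) zero_form) = 0 * Q zero_form"
    using Q smooth_const zero_form_in unfolding tensorial_at_def by blast
  then show ?case by (simp add: form_scale_def)
next
  case (insert i A)
  let ?S = "\<lambda>q v. \<Sum>i\<in>A. c i q * \<theta> i q v"
  have i: "c i \<in> \<F>" "\<theta> i \<in> \<Omega>" and S: "?S \<in> \<Omega>" using insert.prems by (auto intro: forms_sum)
  have "(\<lambda>q v. \<Sum>i\<in>insert i A. c i q * \<theta> i q v) = form_add (form_scale (c i) (\<theta> i)) ?S"
    using insert.hyps by (simp add: form_add_def form_scale_def)
  moreover have "Q (form_add (form_scale (c i) (\<theta> i)) ?S) = Q (form_scale (c i) (\<theta> i)) + Q ?S"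
    and "Q (form_scale (c i) (\<theta> i)) = c i p * Q (\<theta> i)"
    using Q form_scale_in[OF i] i S unfolding tensorial_at_def by blast+
  ultimately show ?case using insert by simp
qed

text \<open>Together with \<open>cotangent_exact\<close> this reduces tensorial identities to exact forms.\<close>

lemma tensorial:
  assumes p: "p \<in> points M" and Q: "tensorial_at p Q"
    and \<omega>\<eta>: "\<omega> \<in> \<Omega>" "\<eta> \<in> \<Omega>" "\<omega> p = \<eta> p"
  shows "Q \<omega> = Q \<eta>"
proof -
  obtain x :: "'e \<Rightarrow> 'a \<Rightarrow> real" and X W where W: "openin (mtop M) W" "p \<in> W" and x: "\<And>i. x i \<in> \<F>" and X: "\<And>i. X i \<in> \<X>"
    and v: "\<And>q v h. q \<in> W \<Longrightarrow> v \<in> \<T> q \<Longrightarrow> v h = (\<Sum>i\<in>Basis. v (x i) * X i q h)"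
    by (rule frame[OF p], rule that)
  obtain \<tau> C where \<tau>: "\<tau> \<in> \<F>" "\<tau> p = 1" "C \<subseteq> W" "\<And>q. q \<notin> C \<Longrightarrow> \<tau> q = 0"
    using bump[OF W] by metis
  have Q_eq: "Q \<omega> = (\<Sum>i\<in>Basis. \<omega> p (X i p) * Q (differential M (x i)))" if \<omega>: "\<omega> \<in> \<Omega>" for \<omega>
  proof -
    \<comment> \<open>The expansion of \<omega> in coordinate differentials is valid on
      \<open>W\<close> only. Multiplied by the cut-off it becomes an identity of global forms, and
      nothing is lost because \<open>\<tau> p = 1\<close>.\<close>
    have "form_scale \<tau> \<omega> = (\<lambda>q v. \<Sum>i\<in>Basis. (\<tau> q * \<omega> q (X i q)) * differential M (x i) q v)"
    proof (intro ext)
      fix q w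
      show "form_scale \<tau> \<omega> q w = (\<Sum>i\<in>Basis. (\<tau> q * \<omega> q (X i q)) * differential M (x i) q w)"
      proof (cases "w \<in> \<T> q \<and> q \<in> W")
        case True
        then have w: "w = (\<lambda>h. \<Sum>i\<in>Basis. w (x i) * X i q h)" using v by blast
        have "\<omega> q w = (\<Sum>i\<in>Basis. w (x i) * \<omega> q (X i q))"
          using cotangent_sum[OF forms_cotangent[OF \<omega>], of Basis "\<lambda>i. X i q" q "\<lambda>i. w (x i)"]
            fields_tangent[OF X] w by simp
        then show ?thesis
          using True by (simp add: form_scale_def differential_apply sum_distrib_left mult_ac)
      next
        case False
        then consider "w \<notin> \<T> q" | "\<tau> q = 0" using \<tau>(3,4) by blast
        then show ?thesis
          by cases (simp_all add: form_scale_def differential_def cotangent_out[OF forms_cotangent[OF \<omega>]])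
      qed
    qed
    then have "Q (form_scale \<tau> \<omega>) = (\<Sum>i\<in>Basis. (\<tau> p * \<omega> p (X i p)) * Q (differential M (x i)))"
      using tensorial_sum[OF Q, of Basis "\<lambda>i q. \<tau> q * \<omega> q (X i q)" "\<lambda>i. differential M (x i)"]
        smooth_mult[OF \<tau>(1) forms_smooth[OF \<omega> X]] differential_in[OF x] by simp
    moreover have "Q (form_scale \<tau> \<omega>) = \<tau> p * Q \<omega>" using Q \<tau>(1) \<omega> unfolding tensorial_at_def by blast
    ultimately show ?thesis using \<tau>(2) by simp
  qed
  show ?thesis using Q_eq[OF \<omega>\<eta>(1)] Q_eq[OF \<omega>\<eta>(2)] \<omega>\<eta>(3) by simp
qed

lemma tensorial_zero:
  assumes p: "p \<in> points M" and Q: "tensorial_at p Q" and exact: "\<And>F. F \<in> \<F> \<Longrightarrow> Q (differential M F) = 0"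
    and \<omega>: "\<omega> \<in> \<Omega>"
  shows "Q \<omega> = 0"
proof -
  obtain F where F: "F \<in> \<F>" "\<omega> p = differential M F p"
    by (rule cotangent_exact[OF p forms_cotangent[OF \<omega>]])
  then show ?thesis using tensorial[OF p Q \<omega> differential_in[OF F(1)] F(2)] exact by simp
qed

text \<open>The mixed products of first derivatives, which spoil the Leibniz rule for X Y and Y X
  separately, are symmetric in X and Y and cancel in the commutator.\<close>

lemma lie_bracket_tangent:
  assumes X: "X \<in> \<X>" and Y: "Y \<in> \<X>"
  shows "lie_bracket X Y p \<in> \<T> p"
proof (rule tangentI)
  note Xp = fields_tangent[OF X] and Yp = fields_tangent[OF Y]
    and Xs = fields_smooth[OF X] and Ys = fields_smooth[OF Y]
  show "lie_bracket X Y p h = 0" if "h \<notin> \<F>" for h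
    using that by (simp add: lie_bracket_def tangent_out[OF Xp that] tangent_out[OF Yp that]
        tangent_const[OF Xp] tangent_const[OF Yp])
  show "lie_bracket X Y p (\<lambda>x. a * h x + b * k x) = a * lie_bracket X Y p h + b * lie_bracket X Y p k"
    if "h \<in> \<F>" "k \<in> \<F>" for h k a b
    using that by (simp add: lie_bracket_def tangent_lincomb[OF Xp] tangent_lincomb[OF Yp] Xs Ys algebra_simps)
  show "lie_bracket X Y p (\<lambda>x. h x * k x) = h p * lie_bracket X Y p k + k p * lie_bracket X Y p h"
    if "h \<in> \<F>" "k \<in> \<F>" for h k
    using that by (simp add: lie_bracket_def tangent_add[OF Xp] tangent_add[OF Yp]
        tangent_mult[OF Xp] tangent_mult[OF Yp] Xs Ys smooth_mult algebra_simps)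
qed

text \<open>X (Y k) - [X, Y] k = Y (X k), so d(X k) satisfies the characterisation;
  \<open>forms_eqI\<close> gives uniqueness. This evaluates the definite description on exact
  forms.\<close>

lemma lie_derivative_differential:
  assumes X: "X \<in> \<X>" and k: "k \<in> \<F>"
  shows "lie_derivative M X (differential M k) = differential M (\<lambda>p. X p k)"
  unfolding lie_derivative_def
proof (rule the_equality)
  have eq: "differential M (\<lambda>p. X p k) p (Y p) =
      X p (\<lambda>q. differential M k q (Y q)) - differential M k p (lie_bracket X Y p)" if "Y \<in> \<X>" for Y p
    by (simp add: differential_apply fields_tangent[OF that] lie_bracket_tangent[OF X that])
      (simp add: lie_bracket_def)
  then show "differential M (\<lambda>p. X p k) \<in> \<Omega> \<and> (\<forall>Y\<in>\<X>. \<forall>p\<in>points M. differential M (\<lambda>p. X p k) p (Y p) =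
      X p (\<lambda>q. differential M k q (Y q)) - differential M k p (lie_bracket X Y p))"
    using differential_in[OF fields_smooth[OF X k]] by blast
  show "\<zeta> = differential M (\<lambda>p. X p k)"
    if "\<zeta> \<in> \<Omega> \<and> (\<forall>Y\<in>\<X>. \<forall>p\<in>points M. \<zeta> p (Y p) =
      X p (\<lambda>q. differential M k q (Y q)) - differential M k p (lie_bracket X Y p))" for \<zeta>
    using that eq by (intro forms_eqI differential_in[OF fields_smooth[OF X k]]) auto
qed

end

section \<open>Orthonormal frames and the cometric\<close>

text \<open>The linear map sending the standard basis to \<open>u\<close> preserves coordinates in
  the sense of \<open>Lu\<close>, hence is injective and, by dimension, surjective.\<close>

lemma orthonormal_expansion:
  fixes u :: "'e \<Rightarrow> 'e::euclidean_space"
  assumes u: "\<And>i j. i \<in> Basis \<Longrightarrow> j \<in> Basis \<Longrightarrow> u i \<bullet> u j = (if i = j then 1 else 0)"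
  shows "y = (\<Sum>i\<in>Basis. (y \<bullet> u i) *\<^sub>R u i)"
proof -
  define L where "L z = (\<Sum>i\<in>Basis. (z \<bullet> i) *\<^sub>R u i)" for z
  have lin: "linear L"
    unfolding L_def by (rule linearI) (auto simp: inner_add_left scaleR_add_left sum.distrib scaleR_sum_right)
  have Lu: "L z \<bullet> u j = z \<bullet> j" if "j \<in> Basis" for z j
    using that u by (simp add: L_def inner_sum_left if_distrib[of "(*) _"] sum.delta cong: if_cong)
  have "inj L"
    using Lu unfolding linear_injective_0[OF lin] by (metis euclidean_eqI inner_zero_left)
  then have "surj L" using lin linear_injective_imp_surjective by blast
  then obtain z where z: "y = L z" by blast
  then show ?thesis using Lu by (simp add: L_def)
qed

locale riem_mfd = smooth_mfd M for M :: "('a, 'e::euclidean_space) manifold" +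
  fixes gt :: "'a cov_tensor"
  assumes metric: "riemannian_metric M gt"
begin

abbreviation g :: "'a contra_tensor" where "g \<equiv> cometric M gt"

lemma gt_sym: "p \<in> points M \<Longrightarrow> v \<in> \<T> p \<Longrightarrow> w \<in> \<T> p \<Longrightarrow> gt p v w = gt p w v"
  using metric unfolding riemannian_metric_def by blast

lemma gt_pos: "p \<in> points M \<Longrightarrow> v \<in> \<T> p \<Longrightarrow> v \<noteq> (\<lambda>h. 0) \<Longrightarrow> gt p v v > 0"
  using metric unfolding riemannian_metric_def by blast

lemma gt_smooth: "X \<in> \<X> \<Longrightarrow> Y \<in> \<X> \<Longrightarrow> (\<lambda>p. gt p (X p) (Y p)) \<in> \<F>"
  using metric unfolding riemannian_metric_def by blast

lemma gt_lincomb: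
  assumes "p \<in> points M" "v \<in> \<T> p" "w \<in> \<T> p" "u \<in> \<T> p"
  shows "gt p (\<lambda>h. a * v h + b * w h) u = a * gt p v u + b * gt p w u"
    and "gt p u (\<lambda>h. a * v h + b * w h) = a * gt p u v + b * gt p u w"
  using metric assms unfolding riemannian_metric_def bilinear_form_on_def linear_functional_on_def by blast+

lemma gt_zero:
  assumes "p \<in> points M" "u \<in> \<T> p"
  shows "gt p (\<lambda>h. 0) u = 0"
  using gt_lincomb(1)[OF assms(1) tangent_zero tangent_zero assms(2), of 0 0] by simp

lemma gt_sum:
  assumes "p \<in> points M" "\<And>i. i \<in> A \<Longrightarrow> v i \<in> \<T> p" "u \<in> \<T> p"
  shows "gt p (\<lambda>h. \<Sum>i\<in>A. c i * v i h) u = (\<Sum>i\<in>A. c i * gt p (v i) u)"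
  using assms(2)
proof (induction A rule: infinite_finite_induct)
  case (insert i A)
  then show ?case
    using gt_lincomb(1)[OF assms(1) _ _ assms(3), of "v i" "\<lambda>h. \<Sum>i\<in>A. c i * v i h" "c i" 1]
      tangent_closed_sum[of A v p c] by simp
qed (auto simp: gt_zero[OF assms(1,3)])

text \<open>The second invariant keeps the next vector \<open>Y\<close> away from \<open>0\<close>, the third one keeps track of the span.\<close>

lemma gram_schmidt:
  assumes p: "p \<in> points M" and W: "openin (mtop M) W" "p \<in> W"
    and x: "\<And>i. x i \<in> \<F>" and X: "\<And>i. X i \<in> \<X>"
    and Xx: "\<forall>q\<in>W. \<forall>i\<in>Basis. \<forall>j\<in>Basis. X i q (x j) = (if i = j then 1 else 0)"
    and A: "finite A" "A \<subseteq> (Basis :: 'e set)"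
  shows "\<exists>E U. openin (mtop M) U \<and> p \<in> U \<and> U \<subseteq> W \<and> (\<forall>i. E i \<in> \<X>) \<and>
    (\<forall>q\<in>U. (\<forall>i\<in>A. \<forall>j\<in>A. gt q (E i q) (E j q) = (if i = j then 1 else 0)) \<and>
      (\<forall>i\<in>A. \<forall>k\<in>Basis - A. E i q (x k) = 0) \<and>
      (\<forall>i\<in>A. \<exists>c. \<forall>h. X i q h = (\<Sum>k\<in>A. c k * E k q h)))"
  using A
proof (induction A rule: finite_induct)
  case empty
  show ?case using W X by (intro exI[of _ X] exI[of _ W]) auto
next
  case (insert i A)
  then have iB: "i \<in> Basis" "A \<subseteq> Basis" by auto
  from insert.IH[OF iB(2)] obtain E U where U: "openin (mtop M) U" "p \<in> U" "U \<subseteq> W" and E': "\<forall>i. E i \<in> \<X>"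
    and all: "\<forall>q\<in>U. (\<forall>i\<in>A. \<forall>j\<in>A. gt q (E i q) (E j q) = (if i = j then 1 else 0)) \<and>
      (\<forall>i\<in>A. \<forall>k\<in>Basis - A. E i q (x k) = 0) \<and>
      (\<forall>i\<in>A. \<exists>c. \<forall>h. X i q h = (\<Sum>k\<in>A. c k * E k q h))"
    by (elim exE conjE) (rule that, assumption+)
  have E: "E i \<in> \<X>" for i using E' by blast
  have ortho: "\<And>q i j. q \<in> U \<Longrightarrow> i \<in> A \<Longrightarrow> j \<in> A \<Longrightarrow> gt q (E i q) (E j q) = (if i = j then 1 else 0)"
    using all by fast
  have Ex: "\<And>q i k. q \<in> U \<Longrightarrow> i \<in> A \<Longrightarrow> k \<in> Basis - A \<Longrightarrow> E i q (x k) = 0"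
    using all by fast
  have span: "\<And>q i. q \<in> U \<Longrightarrow> i \<in> A \<Longrightarrow> \<exists>c. \<forall>h. X i q h = (\<Sum>k\<in>A. c k * E k q h)"
    using all by fast
  have Up: "q \<in> points M" if "q \<in> U" for q using that openin_subset[OF U(1)] by blast
  have Ep: "E k q \<in> \<T> q" and Xp: "X k q \<in> \<T> q" for k q
    by (rule fields_tangent[OF E], rule fields_tangent[OF X])
  \<comment> \<open>The orthogonal projection of \<open>X i\<close> to the span of the vectors
    already constructed.\<close>
  define S where "S q h = (\<Sum>k\<in>A. gt q (X i q) (E k q) * E k q h)" for q h
  have S: "S \<in> \<X>"
    unfolding S_def using fields_sum[of A E "\<lambda>k q. gt q (X i q) (E k q)"] E gt_smooth[OF X E] by blast
  note Sp = fields_tangent[OF S]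
  \<comment> \<open>The explicit coefficients, here and in \<open>Z\<close> below, give the shape
    that \<open>fields_lincomb\<close> and \<open>gt_lincomb\<close> expect.\<close>
  define Y where "Y q h = 1 * X i q h + (-1) * S q h" for q h
  have Y: "Y \<in> \<X>"
    unfolding Y_def by (rule fields_lincomb[OF X S smooth_const smooth_const])
  note Yp = fields_tangent[OF Y]
  have Yx: "Y q (x k) = (if i = k then 1 else 0)" if "q \<in> U" "k \<in> Basis - A" for q k
    using that Ex[OF that(1) _ that(2)] Xx U(3) iB by (auto simp: Y_def S_def)
  have YE: "gt q (Y q) (E j q) = 0" if "q \<in> U" "j \<in> A" for q j
  proof -
    have "gt q (S q) (E j q) = (\<Sum>k\<in>A. gt q (X i q) (E k q) * gt q (E k q) (E j q))"
      unfolding S_def by (rule gt_sum[OF Up[OF that(1)] Ep Ep])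
    also have "\<dots> = gt q (X i q) (E j q)"
      using that insert.hyps ortho[OF that(1) _ that(2)] by (simp add: if_distrib[of "(*) _"] sum.delta cong: if_cong)
    finally show ?thesis
      unfolding Y_def using gt_lincomb(1)[OF Up[OF that(1)] Xp Sp Ep, of 1 i "-1"] by simp
  qed
  define N where "N q = gt q (Y q) (Y q)" for q
  have N: "N \<in> \<F>" unfolding N_def by (rule gt_smooth[OF Y Y])
  \<comment> \<open>The projection \<open>S\<close> is annihilated by the coordinate
    \<open>x i\<close>, whereas \<open>X i\<close> takes the value 1 on it.\<close>
  have "Y p \<noteq> (\<lambda>h. 0)" using Yx[OF U(2), of i] iB insert.hyps by auto
  then have "N p > 0" unfolding N_def by (rule gt_pos[OF p Yp])
  then obtain s W' where s: "s \<in> \<F>" and W': "openin (mtop M) W'" "p \<in> W'"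
    and Npos: "\<And>q. q \<in> W' \<Longrightarrow> N q > 0" and sN: "\<And>q. q \<in> W' \<Longrightarrow> s q = inverse (sqrt (N q))"
    using inverse_sqrt_near[OF N p] by metis
  define Z where "Z q h = s q * Y q h + 0 * Y q h" for q h
  have Z: "Z \<in> \<X>" unfolding Z_def by (rule fields_lincomb[OF Y Y s smooth_const])
  note Zp = fields_tangent[OF Z]
  define E' where "E' = E(i := Z)"
  have E': "E' k \<in> \<X>" for k using E Z by (simp add: E'_def)
  have E'A: "E' k = E k" if "k \<in> A" for k using that insert.hyps by (auto simp: E'_def)
  have E'i: "E' i = Z" by (simp add: E'_def)
  have ZE: "gt q (Z q) (E j q) = 0" if "q \<in> U" "j \<in> A" for q j
    unfolding Z_def using gt_lincomb(1)[OF Up[OF that(1)] Yp Yp Ep, of "s q" 0 j] YE[OF that] by simp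
  have ZZ: "gt q (Z q) (Z q) = 1" if "q \<in> U" "q \<in> W'" for q
  proof -
    have "gt q (Z q) (Z q) = s q * gt q (Y q) (Z q)"
      using gt_lincomb(1)[OF Up[OF that(1)] Yp Yp Zp, of "s q" 0] unfolding Z_def by simp
    also have "gt q (Y q) (Z q) = s q * N q"
      using gt_lincomb(2)[OF Up[OF that(1)] Yp Yp Yp, of "s q" 0] unfolding Z_def N_def by simp
    also have "s q * (s q * N q) = 1"
      using Npos[OF that(2)] by (simp add: sN[OF that(2)] field_simps)
    finally show ?thesis .
  qed
  show ?case
  proof (intro exI[of _ E'] exI[of _ "U \<inter> W'"] conjI allI ballI)
    fix q assume q: "q \<in> U \<inter> W'"
    then have qU: "q \<in> U" "q \<in> W'" by auto
    {
      fix j k assume "j \<in> insert i A" "k \<in> insert i A"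
      then show "gt q (E' j q) (E' k q) = (if j = k then 1 else 0)"
        using insert.hyps ortho[OF qU(1)] ZE[OF qU(1)] ZZ[OF qU] gt_sym[OF Up[OF qU(1)] Ep Zp]
        by (auto simp: E'A E'i)
    }
    {
      fix j k assume jk: "j \<in> insert i A" "k \<in> Basis - insert i A"
      then have "Z q (x k) = 0" using Yx[OF qU(1), of k] by (auto simp: Z_def)
      then show "E' j q (x k) = 0" using jk Ex[OF qU(1)] by (auto simp: E'A E'i)
    }
    {
      fix j assume j: "j \<in> insert i A"
      show "\<exists>c. \<forall>h. X j q h = (\<Sum>k\<in>insert i A. c k * E' k q h)"
      proof (cases "j = i")
        case True
        \<comment> \<open>Solve the orthogonalisation step for \<open>X i\<close>: its projection
          plus \<open>sqrt (N q)\<close> times the new unit vector.\<close>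
        let ?c = "(\<lambda>k. gt q (X i q) (E k q))(i := sqrt (N q))"
        have "X i q h = (\<Sum>k\<in>insert i A. ?c k * E' k q h)" for h
        proof -
          have "(\<Sum>k\<in>A. ?c k * E' k q h) = S q h"
            unfolding S_def using insert.hyps by (intro sum.cong) (auto simp: E'A)
          moreover have "sqrt (N q) * Z q h = Y q h"
            using Npos[OF qU(2)] by (simp add: Z_def sN[OF qU(2)])
          ultimately show ?thesis
            using insert.hyps by (simp add: E'i Y_def)
        qed
        then show ?thesis using True by blast
      next
        case False
        then obtain c where c: "\<And>h. X j q h = (\<Sum>k\<in>A. c k * E k q h)" using span[OF qU(1)] j by blast
        have "X j q h = (\<Sum>k\<in>insert i A. (c(i := 0)) k * E' k q h)" for h
          unfolding c using insert.hyps by (auto simp: E'A intro!: sum.cong)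
        then show ?thesis by blast
      qed
    }
  qed (use U W' E' in auto)
qed

lemma orthonormal_frame:
  assumes p: "p \<in> points M"
  obtains E :: "'e \<Rightarrow> 'a vfield" and U where "openin (mtop M) U" "p \<in> U" "\<And>i. E i \<in> \<X>"
    "\<And>q i j. q \<in> U \<Longrightarrow> i \<in> Basis \<Longrightarrow> j \<in> Basis \<Longrightarrow> gt q (E i q) (E j q) = (if i = j then 1 else 0)"
    "\<And>q v. q \<in> U \<Longrightarrow> v \<in> \<T> q \<Longrightarrow> v = (\<lambda>h. \<Sum>i\<in>Basis. gt q v (E i q) * E i q h)"
proof -
  obtain x :: "'e \<Rightarrow> 'a \<Rightarrow> real" and X W where W: "openin (mtop M) W" "p \<in> W" and x: "\<And>i. x i \<in> \<F>" and X: "\<And>i. X i \<in> \<X>"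
    and Xx': "\<And>q i j. q \<in> W \<Longrightarrow> i \<in> Basis \<Longrightarrow> j \<in> Basis \<Longrightarrow> X i q (x j) = (if i = j then 1 else 0)"
    and v: "\<And>q v h. q \<in> W \<Longrightarrow> v \<in> \<T> q \<Longrightarrow> v h = (\<Sum>i\<in>Basis. v (x i) * X i q h)"
    by (rule frame[OF p], rule that)
  have Xx: "\<forall>q\<in>W. \<forall>i\<in>Basis. \<forall>j\<in>Basis. X i q (x j) = (if i = j then 1 else 0)" using Xx' by blast
  obtain E :: "'e \<Rightarrow> 'a vfield" and U where U: "openin (mtop M) U" "p \<in> U" "U \<subseteq> W" and E': "\<forall>i. E i \<in> \<X>"
    and all: "\<forall>q\<in>U. (\<forall>i\<in>Basis. \<forall>j\<in>Basis. gt q (E i q) (E j q) = (if i = j then 1 else 0)) \<and>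
      (\<forall>i\<in>Basis. \<forall>k\<in>Basis - Basis. E i q (x k) = 0) \<and>
      (\<forall>i\<in>Basis. \<exists>c. \<forall>h. X i q h = (\<Sum>k\<in>Basis. c k * E k q h))"
    using gram_schmidt[of p W x X Basis, OF p W x X Xx finite_Basis order_refl] by (elim exE conjE) (rule that, assumption+)
  have E: "E i \<in> \<X>" for i using E' by blast
  have ortho: "\<And>q i j. q \<in> U \<Longrightarrow> i \<in> Basis \<Longrightarrow> j \<in> Basis \<Longrightarrow> gt q (E i q) (E j q) = (if i = j then 1 else 0)"
    using all by fast
  have span: "\<And>q i. q \<in> U \<Longrightarrow> i \<in> Basis \<Longrightarrow> \<exists>c. \<forall>h. X i q h = (\<Sum>k\<in>Basis. c k * E k q h)"
    using all by fast
  have "w = (\<lambda>h. \<Sum>k\<in>Basis. gt q w (E k q) * E k q h)" if q: "q \<in> U" and w: "w \<in> \<T> q" for q w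
  proof -
    obtain c where c: "\<And>i h. i \<in> Basis \<Longrightarrow> X i q h = (\<Sum>k\<in>Basis. c i k * E k q h)"
      using span[OF q] by metis
    define b where "b k = (\<Sum>i\<in>Basis. w (x i) * c i k)" for k
    have w_eq: "w = (\<lambda>h. \<Sum>k\<in>Basis. b k * E k q h)"
    proof
      fix h
      have "w h = (\<Sum>i\<in>Basis. w (x i) * X i q h)" using v q w U(3) by blast
      also have "\<dots> = (\<Sum>i\<in>Basis. \<Sum>k\<in>Basis. w (x i) * c i k * E k q h)"
        by (intro sum.cong refl) (simp add: c sum_distrib_left mult_ac)
      also have "\<dots> = (\<Sum>k\<in>Basis. b k * E k q h)"
        by (subst sum.swap) (simp add: b_def sum_distrib_right)
      finally show "w h = (\<Sum>k\<in>Basis. b k * E k q h)" .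
    qed
    have "gt q w (E j q) = b j" if "j \<in> Basis" for j
    proof -
      have qp: "q \<in> points M" using q openin_subset[OF U(1)] by blast
      have "gt q w (E j q) = (\<Sum>k\<in>Basis. b k * gt q (E k q) (E j q))"
        using gt_sum[OF qp, of Basis "\<lambda>k. E k q" "E j q" b] fields_tangent[OF E] w_eq by simp
      then show ?thesis
        using that ortho[OF q _ that] by (simp add: if_distrib[of "(*) _"] sum.delta cong: if_cong)
    qed
    then show ?thesis using w_eq by (simp cong: sum.cong)
  qed
  then show ?thesis using that[OF U(1,2) E ortho] by blast
qed

section \<open>Riesz representation and the cometric\<close>

lemma riesz_eqI:
  assumes p: "p \<in> points M" and r: "r \<in> \<T> p" "\<And>w. w \<in> \<T> p \<Longrightarrow> gt p r w = \<xi> w"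
  shows "riesz M gt p \<xi> = r"
  unfolding riesz_def
proof (rule the_equality)
  show "r \<in> \<T> p \<and> (\<forall>w\<in>\<T> p. gt p r w = \<xi> w)" using r by blast
  fix v assume v: "v \<in> \<T> p \<and> (\<forall>w\<in>\<T> p. gt p v w = \<xi> w)"
  let ?d = "\<lambda>h. 1 * v h + (-1) * r h"
  have d: "?d \<in> \<T> p" using v r by (intro tangent_closed_lincomb) auto
  have "gt p ?d ?d = 0" using gt_lincomb(1)[OF p _ r(1) d, of v 1 "-1"] v r(2)[OF d] d by simp
  then have "?d = (\<lambda>h. 0)" using gt_pos[OF p d] by fastforce
  then show "v = r" by (simp add: fun_eq_iff)
qed

text \<open>Existence of the Riesz vector comes from the explicit formula with respect to an
  orthonormal frame; \<open>riesz_eqI\<close> supplies uniqueness through positive definiteness. The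
  formula also yields smoothness of the cometric.\<close>

lemma riesz_orthonormal:
  assumes p: "p \<in> points M" and \<xi>: "\<xi> \<in> \<C> p" and e: "\<And>i. e i \<in> \<T> p"
    and exp: "\<And>v. v \<in> \<T> p \<Longrightarrow> v = (\<lambda>h. \<Sum>i\<in>Basis. gt p v (e i) * e i h)"
  shows "riesz M gt p \<xi> = (\<lambda>h. \<Sum>i\<in>Basis. \<xi> (e i) * e i h)"
    and "w \<in> \<T> p \<Longrightarrow> gt p (riesz M gt p \<xi>) w = \<xi> w"
proof -
  let ?r = "\<lambda>h. \<Sum>i\<in>Basis. \<xi> (e i) * e i h"
  have r: "gt p ?r w = \<xi> w" if w: "w \<in> \<T> p" for w
  proof -
    have "gt p ?r w = (\<Sum>i\<in>Basis. \<xi> (e i) * gt p (e i) w)" by (rule gt_sum[OF p e w])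
    also have "\<dots> = (\<Sum>i\<in>Basis. gt p w (e i) * \<xi> (e i))"
      using gt_sym[OF p e w] by (simp add: mult.commute)
    also have "\<dots> = \<xi> (\<lambda>h. \<Sum>i\<in>Basis. gt p w (e i) * e i h)"
      by (rule cotangent_sum[OF \<xi> e, symmetric])
    also have "\<dots> = \<xi> w" using exp[OF w] by simp
    finally show ?thesis .
  qed
  then show eq: "riesz M gt p \<xi> = ?r" by (rule riesz_eqI[OF p tangent_closed_sum[OF e]])
  show "w \<in> \<T> p \<Longrightarrow> gt p (riesz M gt p \<xi>) w = \<xi> w" unfolding eq by (rule r)
qed

lemma riesz:
  assumes p: "p \<in> points M" and \<xi>: "\<xi> \<in> \<C> p"
  shows riesz_tangent: "riesz M gt p \<xi> \<in> \<T> p" and gt_riesz: "w \<in> \<T> p \<Longrightarrow> gt p (riesz M gt p \<xi>) w = \<xi> w"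
proof -
  obtain E :: "'e \<Rightarrow> 'a vfield" and U where U: "openin (mtop M) U" "p \<in> U" and E: "\<And>i. E i \<in> \<X>"
    and exp: "\<And>q v. q \<in> U \<Longrightarrow> v \<in> \<T> q \<Longrightarrow> v = (\<lambda>h. \<Sum>i\<in>Basis. gt q v (E i q) * E i q h)"
    by (rule orthonormal_frame[OF p], rule that)
  have Ep: "E k q \<in> \<T> q" for k q by (rule fields_tangent[OF E])
  have "riesz M gt p \<xi> = (\<lambda>h. \<Sum>i\<in>Basis. \<xi> (E i p) * E i p h)"
    by (rule riesz_orthonormal(1)[OF p \<xi> Ep exp[OF U(2)]])
  then show "riesz M gt p \<xi> \<in> \<T> p" using tangent_closed_sum[of Basis "\<lambda>i. E i p"] Ep by simp
  show "w \<in> \<T> p \<Longrightarrow> gt p (riesz M gt p \<xi>) w = \<xi> w"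
    by (rule riesz_orthonormal(2)[OF p \<xi> Ep exp[OF U(2)]])
qed

lemma cometric_riesz: "p \<in> points M \<Longrightarrow> \<xi> \<in> \<C> p \<Longrightarrow> \<zeta> \<in> \<C> p \<Longrightarrow> g p \<xi> \<zeta> = \<xi> (riesz M gt p \<zeta>)"
  unfolding cometric_def by (simp add: gt_riesz riesz_tangent)

lemma cometric_sym: "p \<in> points M \<Longrightarrow> \<xi> \<in> \<C> p \<Longrightarrow> \<zeta> \<in> \<C> p \<Longrightarrow> g p \<xi> \<zeta> = g p \<zeta> \<xi>"
  unfolding cometric_def by (simp add: gt_sym riesz_tangent)

lemma cometric_lincomb:
  assumes "p \<in> points M" "\<xi> \<in> \<C> p" "\<xi>' \<in> \<C> p" "\<zeta> \<in> \<C> p"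
  shows "g p (\<lambda>v. a * \<xi> v + b * \<xi>' v) \<zeta> = a * g p \<xi> \<zeta> + b * g p \<xi>' \<zeta>"
  using assms by (simp add: cometric_riesz cotangent_closed_lincomb)

lemma cometric_zero: "p \<in> points M \<Longrightarrow> \<zeta> \<in> \<C> p \<Longrightarrow> g p (\<lambda>v. 0) \<zeta> = 0"
  using cometric_lincomb[of p "\<lambda>v. 0" "\<lambda>v. 0" \<zeta> 0 0] cotangent_zero by simp

lemma cometric_nonneg:
  assumes "p \<in> points M" "\<xi> \<in> \<C> p"
  shows "g p \<xi> \<xi> \<ge> 0"
proof (cases "riesz M gt p \<xi> = (\<lambda>h. 0)")
  case True
  then show ?thesis using gt_zero[OF assms(1) tangent_zero] by (simp add: cometric_def)
next
  case False
  then show ?thesis using gt_pos[OF assms(1) riesz_tangent[OF assms]] by (simp add: cometric_def)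
qed

lemma cometric_definite:
  assumes "p \<in> points M" "\<xi> \<in> \<C> p" "g p \<xi> \<xi> = 0"
  shows "\<xi> = (\<lambda>v. 0)"
proof (rule cotangent_eqI[OF assms(2) cotangent_zero])
  fix w assume w: "w \<in> \<T> p"
  have "riesz M gt p \<xi> = (\<lambda>h. 0)"
    using gt_pos[OF assms(1) riesz_tangent[OF assms(1,2)]] assms(3) by (auto simp: cometric_def)
  then show "\<xi> w = 0" using gt_riesz[OF assms(1,2) w] gt_zero[OF assms(1) w] by simp
qed

text \<open>In an orthonormal frame the cometric is locally the sum of the products of components,
  and this sum is a globally smooth function.\<close>

lemma cometric_smooth:
  assumes "\<omega> \<in> \<Omega>" "\<eta> \<in> \<Omega>"
  shows "app2 g \<omega> \<eta> \<in> \<F>"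
proof (rule smooth_if_locally_smooth, unfold locally_smooth_def, intro ballI)
  fix p assume p: "p \<in> points M"
  obtain E :: "'e \<Rightarrow> 'a vfield" and U where U: "openin (mtop M) U" "p \<in> U" and E: "\<And>i. E i \<in> \<X>"
    and exp: "\<And>q v. q \<in> U \<Longrightarrow> v \<in> \<T> q \<Longrightarrow> v = (\<lambda>h. \<Sum>i\<in>Basis. gt q v (E i q) * E i q h)"
    by (rule orthonormal_frame[OF p], rule that)
  have Ep: "E k q \<in> \<T> q" for k q by (rule fields_tangent[OF E])
  have "app2 g \<omega> \<eta> q = (\<Sum>i\<in>Basis. \<eta> q (E i q) * \<omega> q (E i q))" if q: "q \<in> U" for q
  proof -
    have qp: "q \<in> points M" using q openin_subset[OF U(1)] by blast
    have "riesz M gt q (\<eta> q) = (\<lambda>h. \<Sum>i\<in>Basis. \<eta> q (E i q) * E i q h)"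
      by (rule riesz_orthonormal(1)[OF qp forms_cotangent[OF assms(2)] Ep exp[OF q]])
    then show ?thesis
      using cometric_riesz[OF qp forms_cotangent[OF assms(1)] forms_cotangent[OF assms(2)]]
        cotangent_sum[OF forms_cotangent[OF assms(1)], of Basis "\<lambda>i. E i q" q "\<lambda>i. \<eta> q (E i q)"]
      by (simp add: app2_def Ep)
  qed
  moreover have "(\<lambda>q. \<Sum>i\<in>Basis. \<eta> q (E i q) * \<omega> q (E i q)) \<in> \<F>"
    by (rule smooth_sum) (rule smooth_mult[OF forms_smooth[OF assms(2) E] forms_smooth[OF assms(1) E]])
  ultimately show "\<exists>W k. openin (mtop M) W \<and> p \<in> W \<and> k \<in> \<F> \<and> (\<forall>q\<in>W. app2 g \<omega> \<eta> q = k q)"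
    using U by blast
qed

lemma orthonormal_coframe_exists:
  assumes p: "p \<in> points M"
  shows "\<exists>\<theta>. local_orthonormal_coframe M g p \<theta>"
proof -
  obtain E :: "'e \<Rightarrow> 'a vfield" and U where U: "openin (mtop M) U" "p \<in> U" and E: "\<And>i. E i \<in> \<X>"
    and ortho: "\<And>q i j. q \<in> U \<Longrightarrow> i \<in> Basis \<Longrightarrow> j \<in> Basis \<Longrightarrow> gt q (E i q) (E j q) = (if i = j then 1 else 0)"
    by (rule orthonormal_frame[OF p], rule that)
  have Ep: "E k q \<in> \<T> q" for k q by (rule fields_tangent[OF E])
  \<comment> \<open>The forms dual to the frame, with Riesz vectors \<open>E i\<close>. The guards
    supply the normalisation to 0 that covectors require.\<close>
  define \<theta> where "\<theta> i q v = (if q \<in> points M \<and> v \<in> \<T> q then gt q (E i q) v else 0)" for i q v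
  have "\<theta> i \<in> \<Omega>" for i
  proof (rule formsI)
    fix q
    show "\<theta> i q \<in> \<C> q"
      by (rule cotangentI) (auto simp: \<theta>_def gt_lincomb(2)[OF _ _ _ Ep] tangent_closed_lincomb)
  next
    fix X assume X: "X \<in> \<X>"
    show "(\<lambda>q. \<theta> i q (X q)) \<in> \<F>"
      by (rule smooth_cong[OF gt_smooth[OF E[of i] X]]) (simp add: \<theta>_def fields_tangent[OF X])
  qed
  moreover have "app2 g (\<theta> i) (\<theta> j) q = (if i = j then 1 else 0)" if "q \<in> U" "i \<in> Basis" "j \<in> Basis" for q i j
  proof -
    have qp: "q \<in> points M" using that openin_subset[OF U(1)] by blast
    have "riesz M gt q (\<theta> k q) = E k q" for k
      by (rule riesz_eqI[OF qp Ep]) (simp add: \<theta>_def qp)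
    then show ?thesis using ortho[OF that] by (simp add: app2_def cometric_def)
  qed
  ultimately show ?thesis using U unfolding local_orthonormal_coframe_def by (intro exI[of _ \<theta>]) auto
qed

text \<open>Evaluation on an orthonormal frame carries the cometric to the inner product of the
  model space. There an orthonormal family indexed by \<open>Basis\<close> spans, so no separate
  dimension theory for covectors enters.\<close>

lemma orthonormal_coframe_expansion:
  assumes p: "p \<in> points M" and \<theta>: "local_orthonormal_coframe M g p \<theta>" and \<xi>: "\<xi> \<in> \<C> p"
  obtains c where "\<xi> = (\<lambda>v. \<Sum>i\<in>Basis. c i * \<theta> i p v)"
proof -
  obtain E :: "'e \<Rightarrow> 'a vfield" and U where U: "openin (mtop M) U" "p \<in> U" and E: "\<And>i. E i \<in> \<X>"
    and exp: "\<And>q v. q \<in> U \<Longrightarrow> v \<in> \<T> q \<Longrightarrow> v = (\<lambda>h. \<Sum>i\<in>Basis. gt q v (E i q) * E i q h)"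
    by (rule orthonormal_frame[OF p], rule that)
  have Ep: "E k q \<in> \<T> q" for k q by (rule fields_tangent[OF E])
  define \<Phi> where "\<Phi> \<zeta> = (\<Sum>k\<in>Basis. \<zeta> (E k p) *\<^sub>R k)" for \<zeta> :: "'a cotangent"
  have \<Phi>_Basis: "\<Phi> \<zeta> \<bullet> k = \<zeta> (E k p)" if "k \<in> Basis" for \<zeta> k
    using that by (simp add: \<Phi>_def)
  have \<theta>p: "\<theta> i p \<in> \<C> p" if "i \<in> Basis" for i
    using that \<theta> forms_cotangent unfolding local_orthonormal_coframe_def by blast
  have inner: "g p \<zeta> \<zeta>' = \<Phi> \<zeta> \<bullet> \<Phi> \<zeta>'" if "\<zeta> \<in> \<C> p" "\<zeta>' \<in> \<C> p" for \<zeta> \<zeta>'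
  proof -
    have "riesz M gt p \<zeta>' = (\<lambda>h. \<Sum>i\<in>Basis. \<zeta>' (E i p) * E i p h)"
      by (rule riesz_orthonormal(1)[OF p that(2) Ep exp[OF U(2)]])
    then have "g p \<zeta> \<zeta>' = (\<Sum>i\<in>Basis. \<zeta>' (E i p) * \<zeta> (E i p))"
      using cotangent_sum[OF that(1), of Basis "\<lambda>i. E i p" "\<lambda>i. \<zeta>' (E i p)"]
      by (simp add: cometric_riesz[OF p that] Ep)
    also have "\<dots> = \<Phi> \<zeta> \<bullet> \<Phi> \<zeta>'"
      by (subst euclidean_inner) (simp add: \<Phi>_Basis mult.commute)
    finally show ?thesis .
  qed
  have "\<Phi> (\<theta> i p) \<bullet> \<Phi> (\<theta> j p) = (if i = j then 1 else 0)" if "i \<in> Basis" "j \<in> Basis" for i j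
  proof -
    have "app2 g (\<theta> i) (\<theta> j) p = (if i = j then 1 else 0)"
      using \<theta> that unfolding local_orthonormal_coframe_def by blast
    then show ?thesis using inner[OF \<theta>p \<theta>p] that unfolding app2_def by simp
  qed
  from orthonormal_expansion[OF this, of "\<Phi> \<xi>"]
  have *: "\<Phi> \<xi> = (\<Sum>i\<in>Basis. (\<Phi> \<xi> \<bullet> \<Phi> (\<theta> i p)) *\<^sub>R \<Phi> (\<theta> i p))" .
  define c where "c i = \<Phi> \<xi> \<bullet> \<Phi> (\<theta> i p)" for i
  have "\<xi> v = (\<Sum>i\<in>Basis. c i * \<theta> i p v)" for v
  proof (cases "v \<in> \<T> p")
    case True
    have E_eq: "\<xi> (E k p) = (\<Sum>i\<in>Basis. c i * \<theta> i p (E k p))" if "k \<in> Basis" for k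
      using arg_cong[OF *, of "\<lambda>y. y \<bullet> k"] \<Phi>_Basis[OF that] by (simp add: inner_sum_left c_def)
    have v: "\<zeta> v = (\<Sum>k\<in>Basis. gt p v (E k p) * \<zeta> (E k p))" if "\<zeta> \<in> \<C> p" for \<zeta>
      using cotangent_sum[OF that, of Basis "\<lambda>k. E k p" "\<lambda>k. gt p v (E k p)"] exp[OF U(2) True] Ep by simp
    have "\<xi> v = (\<Sum>k\<in>Basis. \<Sum>i\<in>Basis. c i * (gt p v (E k p) * \<theta> i p (E k p)))"
      unfolding v[OF \<xi>] by (intro sum.cong refl) (simp add: E_eq sum_distrib_left mult_ac)
    also have "\<dots> = (\<Sum>i\<in>Basis. c i * \<theta> i p v)"
      by (subst sum.swap) (simp add: v[OF \<theta>p] sum_distrib_left)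
    finally show ?thesis .
  qed (simp add: cotangent_out[OF \<xi>] cotangent_out[OF \<theta>p])
  then show ?thesis using that by blast
qed

end

section \<open>Poisson tensors\<close>

locale poisson_mfd = smooth_mfd M for M :: "('a, 'e::euclidean_space) manifold" +
  fixes P :: "'a contra_tensor"
  assumes poisson: "poisson_tensor M P"
begin

lemma P_lincomb:
  assumes "p \<in> points M" "\<xi> \<in> \<C> p" "\<xi>' \<in> \<C> p" "\<zeta> \<in> \<C> p"
  shows "P p (\<lambda>v. a * \<xi> v + b * \<xi>' v) \<zeta> = a * P p \<xi> \<zeta> + b * P p \<xi>' \<zeta>"
    and "P p \<zeta> (\<lambda>v. a * \<xi> v + b * \<xi>' v) = a * P p \<zeta> \<xi> + b * P p \<zeta> \<xi>'"
  using poisson assms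
  unfolding poisson_tensor_def bivector_field_def bilinear_form_on_def linear_functional_on_def by blast+

lemma P_alternating: "p \<in> points M \<Longrightarrow> \<xi> \<in> \<C> p \<Longrightarrow> P p \<xi> \<xi> = 0"
  using poisson unfolding poisson_tensor_def bivector_field_def by blast

lemma P_zero:
  assumes "p \<in> points M" "\<zeta> \<in> \<C> p"
  shows "P p (\<lambda>v. 0) \<zeta> = 0" "P p \<zeta> (\<lambda>v. 0) = 0"
  using P_lincomb[OF assms(1) cotangent_zero cotangent_zero assms(2), of 0 0] by simp_all

text \<open>Polarisation of the alternating property.\<close>

lemma P_skew:
  assumes p: "p \<in> points M" and \<xi>: "\<xi> \<in> \<C> p" and \<zeta>: "\<zeta> \<in> \<C> p"
  shows "P p \<xi> \<zeta> = - P p \<zeta> \<xi>"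
proof -
  let ?s = "\<lambda>v. 1 * \<xi> v + 1 * \<zeta> v"
  have s: "?s \<in> \<C> p" by (rule cotangent_closed_lincomb[OF \<xi> \<zeta>])
  have "P p ?s ?s = P p \<xi> ?s + P p \<zeta> ?s" using P_lincomb(1)[OF p \<xi> \<zeta> s, of 1 1] by simp
  then show ?thesis
    using P_lincomb(2)[OF p \<xi> \<zeta> \<xi>, of 1 1] P_lincomb(2)[OF p \<xi> \<zeta> \<zeta>, of 1 1]
      P_alternating[OF p s] P_alternating[OF p \<xi>] P_alternating[OF p \<zeta>] by simp
qed

lemma P_smooth: "\<omega> \<in> \<Omega> \<Longrightarrow> \<eta> \<in> \<Omega> \<Longrightarrow> app2 P \<omega> \<eta> \<in> \<F>"
  using poisson unfolding poisson_tensor_def bivector_field_def by blast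

text \<open>Evaluates the definite description: the field with X h = P(\<omega>, dh) satisfies the
  defining equation for every \<eta>, because each \<eta> agrees at the given point with some
  differential.\<close>

lemma sharp:
  assumes \<omega>: "\<omega> \<in> \<Omega>"
  shows sharp_in: "sharp M P \<omega> \<in> \<X>"
    and sharp_apply: "p \<in> points M \<Longrightarrow> h \<in> \<F> \<Longrightarrow> sharp M P \<omega> p h = P p (\<omega> p) (differential M h p)"
proof -
  define X where "X p h = (if p \<in> points M \<and> h \<in> \<F> then P p (\<omega> p) (differential M h p) else 0)" for p h
  note \<omega>p = forms_cotangent[OF \<omega>]
  have "X p \<in> \<T> p" for p
  proof (rule tangentI)
    show "X p (\<lambda>x. a * h x + b * k x) = a * X p h + b * X p k" if "h \<in> \<F>" "k \<in> \<F>" for h k a b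
      using that P_lincomb(2)[OF _ differential_cotangent differential_cotangent \<omega>p]
      by (simp add: X_def smooth_lincomb differential_lincomb)
    show "X p (\<lambda>x. h x * k x) = h p * X p k + k p * X p h" if "h \<in> \<F>" "k \<in> \<F>" for h k
      using that P_lincomb(2)[OF _ differential_cotangent differential_cotangent \<omega>p]
      by (simp add: X_def smooth_mult differential_mult)
  qed (simp add: X_def)
  moreover have "(\<lambda>p. X p h) \<in> \<F>" if h: "h \<in> \<F>" for h
    by (rule smooth_cong[OF P_smooth[OF \<omega> differential_in[OF h]]]) (simp add: X_def h app2_def)
  ultimately have X: "X \<in> \<X>" by (rule fieldsI)
  have spec: "\<eta> p (X p) = app2 P \<omega> \<eta> p" if \<eta>: "\<eta> \<in> \<Omega>" and p: "p \<in> points M" for \<eta> p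
  proof -
    obtain F where F: "F \<in> \<F>" "\<eta> p = differential M F p"
      by (rule cotangent_exact[OF p forms_cotangent[OF \<eta>]])
    then show ?thesis
      using p by (simp add: app2_def differential_apply[OF fields_tangent[OF X]]) (simp add: X_def)
  qed
  have "sharp M P \<omega> = X"
    unfolding sharp_def
  proof (rule the_equality)
    show "X \<in> \<X> \<and> (\<forall>\<eta>\<in>\<Omega>. \<forall>p\<in>points M. \<eta> p (X p) = app2 P \<omega> \<eta> p)" using X spec by blast
    fix Y assume Y: "Y \<in> \<X> \<and> (\<forall>\<eta>\<in>\<Omega>. \<forall>p\<in>points M. \<eta> p (Y p) = app2 P \<omega> \<eta> p)"
    then have Y': "Y p \<in> \<T> p" for p using fields_tangent by blast
    have "Y p h = X p h" for p h
    proof (cases "p \<in> points M \<and> h \<in> \<F>")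
      case True
      then have "differential M h p (Y p) = P p (\<omega> p) (differential M h p)"
        using Y differential_in[of h] by (simp add: app2_def)
      then show ?thesis using True differential_apply[OF Y'] by (simp add: X_def)
    next
      case False
      then show ?thesis
        using tangent_out[OF Y'] Y'[of p] tangent_space_outside[OF smooth_manifold, of p] by (auto simp: X_def)
    qed
    then show "Y = X" by (intro ext)
  qed
  then show "sharp M P \<omega> \<in> \<X>"
    and "p \<in> points M \<Longrightarrow> h \<in> \<F> \<Longrightarrow> sharp M P \<omega> p h = P p (\<omega> p) (differential M h p)"
    using X by (simp_all add: X_def)
qed

lemmas sharp_tangent = fields_tangent[OF sharp_in]
lemmas sharp_smooth = fields_smooth[OF sharp_in]

text \<open>The relation between the forms is required at \<open>p\<close> only, so \<open>a\<close>
  and \<open>b\<close> may be the values at \<open>p\<close> of non-constant functions.\<close>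

lemma sharp_lincomb:
  assumes "\<omega> \<in> \<Omega>" "\<eta> \<in> \<Omega>" "\<theta> \<in> \<Omega>" "p \<in> points M" "\<theta> p = (\<lambda>v. a * \<omega> p v + b * \<eta> p v)"
  shows "sharp M P \<theta> p h = a * sharp M P \<omega> p h + b * sharp M P \<eta> p h"
proof (cases "h \<in> \<F>")
  case True
  then show ?thesis
    using assms P_lincomb(1)[OF assms(4) forms_cotangent forms_cotangent differential_cotangent]
    by (simp add: sharp_apply)
qed (use tangent_out[OF sharp_tangent] assms in simp)

text \<open>Each of the two Lie derivative terms contributes d{F, G}, the second one by
  skew-symmetry, and the last term removes one copy.\<close>

lemma koszul_exact:
  assumes F: "F \<in> \<F>" and G: "G \<in> \<F>"
  shows "koszul_bracket M P (differential M F) (differential M G) = differential M (biderivation M P F G)"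
proof -
  note dF = differential_in[OF F] and dG = differential_in[OF G]
  let ?B = "biderivation M P F G"
  have B: "?B \<in> \<F>" unfolding biderivation_def by (rule P_smooth[OF dF dG])
  have 1: "differential M (\<lambda>p. sharp M P (differential M F) p G) = differential M ?B"
    by (rule differential_cong[OF sharp_smooth[OF dF G]]) (simp add: sharp_apply[OF dF _ G] biderivation_def app2_def)
  have 2: "differential M (\<lambda>p. sharp M P (differential M G) p F) = differential M (\<lambda>p. (-1) * ?B p + 0 * ?B p)"
  proof (rule differential_cong[OF sharp_smooth[OF dG F]])
    show "sharp M P (differential M G) p F = (-1) * ?B p + 0 * ?B p" if "p \<in> points M" for p
      using P_skew[OF that differential_cotangent differential_cotangent, of G F]
      by (simp add: sharp_apply[OF dG that F] biderivation_def app2_def)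
  qed
  have "differential M (\<lambda>p. (-1) * ?B p + 0 * ?B p) p = (\<lambda>v. - differential M ?B p v)" for p
    using differential_lincomb[OF B B, of "-1" 0 p] by simp
  then show ?thesis
    unfolding koszul_bracket_def lie_derivative_differential[OF sharp_in[OF dF] G]
      lie_derivative_differential[OF sharp_in[OF dG] F] 1 2
    by (simp add: form_diff_def fun_eq_iff) (simp add: biderivation_def)
qed

text \<open>With both arguments equal, every term of the Schouten bracket occurs twice.\<close>

lemma jacobi:
  assumes "F \<in> \<F>" "G \<in> \<F>" "H \<in> \<F>" "p \<in> points M"
  shows "biderivation M P (biderivation M P F G) H p + biderivation M P (biderivation M P G H) F p
    + biderivation M P (biderivation M P H F) G p = 0"
proof -
  have "schouten_bracket M P P F G H p = 0" using poisson assms unfolding poisson_tensor_def by blast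
  then show ?thesis unfolding schouten_bracket_def by simp
qed

end

section \<open>Contravariant Levi-Civita connections\<close>

locale levi_civita_mfd = riem_mfd M gt + poisson_mfd M P
  for M :: "('a, 'e::euclidean_space) manifold" and gt :: "'a cov_tensor" and P :: "'a contra_tensor" +
  fixes D :: "'a form \<Rightarrow> 'a form \<Rightarrow> 'a form"
  assumes levi_civita: "contravariant_levi_civita M P (cometric M gt) D"
begin

abbreviation "\<K> \<equiv> koszul_bracket M P"
abbreviation sharp_map ("\<sharp>") where "\<sharp> \<equiv> sharp M P"

lemma D_in: "\<omega> \<in> \<Omega> \<Longrightarrow> \<eta> \<in> \<Omega> \<Longrightarrow> D \<omega> \<eta> \<in> \<Omega>"
  using levi_civita unfolding contravariant_levi_civita_def contravariant_connection_def by blast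

lemma D_add:
  assumes "\<omega> \<in> \<Omega>" "\<omega>' \<in> \<Omega>" "\<eta> \<in> \<Omega>"
  shows "D (form_add \<omega> \<omega>') \<eta> = form_add (D \<omega> \<eta>) (D \<omega>' \<eta>)"
    and "D \<eta> (form_add \<omega> \<omega>') = form_add (D \<eta> \<omega>) (D \<eta> \<omega>')"
  using levi_civita assms unfolding contravariant_levi_civita_def contravariant_connection_def by blast+

lemma D_scale:
  assumes "h \<in> \<F>" "\<omega> \<in> \<Omega>" "\<eta> \<in> \<Omega>"
  shows "D (form_scale h \<omega>) \<eta> = form_scale h (D \<omega> \<eta>)"
    and "D \<omega> (form_scale h \<eta>) = form_add (form_scale h (D \<omega> \<eta>)) (form_scale (\<lambda>p. \<sharp> \<omega> p h) \<eta>)"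
  using levi_civita assms unfolding contravariant_levi_civita_def contravariant_connection_def by blast+

lemma torsion_free: "\<omega> \<in> \<Omega> \<Longrightarrow> \<eta> \<in> \<Omega> \<Longrightarrow> \<K> \<omega> \<eta> = form_diff (D \<omega> \<eta>) (D \<eta> \<omega>)"
  using levi_civita unfolding contravariant_levi_civita_def by auto

lemma D_metric: "\<omega> \<in> \<Omega> \<Longrightarrow> \<eta> \<in> \<Omega> \<Longrightarrow> \<gamma> \<in> \<Omega> \<Longrightarrow> p \<in> points M \<Longrightarrow>
    \<sharp> \<omega> p (app2 g \<eta> \<gamma>) = app2 g (D \<omega> \<eta>) \<gamma> p + app2 g \<eta> (D \<omega> \<gamma>) p"
  using levi_civita unfolding contravariant_levi_civita_def by blast

lemma form_diff_in: "\<omega> \<in> \<Omega> \<Longrightarrow> \<eta> \<in> \<Omega> \<Longrightarrow> form_diff \<omega> \<eta> \<in> \<Omega>"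
  using forms_lincomb[of \<omega> \<eta> "\<lambda>p. 1" "\<lambda>p. -1"] by (simp add: form_diff_def smooth_const)

text \<open>Obtained from torsion-freeness: \<open>D\<close> maps into the 1-forms, so the Lie
  derivatives inside the bracket need not be evaluated.\<close>

lemma koszul_in: "\<omega> \<in> \<Omega> \<Longrightarrow> \<eta> \<in> \<Omega> \<Longrightarrow> \<K> \<omega> \<eta> \<in> \<Omega>"
  by (simp add: torsion_free D_in form_diff_in)

lemma D_zero: "\<omega> \<in> \<Omega> \<Longrightarrow> D \<omega> zero_form = zero_form"
proof -
  assume \<omega>: "\<omega> \<in> \<Omega>"
  have "form_add zero_form zero_form = zero_form" by (simp add: form_add_def zero_form_def)
  then have "D \<omega> zero_form = form_add (D \<omega> zero_form) (D \<omega> zero_form)"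
    using D_add(2)[OF zero_form_in zero_form_in \<omega>] by metis
  then have "D \<omega> zero_form p v = D \<omega> zero_form p v + D \<omega> zero_form p v" for p v
    by (metis form_add_def)
  then show ?thesis by (simp add: zero_form_def fun_eq_iff)
qed

lemma D_tensorial:
  assumes "\<eta> \<in> \<Omega>"
  shows "tensorial_at p (\<lambda>\<omega>. D \<omega> \<eta> p v)"
  by (rule tensorial_atI) (simp_all add: D_add(1)[OF _ _ assms] D_scale(1)[OF _ _ assms],
    simp_all add: form_add_def form_scale_def)

lemma cometric_add:
  assumes "\<omega> \<in> \<Omega>" "\<eta> \<in> \<Omega>" "\<gamma> \<in> \<Omega>" "p \<in> points M"
  shows "app2 g (form_add \<omega> \<eta>) \<gamma> p = app2 g \<omega> \<gamma> p + app2 g \<eta> \<gamma> p"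
    and "app2 g (form_diff \<omega> \<eta>) \<gamma> p = app2 g \<omega> \<gamma> p - app2 g \<eta> \<gamma> p"
  using cometric_lincomb[OF assms(4) assms(1,2,3)[THEN forms_cotangent], of 1 1]
    cometric_lincomb[OF assms(4) assms(1,2,3)[THEN forms_cotangent], of 1 "-1"]
  by (simp_all add: app2_def form_add_def form_diff_def)

lemma cometric_commute: "\<omega> \<in> \<Omega> \<Longrightarrow> \<eta> \<in> \<Omega> \<Longrightarrow> p \<in> points M \<Longrightarrow> app2 g \<omega> \<eta> p = app2 g \<eta> \<omega> p"
  unfolding app2_def by (intro cometric_sym forms_cotangent)

text \<open>Metric compatibility for three arrangements of the arguments, with the torsion-free
  condition to exchange them. Thus \<open>D\<close> is determined by sharp, bracket and cometric,
  each of which is computable on lifts.\<close>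

lemma koszul_formula:
  assumes \<omega>: "\<omega> \<in> \<Omega>" and \<eta>: "\<eta> \<in> \<Omega>" and \<gamma>: "\<gamma> \<in> \<Omega>" and p: "p \<in> points M"
  shows "2 * app2 g (D \<omega> \<eta>) \<gamma> p =
    \<sharp> \<omega> p (app2 g \<eta> \<gamma>) + \<sharp> \<eta> p (app2 g \<omega> \<gamma>) - \<sharp> \<gamma> p (app2 g \<omega> \<eta>)
    + app2 g (\<K> \<omega> \<eta>) \<gamma> p - app2 g (\<K> \<omega> \<gamma>) \<eta> p - app2 g (\<K> \<eta> \<gamma>) \<omega> p"
  using D_metric[OF \<omega> \<eta> \<gamma> p] D_metric[OF \<eta> \<omega> \<gamma> p] D_metric[OF \<gamma> \<omega> \<eta> p]
    cometric_add(2)[OF D_in[OF \<omega> \<eta>] D_in[OF \<eta> \<omega>] \<gamma> p] cometric_add(2)[OF D_in[OF \<omega> \<gamma>] D_in[OF \<gamma> \<omega>] \<eta> p]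
    cometric_add(2)[OF D_in[OF \<eta> \<gamma>] D_in[OF \<gamma> \<eta>] \<omega> p]
    cometric_commute[OF \<eta> D_in[OF \<omega> \<gamma>] p] cometric_commute[OF \<omega> D_in[OF \<eta> \<gamma>] p]
    cometric_commute[OF \<omega> D_in[OF \<gamma> \<eta>] p]
  unfolding torsion_free[OF \<omega> \<eta>] torsion_free[OF \<omega> \<gamma>] torsion_free[OF \<eta> \<gamma>] by linarith

text \<open>The deviation from \<open>\<sharp>[\<omega>, \<eta>] = [\<sharp>\<omega>, \<sharp>\<eta>]\<close>, which is tensorial in both arguments and vanishes on
  exact forms by the Jacobi identity.\<close>

definition sharp_defect :: "'a \<Rightarrow> ('a \<Rightarrow> real) \<Rightarrow> 'a form \<Rightarrow> 'a form \<Rightarrow> real" where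
  "sharp_defect p h \<omega> \<eta> = \<sharp> \<omega> p (\<lambda>q. \<sharp> \<eta> q h) - \<sharp> \<eta> p (\<lambda>q. \<sharp> \<omega> q h) - \<sharp> (\<K> \<omega> \<eta>) p h"

lemma sharp_defect_skew:
  assumes "p \<in> points M" "\<omega> \<in> \<Omega>" "\<eta> \<in> \<Omega>"
  shows "sharp_defect p h \<omega> \<eta> = - sharp_defect p h \<eta> \<omega>"
proof -
  have "\<sharp> (\<K> \<omega> \<eta>) p h = (-1) * \<sharp> (\<K> \<eta> \<omega>) p h + 0 * \<sharp> (\<K> \<eta> \<omega>) p h"
    using assms by (intro sharp_lincomb koszul_in) (simp_all add: torsion_free form_diff_def)
  then show ?thesis by (simp add: sharp_defect_def)
qed

lemma sharp_defect_add:
  assumes p: "p \<in> points M" and h: "h \<in> \<F>" and \<eta>: "\<eta> \<in> \<Omega>" and \<omega>: "\<omega> \<in> \<Omega>" "\<omega>' \<in> \<Omega>"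
  shows "sharp_defect p h \<eta> (form_add \<omega> \<omega>') = sharp_defect p h \<eta> \<omega> + sharp_defect p h \<eta> \<omega>'"
proof -
  note add = form_add_in[OF \<omega>]
  have s: "\<sharp> (form_add \<omega> \<omega>') q k = 1 * \<sharp> \<omega> q k + 1 * \<sharp> \<omega>' q k" if "q \<in> points M" for q k
    by (rule sharp_lincomb[OF \<omega> add that]) (simp add: form_add_def)
  have "\<sharp> \<eta> p (\<lambda>q. \<sharp> (form_add \<omega> \<omega>') q h) = \<sharp> \<eta> p (\<lambda>q. 1 * \<sharp> \<omega> q h + 1 * \<sharp> \<omega>' q h)"
    by (rule tangent_cong[OF sharp_tangent[OF \<eta>] p sharp_smooth[OF add h] s])
  also have "\<dots> = 1 * \<sharp> \<eta> p (\<lambda>q. \<sharp> \<omega> q h) + 1 * \<sharp> \<eta> p (\<lambda>q. \<sharp> \<omega>' q h)"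
    by (rule tangent_lincomb[OF sharp_tangent[OF \<eta>] sharp_smooth[OF \<omega>(1) h] sharp_smooth[OF \<omega>(2) h]])
  moreover have "\<sharp> (\<K> \<eta> (form_add \<omega> \<omega>')) p h = 1 * \<sharp> (\<K> \<eta> \<omega>) p h + 1 * \<sharp> (\<K> \<eta> \<omega>') p h"
  proof (rule sharp_lincomb[OF koszul_in[OF \<eta> \<omega>(1)] koszul_in[OF \<eta> \<omega>(2)] koszul_in[OF \<eta> add] p])
    show "\<K> \<eta> (form_add \<omega> \<omega>') p = (\<lambda>v. 1 * \<K> \<eta> \<omega> p v + 1 * \<K> \<eta> \<omega>' p v)"
      unfolding torsion_free[OF \<eta> add] torsion_free[OF \<eta> \<omega>(1)] torsion_free[OF \<eta> \<omega>(2)] D_add[OF \<omega> \<eta>]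
      by (simp add: form_diff_def form_add_def algebra_simps)
  qed
  ultimately show ?thesis using s[OF p] by (simp add: sharp_defect_def)
qed

text \<open>The term with the derivative of \<open>k\<close> along the sharp of \<eta> appears both
  in the commutator and in the sharp of the bracket, and cancels.\<close>

lemma sharp_defect_scale:
  assumes p: "p \<in> points M" and h: "h \<in> \<F>" and \<eta>: "\<eta> \<in> \<Omega>" and k: "k \<in> \<F>" and \<omega>: "\<omega> \<in> \<Omega>"
  shows "sharp_defect p h \<eta> (form_scale k \<omega>) = k p * sharp_defect p h \<eta> \<omega>"
proof -
  note k\<omega> = form_scale_in[OF k \<omega>]
  have s: "\<sharp> (form_scale k \<omega>) q f = k q * \<sharp> \<omega> q f" if "q \<in> points M" for q f
    using sharp_lincomb[OF \<omega> \<omega> k\<omega> that, of "k q" 0] by (simp add: form_scale_def)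
  have "\<sharp> \<eta> p (\<lambda>q. \<sharp> (form_scale k \<omega>) q h) = \<sharp> \<eta> p (\<lambda>q. k q * \<sharp> \<omega> q h)"
    by (rule tangent_cong[OF sharp_tangent[OF \<eta>] p sharp_smooth[OF k\<omega> h] s])
  also have "\<dots> = k p * \<sharp> \<eta> p (\<lambda>q. \<sharp> \<omega> q h) + \<sharp> \<omega> p h * \<sharp> \<eta> p k"
    by (rule tangent_mult[OF sharp_tangent[OF \<eta>] k sharp_smooth[OF \<omega> h]])
  moreover have "\<sharp> (\<K> \<eta> (form_scale k \<omega>)) p h = k p * \<sharp> (\<K> \<eta> \<omega>) p h + \<sharp> \<eta> p k * \<sharp> \<omega> p h"
  proof (rule sharp_lincomb[OF koszul_in[OF \<eta> \<omega>] \<omega> koszul_in[OF \<eta> k\<omega>] p])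
    show "\<K> \<eta> (form_scale k \<omega>) p = (\<lambda>v. k p * \<K> \<eta> \<omega> p v + \<sharp> \<eta> p k * \<omega> p v)"
      unfolding torsion_free[OF \<eta> k\<omega>] torsion_free[OF \<eta> \<omega>] D_scale(1)[OF k \<omega> \<eta>] D_scale(2)[OF k \<eta> \<omega>]
      by (simp add: form_diff_def form_add_def form_scale_def algebra_simps)
  qed
  ultimately show ?thesis using s[OF p] by (simp add: sharp_defect_def algebra_simps)
qed

lemma sharp_defect_exact:
  assumes F: "F \<in> \<F>" and G: "G \<in> \<F>" and h: "h \<in> \<F>" and p: "p \<in> points M"
  shows "sharp_defect p h (differential M F) (differential M G) = 0"
proof -
  let ?B = "biderivation M P"
  have B: "?B a b \<in> \<F>" if "a \<in> \<F>" "b \<in> \<F>" for a b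
    unfolding biderivation_def by (rule P_smooth[OF that[THEN differential_in]])
  have sharp_B: "\<sharp> (differential M a) q b = ?B a b q" if "a \<in> \<F>" "b \<in> \<F>" "q \<in> points M" for a b q
    using that by (simp add: sharp_apply differential_in biderivation_def app2_def)
  have skew: "?B a b q = - ?B b a q" if "q \<in> points M" for a b q
    unfolding biderivation_def app2_def by (rule P_skew[OF that differential_cotangent differential_cotangent])
  \<comment> \<open>An iterated derivative along Hamiltonian fields is an iterated bracket, {F, {G,
    h}} = - {{G, h}, F}.\<close>
  have twice: "\<sharp> (differential M a) p (\<lambda>q. \<sharp> (differential M b) q h) = - ?B (?B b h) a p"
    if "a \<in> \<F>" "b \<in> \<F>" for a b
  proof -
    have "\<sharp> (differential M a) p (\<lambda>q. \<sharp> (differential M b) q h) = \<sharp> (differential M a) p (?B b h)"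
      by (rule tangent_cong[OF sharp_tangent[OF differential_in[OF that(1)]] p
            sharp_smooth[OF differential_in[OF that(2)] h] sharp_B[OF that(2) h]])
    then show ?thesis using that h p skew[OF p, of a "?B b h"] by (simp add: sharp_B B)
  qed
  \<comment> \<open>The Jacobi identity is stated cyclically and contains {h, F}, so the inner
    bracket has to be reversed under the differential.\<close>
  have "?B (?B F h) G p = - ?B (?B h F) G p"
  proof -
    have "differential M (?B F h) = differential M (\<lambda>q. (-1) * ?B h F q + 0 * ?B h F q)"
      by (rule differential_cong[OF B[OF F h]]) (simp only: skew[of _ F h] mult_minus1 mult_zero_left add_0_right)
    then have "differential M (?B F h) p = (\<lambda>v. (-1) * differential M (?B h F) p v + 0 * differential M (?B h F) p v)"
      using differential_lincomb[OF B[OF h F] B[OF h F]] by metis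
    then show ?thesis
      using P_lincomb(1)[OF p differential_cotangent differential_cotangent differential_cotangent, of "-1" "?B h F" 0 "?B h F" G]
      by (simp add: biderivation_def app2_def)
  qed
  then show ?thesis
    using jacobi[OF F G h p] twice[OF F G] twice[OF G F] F G h p
    by (simp add: sharp_defect_def koszul_exact sharp_B B)
qed

text \<open>The anchor is a homomorphism of brackets. Exactness is removed from one argument at a
  time, with skew-symmetry used to exchange them.\<close>

lemma sharp_hom:
  assumes p: "p \<in> points M" and h: "h \<in> \<F>" and \<omega>: "\<omega> \<in> \<Omega>" and \<eta>: "\<eta> \<in> \<Omega>"
  shows "\<sharp> (\<K> \<omega> \<eta>) p h = \<sharp> \<omega> p (\<lambda>q. \<sharp> \<eta> q h) - \<sharp> \<eta> p (\<lambda>q. \<sharp> \<omega> q h)"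
proof -
  have tensor: "tensorial_at p (sharp_defect p h \<gamma>)" if "\<gamma> \<in> \<Omega>" for \<gamma>
    by (rule tensorial_atI[OF sharp_defect_add[OF p h that] sharp_defect_scale[OF p h that]])
  have exact: "sharp_defect p h (differential M F) \<gamma> = 0" if F: "F \<in> \<F>" and \<gamma>: "\<gamma> \<in> \<Omega>" for F \<gamma>
    by (rule tensorial_zero[OF p tensor[OF differential_in[OF F]] sharp_defect_exact[OF F _ h p] \<gamma>])
  have "sharp_defect p h \<eta> \<omega> = 0"
    by (rule tensorial_zero[OF p tensor[OF \<eta>] _ \<omega>])
      (simp add: sharp_defect_skew[OF p \<eta> differential_in] exact[OF _ \<eta>])
  then show ?thesis using sharp_defect_skew[OF p \<omega> \<eta>, of h] by (simp add: sharp_defect_def)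
qed

section \<open>Curvature and 2-Killing forms\<close>

abbreviation "R \<equiv> curvature M P D"

lemma R_in: "\<omega> \<in> \<Omega> \<Longrightarrow> \<eta> \<in> \<Omega> \<Longrightarrow> \<gamma> \<in> \<Omega> \<Longrightarrow> R \<omega> \<eta> \<gamma> \<in> \<Omega>"
  unfolding curvature_def by (intro form_diff_in D_in koszul_in)

lemma cometric_R:
  assumes "\<omega> \<in> \<Omega>" "\<eta> \<in> \<Omega>" "\<gamma> \<in> \<Omega>" "\<delta> \<in> \<Omega>" "p \<in> points M"
  shows "app2 g (R \<omega> \<eta> \<gamma>) \<delta> p =
    app2 g (D \<omega> (D \<eta> \<gamma>)) \<delta> p - app2 g (D \<eta> (D \<omega> \<gamma>)) \<delta> p - app2 g (D (\<K> \<omega> \<eta>) \<gamma>) \<delta> p"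
  using assms by (simp add: curvature_def cometric_add form_diff_in D_in koszul_in)

text \<open>Apply sharp \<omega> sharp \<eta> - sharp \<eta> sharp \<omega> - sharp
  [\<omega>, \<eta>], which is 0 by \<open>sharp_hom\<close>, to the squared norm of \<gamma>. By
  metric compatibility the result is also twice the left-hand side, as the mixed terms are
  symmetric.\<close>

lemma R_alternating:
  assumes \<omega>: "\<omega> \<in> \<Omega>" and \<eta>: "\<eta> \<in> \<Omega>" and \<gamma>: "\<gamma> \<in> \<Omega>" and p: "p \<in> points M"
  shows "app2 g (R \<omega> \<eta> \<gamma>) \<gamma> p = 0"
proof -
  have gg: "\<sharp> \<beta> q (app2 g \<gamma> \<gamma>) = 2 * app2 g (D \<beta> \<gamma>) \<gamma> q" if "\<beta> \<in> \<Omega>" "q \<in> points M" for \<beta> q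
    using D_metric[OF that(1) \<gamma> \<gamma> that(2)] cometric_commute[OF \<gamma> D_in[OF that(1) \<gamma>] that(2)] by simp
  have gD: "\<sharp> \<alpha> p (\<lambda>q. \<sharp> \<beta> q (app2 g \<gamma> \<gamma>)) =
      2 * (app2 g (D \<alpha> (D \<beta> \<gamma>)) \<gamma> p + app2 g (D \<beta> \<gamma>) (D \<alpha> \<gamma>) p)" if \<alpha>: "\<alpha> \<in> \<Omega>" and \<beta>: "\<beta> \<in> \<Omega>" for \<alpha> \<beta>
  proof -
    have "\<sharp> \<alpha> p (\<lambda>q. \<sharp> \<beta> q (app2 g \<gamma> \<gamma>)) = \<sharp> \<alpha> p (\<lambda>q. 2 * app2 g (D \<beta> \<gamma>) \<gamma> q)"
      by (rule tangent_cong[OF sharp_tangent[OF \<alpha>] p sharp_smooth[OF \<beta> cometric_smooth[OF \<gamma> \<gamma>]] gg[OF \<beta>]])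
    also have "\<dots> = 2 * \<sharp> \<alpha> p (app2 g (D \<beta> \<gamma>) \<gamma>)"
      by (rule tangent_scale[OF sharp_tangent[OF \<alpha>] cometric_smooth[OF D_in[OF \<beta> \<gamma>] \<gamma>]])
    finally show ?thesis by (simp only: D_metric[OF \<alpha> D_in[OF \<beta> \<gamma>] \<gamma> p])
  qed
  show ?thesis
    using sharp_hom[OF p cometric_smooth[OF \<gamma> \<gamma>] \<omega> \<eta>] gg[OF koszul_in[OF \<omega> \<eta>] p] gD[OF \<omega> \<eta>] gD[OF \<eta> \<omega>]
      cometric_commute[OF D_in[OF \<omega> \<gamma>] D_in[OF \<eta> \<gamma>] p] cometric_R[OF \<omega> \<eta> \<gamma> \<gamma> p] by simp
qed

text \<open>Polarisation of \<open>R_alternating\<close>.\<close>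

lemma R_skew:
  assumes \<omega>: "\<omega> \<in> \<Omega>" and \<eta>: "\<eta> \<in> \<Omega>" and \<gamma>: "\<gamma> \<in> \<Omega>" and \<delta>: "\<delta> \<in> \<Omega>" and p: "p \<in> points M"
  shows "app2 g (R \<omega> \<eta> \<gamma>) \<delta> p = - app2 g (R \<omega> \<eta> \<delta>) \<gamma> p"
proof -
  note s = form_add_in[OF \<gamma> \<delta>] and in_R = R_in[OF \<omega> \<eta>]
  have "R \<omega> \<eta> (form_add \<gamma> \<delta>) = form_add (R \<omega> \<eta> \<gamma>) (R \<omega> \<eta> \<delta>)"
    using assms unfolding curvature_def
    by (simp add: D_add D_in koszul_in) (simp add: form_add_def form_diff_def fun_eq_iff)
  then have "app2 g (R \<omega> \<eta> (form_add \<gamma> \<delta>)) (form_add \<gamma> \<delta>) p =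
      app2 g (R \<omega> \<eta> \<gamma>) (form_add \<gamma> \<delta>) p + app2 g (R \<omega> \<eta> \<delta>) (form_add \<gamma> \<delta>) p"
    by (simp add: cometric_add(1)[OF in_R[OF \<gamma>] in_R[OF \<delta>] s p])
  moreover have "app2 g (R \<omega> \<eta> \<beta>) (form_add \<gamma> \<delta>) p = app2 g (R \<omega> \<eta> \<beta>) \<gamma> p + app2 g (R \<omega> \<eta> \<beta>) \<delta> p"
    if "\<beta> \<in> \<Omega>" for \<beta>
    using cometric_commute[OF in_R[OF that] _ p] cometric_add(1)[OF \<gamma> \<delta> in_R[OF that] p] \<gamma> \<delta> s by simp
  ultimately show ?thesis
    using R_alternating[OF \<omega> \<eta> s p] R_alternating[OF \<omega> \<eta> \<gamma> p] R_alternating[OF \<omega> \<eta> \<delta> p] \<gamma> \<delta> by simp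
qed

lemma two_killing_R:
  assumes \<eta>: "\<eta> \<in> \<Omega>" and \<alpha>: "\<alpha> \<in> \<Omega>" and tk: "two_killing M P g \<eta>" and geodesic: "D \<eta> \<eta> = zero_form"
    and p: "p \<in> points M"
  shows "app2 g (R \<eta> \<alpha> \<eta>) \<alpha> p = - app2 g (D \<alpha> \<eta>) (D \<alpha> \<eta>) p"
proof -
  let ?L = "lie_derivative2 M P \<eta> (app2 g)"
  \<comment> \<open>Metric compatibility and [\<eta>, \<beta>] = D_\<eta> \<beta> - D_\<beta> \<eta>
    cancel all derivatives in direction \<eta>.\<close>
  have L: "?L \<beta> \<gamma> q = app2 g (D \<beta> \<eta>) \<gamma> q + app2 g \<beta> (D \<gamma> \<eta>) q"
    if \<beta>: "\<beta> \<in> \<Omega>" and \<gamma>: "\<gamma> \<in> \<Omega>" and q: "q \<in> points M" for \<beta> \<gamma> q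
    using D_metric[OF \<eta> \<beta> \<gamma> q] cometric_commute[OF \<beta> koszul_in[OF \<eta> \<gamma>] q]
      cometric_commute[OF \<beta> D_in[OF \<gamma> \<eta>] q] cometric_commute[OF \<beta> D_in[OF \<eta> \<gamma>] q]
      cometric_add(2)[OF D_in[OF \<eta> \<beta>] D_in[OF \<beta> \<eta>] \<gamma> q] cometric_add(2)[OF D_in[OF \<eta> \<gamma>] D_in[OF \<gamma> \<eta>] \<beta> q]
    by (simp add: lie_derivative2_def torsion_free \<eta> \<beta> \<gamma>)
  note K = koszul_in[OF \<eta> \<alpha>] and D\<alpha>\<eta> = D_in[OF \<alpha> \<eta>]
  have "\<sharp> \<eta> p (\<lambda>q. 2 * app2 g (D \<alpha> \<eta>) \<alpha> q) = \<sharp> \<eta> p (?L \<alpha> \<alpha>)"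
  proof (rule tangent_cong[OF sharp_tangent[OF \<eta>] p])
    show "(\<lambda>q. 2 * app2 g (D \<alpha> \<eta>) \<alpha> q) \<in> \<F>"
      by (rule smooth_mult[OF smooth_const cometric_smooth[OF D\<alpha>\<eta> \<alpha>]])
    show "2 * app2 g (D \<alpha> \<eta>) \<alpha> q = ?L \<alpha> \<alpha> q" if "q \<in> points M" for q
      using L[OF \<alpha> \<alpha> that] cometric_commute[OF \<alpha> D\<alpha>\<eta> that] by simp
  qed
  then have "\<sharp> \<eta> p (?L \<alpha> \<alpha>) = 2 * (app2 g (D \<eta> (D \<alpha> \<eta>)) \<alpha> p + app2 g (D \<alpha> \<eta>) (D \<eta> \<alpha>) p)"
    using tangent_scale[OF sharp_tangent[OF \<eta>] cometric_smooth[OF D\<alpha>\<eta> \<alpha>]] D_metric[OF \<eta> D\<alpha>\<eta> \<alpha> p] by simp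
  moreover have "\<sharp> \<eta> p (?L \<alpha> \<alpha>) - ?L (\<K> \<eta> \<alpha>) \<alpha> p - ?L \<alpha> (\<K> \<eta> \<alpha>) p = 0"
    using tk \<alpha> p unfolding two_killing_def by (subst (asm) lie_derivative2_def) blast
  moreover have "app2 g (\<K> \<eta> \<alpha>) (D \<alpha> \<eta>) p = app2 g (D \<eta> \<alpha>) (D \<alpha> \<eta>) p - app2 g (D \<alpha> \<eta>) (D \<alpha> \<eta>) p"
    using cometric_add(2)[OF D_in[OF \<eta> \<alpha>] D\<alpha>\<eta> D\<alpha>\<eta> p] by (simp add: torsion_free \<eta> \<alpha>)
  \<comment> \<open>The one curvature term that does not occur in the expanded 2-Killing equation
    vanishes by the geodesic condition.\<close>
  moreover have "app2 g (D \<alpha> (D \<eta> \<eta>)) \<alpha> p = 0"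
    unfolding geodesic D_zero[OF \<alpha>]
    using cometric_zero[OF p forms_cotangent[OF \<alpha>]] by (simp add: app2_def zero_form_def)
  ultimately show ?thesis
    using L[OF K \<alpha> p] L[OF \<alpha> K p] cometric_R[OF \<eta> \<alpha> \<eta> \<alpha> p]
      cometric_commute[OF \<alpha> D_in[OF K \<eta>] p] cometric_commute[OF D_in[OF \<eta> \<alpha>] D\<alpha>\<eta> p]
      cometric_commute[OF K D\<alpha>\<eta> p] by simp
qed

text \<open>By \<open>two_killing_R\<close> the Ricci curvature in the direction \<open>\<eta>\<close> is the squared norm of \<open>D\<eta>\<close>.\<close>

lemma two_killing_parallel:
  assumes \<eta>: "\<eta> \<in> \<Omega>" and tk: "two_killing M P g \<eta>" and geodesic: "D \<eta> \<eta> = zero_form"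
    and ric: "\<forall>p\<in>points M. ricci M P g D \<eta> \<eta> p \<le> 0"
  shows "parallel M D \<eta>"
  unfolding parallel_def
proof
  fix \<alpha> assume \<alpha>: "\<alpha> \<in> \<Omega>"
  show "D \<alpha> \<eta> = zero_form"
  proof (rule forms_zeroI[OF D_in[OF \<alpha> \<eta>]])
    fix p assume p: "p \<in> points M"
    \<comment> \<open>Literally the coframe chosen inside \<open>ricci\<close>, so that independence
      of the trace from the coframe is not an issue.\<close>
    define \<theta> where "\<theta> = (SOME \<theta>. local_orthonormal_coframe M g p \<theta>)"
    have coframe: "local_orthonormal_coframe M g p \<theta>"
      unfolding \<theta>_def by (rule someI_ex[OF orthonormal_coframe_exists[OF p]])
    then have \<theta>: "\<theta> i \<in> \<Omega>" if "i \<in> Basis" for i using that unfolding local_orthonormal_coframe_def by blast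
    have "ricci M P g D \<eta> \<eta> p = (\<Sum>i\<in>Basis. app2 g (R \<eta> (\<theta> i) (\<theta> i)) \<eta> p)"
      unfolding ricci_def \<theta>_def Let_def ..
    also have "\<dots> = (\<Sum>i\<in>Basis. app2 g (D (\<theta> i) \<eta>) (D (\<theta> i) \<eta>) p)"
    proof (rule sum.cong[OF refl])
      fix i :: 'e assume i: "i \<in> Basis"
      \<comment> \<open>Skew-symmetry moves \<eta> into the third slot at the price of a sign, which
        the minus sign in \<open>two_killing_R\<close> absorbs.\<close>
      show "app2 g (R \<eta> (\<theta> i) (\<theta> i)) \<eta> p = app2 g (D (\<theta> i) \<eta>) (D (\<theta> i) \<eta>) p"
        using R_skew[OF \<eta> \<theta>[OF i] \<theta>[OF i] \<eta> p] two_killing_R[OF \<eta> \<theta>[OF i] tk geodesic p] by simp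
    qed
    finally have sum_le: "(\<Sum>i\<in>Basis. app2 g (D (\<theta> i) \<eta>) (D (\<theta> i) \<eta>) p) \<le> 0"
      using bspec[OF ric p] by linarith
    have nonneg: "app2 g (D (\<theta> i) \<eta>) (D (\<theta> i) \<eta>) p \<ge> 0" if "i \<in> Basis" for i
      using cometric_nonneg[OF p forms_cotangent[OF D_in[OF \<theta>[OF that] \<eta>]]] by (simp add: app2_def)
    have zero: "D (\<theta> i) \<eta> p = (\<lambda>v. 0)" if "i \<in> Basis" for i
    proof (rule cometric_definite[OF p forms_cotangent[OF D_in[OF \<theta>[OF that] \<eta>]]])
      have "(\<Sum>i\<in>Basis. app2 g (D (\<theta> i) \<eta>) (D (\<theta> i) \<eta>) p) = 0"
        using sum_le sum_nonneg[of Basis, OF nonneg] by (intro antisym)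
      then have "\<forall>i\<in>Basis. app2 g (D (\<theta> i) \<eta>) (D (\<theta> i) \<eta>) p = 0"
        using sum_nonneg_eq_0_iff[of Basis "\<lambda>i. app2 g (D (\<theta> i) \<eta>) (D (\<theta> i) \<eta>) p"] nonneg by simp
      then show "g p (D (\<theta> i) \<eta> p) (D (\<theta> i) \<eta> p) = 0"
        using that by (simp add: app2_def)
    qed
    obtain c where c: "\<alpha> p = (\<lambda>v. \<Sum>i\<in>Basis. c i * \<theta> i p v)"
      by (rule orthonormal_coframe_expansion[OF p coframe forms_cotangent[OF \<alpha>]])
    show "D \<alpha> \<eta> p = (\<lambda>v. 0)"
    proof
      fix v
      \<comment> \<open>Constant coefficients give a global form that agrees with \<alpha> at
        \<open>p\<close>; tensoriality of \<open>D\<close> in its first argument permits the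
        exchange.\<close>
      let ?\<alpha> = "\<lambda>q v. \<Sum>i\<in>Basis. (\<lambda>q. c i) q * \<theta> i q v"
      have "?\<alpha> \<in> \<Omega>" by (rule forms_sum[OF smooth_const \<theta>])
      then have "D \<alpha> \<eta> p v = D ?\<alpha> \<eta> p v"
        using tensorial[OF p D_tensorial[OF \<eta>] \<alpha>, of ?\<alpha>] c by simp
      also have "\<dots> = (\<Sum>i\<in>Basis. c i * D (\<theta> i) \<eta> p v)"
        by (rule tensorial_sum[OF D_tensorial[OF \<eta>] finite_Basis smooth_const \<theta>])
      finally show "D \<alpha> \<eta> p v = 0" by (simp add: zero)
    qed
  qed
qed

end

section \<open>Smooth maps between manifolds\<close>

text \<open>The instances are the two projections of a product and the slice inclusions through its
  points.\<close>

locale smooth_mfd_map = M: smooth_mfd M + N: smooth_mfd N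
  for M :: "('a, 'e::euclidean_space) manifold" and N :: "('b, 'f::euclidean_space) manifold" +
  fixes \<pi> :: "'a \<Rightarrow> 'b"
  assumes continuous: "continuous_map (mtop M) (mtop N) \<pi>"
    and smooth_comp: "h \<in> smooth_functions N \<Longrightarrow> h \<circ> \<pi> \<in> smooth_functions M"
begin

lemma maps_points: "p \<in> points M \<Longrightarrow> \<pi> p \<in> points N"
  using continuous continuous_map_image_subset_topspace by blast

abbreviation "push \<equiv> push_forward N \<pi>"

lemma push_apply: "h \<in> N.\<F> \<Longrightarrow> push v h = v (h \<circ> \<pi>)"
  by (simp add: push_forward_def)

lemma push_tangent:
  assumes v: "v \<in> M.\<T> p"
  shows "push v \<in> N.\<T> (\<pi> p)"
proof (rule N.tangentI)
  show "push v (\<lambda>x. a * h x + b * k x) = a * push v h + b * push v k" if "h \<in> N.\<F>" "k \<in> N.\<F>" for h k a b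
    using M.tangent_lincomb[OF v smooth_comp[OF that(1)] smooth_comp[OF that(2)], of a b] that
    by (simp add: push_apply N.smooth_lincomb comp_def)
  show "push v (\<lambda>x. h x * k x) = h (\<pi> p) * push v k + k (\<pi> p) * push v h" if "h \<in> N.\<F>" "k \<in> N.\<F>" for h k
    using M.tangent_mult[OF v smooth_comp[OF that(1)] smooth_comp[OF that(2)]] that
    by (simp add: push_apply N.smooth_mult comp_def)
qed (simp add: push_forward_def)

lemma push_lincomb: "push (\<lambda>h. a * v h + b * w h) = (\<lambda>h. a * push v h + b * push w h)"
  by (auto simp: push_forward_def)

lemma pull_back_at_apply: "v \<in> M.\<T> p \<Longrightarrow> pull_back_at M N \<pi> p \<xi> v = \<xi> (push v)"
  by (simp add: pull_back_at_def)

lemma pull_back_apply: "v \<in> M.\<T> p \<Longrightarrow> pull_back M N \<pi> \<omega> p v = \<omega> (\<pi> p) (push v)"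
  by (simp add: pull_back_def pull_back_at_def)

lemma pull_back_at_cotangent:
  assumes "\<xi> \<in> N.\<C> (\<pi> p)"
  shows "pull_back_at M N \<pi> p \<xi> \<in> M.\<C> p"
  by (rule M.cotangentI)
    (simp_all add: pull_back_at_apply M.tangent_closed_lincomb push_lincomb N.cotangent_lincomb[OF assms] push_tangent,
      simp add: pull_back_at_def)

text \<open>The push-forward of a field \<open>Y\<close> need not be a vector field on
  \<open>N\<close>, so \<omega> cannot be evaluated on it as a form on a field. Expansion in a frame
  of \<open>N\<close> around the image point splits the value into smooth functions on
  \<open>M\<close> and pulled back smooth functions.\<close>

lemma pull_back_in:
  assumes \<omega>: "\<omega> \<in> N.\<Omega>"
  shows "pull_back M N \<pi> \<omega> \<in> M.\<Omega>"
proof (rule M.formsI)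
  note \<omega>p = N.forms_cotangent[OF \<omega>]
  show "pull_back M N \<pi> \<omega> p \<in> M.\<C> p" for p
    unfolding pull_back_def by (rule pull_back_at_cotangent[OF \<omega>p])
  fix Y assume Y: "Y \<in> M.\<X>"
  note Yp = M.fields_tangent[OF Y]
  show "(\<lambda>p. pull_back M N \<pi> \<omega> p (Y p)) \<in> M.\<F>"
  proof (rule M.smooth_if_locally_smooth, unfold M.locally_smooth_def, intro ballI)
    fix p assume p: "p \<in> points M"
    obtain x :: "'f \<Rightarrow> 'b \<Rightarrow> real" and X W where W: "openin (mtop N) W" "\<pi> p \<in> W"
      and x: "\<And>i. x i \<in> N.\<F>" and X: "\<And>i. X i \<in> N.\<X>"
      and v: "\<And>q v h. q \<in> W \<Longrightarrow> v \<in> N.\<T> q \<Longrightarrow> v h = (\<Sum>i\<in>Basis. v (x i) * X i q h)"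
      by (rule N.frame[OF maps_points[OF p]], rule that)
    let ?W = "{q \<in> points M. \<pi> q \<in> W}"
    let ?k = "\<lambda>q. \<Sum>i\<in>Basis. Y q (x i \<circ> \<pi>) * ((\<lambda>r. \<omega> r (X i r)) \<circ> \<pi>) q"
    have "openin (mtop M) ?W" by (rule openin_continuous_map_preimage[OF continuous W(1)])
    moreover have "?k \<in> M.\<F>"
      by (rule M.smooth_sum)
        (rule M.smooth_mult[OF M.fields_smooth[OF Y smooth_comp[OF x]] smooth_comp[OF N.forms_smooth[OF \<omega> X]]])
    moreover have "pull_back M N \<pi> \<omega> q (Y q) = ?k q" if q: "\<pi> q \<in> W" for q
    proof -
      have "push (Y q) = (\<lambda>h. \<Sum>i\<in>Basis. push (Y q) (x i) * X i (\<pi> q) h)"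
        by (rule ext) (rule v[OF q push_tangent[OF Yp]])
      then have "\<omega> (\<pi> q) (push (Y q)) = \<omega> (\<pi> q) (\<lambda>h. \<Sum>i\<in>Basis. push (Y q) (x i) * X i (\<pi> q) h)"
        by simp
      also have "\<dots> = (\<Sum>i\<in>Basis. push (Y q) (x i) * \<omega> (\<pi> q) (X i (\<pi> q)))"
        using N.cotangent_sum[OF \<omega>p, of Basis "\<lambda>i. X i (\<pi> q)"] N.fields_tangent[OF X] by simp
      finally show ?thesis by (simp add: pull_back_apply[OF Yp] push_apply[OF x])
    qed
    ultimately show "\<exists>W k. openin (mtop M) W \<and> p \<in> W \<and> k \<in> M.\<F> \<and> (\<forall>q\<in>W. pull_back M N \<pi> \<omega> q (Y q) = k q)"
      using p W(2) by (intro exI[of _ ?W] exI[of _ ?k]) simp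
  qed
qed

lemma pull_back_at_differential:
  "F \<in> N.\<F> \<Longrightarrow> pull_back_at M N \<pi> p (differential N F (\<pi> p)) = differential M (F \<circ> \<pi>) p"
  by (auto simp: pull_back_at_def differential_def push_apply push_tangent)

lemma pull_back_differential: "F \<in> N.\<F> \<Longrightarrow> pull_back M N \<pi> (differential N F) = differential M (F \<circ> \<pi>)"
  by (simp add: pull_back_def pull_back_at_differential)

lemma pull_back_add: "pull_back M N \<pi> (form_add \<omega> \<eta>) = form_add (pull_back M N \<pi> \<omega>) (pull_back M N \<pi> \<eta>)"
  by (simp add: pull_back_def pull_back_at_def form_add_def fun_eq_iff)

lemma pull_back_scale: "pull_back M N \<pi> (form_scale k \<omega>) = form_scale (k \<circ> \<pi>) (pull_back M N \<pi> \<omega>)"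
  by (simp add: pull_back_def pull_back_at_def form_scale_def fun_eq_iff)

end

text \<open>The difference of the two sides is tensorial in \<open>\<eta>\<close>, as the derivative terms cancel.\<close>

lemma (in smooth_mfd_map) D_pull_back:
  assumes "levi_civita_mfd M gt P D" and "levi_civita_mfd N gt' P' D'"
    and p: "p \<in> points M" and \<alpha>: "\<alpha> \<in> M.\<Omega>" and \<beta>: "\<beta> \<in> N.\<Omega>"
    and related: "\<And>k. k \<in> N.\<F> \<Longrightarrow> sharp M P \<alpha> p (k \<circ> \<pi>) = sharp N P' \<beta> (\<pi> p) k"
    and exact: "\<And>G. G \<in> N.\<F> \<Longrightarrow> D \<alpha> (differential M (G \<circ> \<pi>)) p = pull_back M N \<pi> (D' \<beta> (differential N G)) p"
    and \<eta>: "\<eta> \<in> N.\<Omega>"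
  shows "D \<alpha> (pull_back M N \<pi> \<eta>) p = pull_back M N \<pi> (D' \<beta> \<eta>) p"
proof
  fix v
  interpret M': levi_civita_mfd M gt P D by fact
  interpret N': levi_civita_mfd N gt' P' D' by fact
  let ?Q = "\<lambda>\<eta>. D \<alpha> (pull_back M N \<pi> \<eta>) p v - pull_back M N \<pi> (D' \<beta> \<eta>) p v"
  have "?Q \<eta> = 0"
  proof (rule N.tensorial_zero[where Q = ?Q, OF maps_points[OF p] N.tensorial_atI _ \<eta>])
    show "?Q (form_add \<omega> \<eta>) = ?Q \<omega> + ?Q \<eta>" if "\<omega> \<in> N.\<Omega>" "\<eta> \<in> N.\<Omega>" for \<omega> \<eta>
      using M'.D_add(2)[OF pull_back_in[OF that(1)] pull_back_in[OF that(2)] \<alpha>] N'.D_add(2)[OF that \<beta>]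
      by (simp add: pull_back_add) (simp add: form_add_def)
    show "?Q (form_scale k \<omega>) = k (\<pi> p) * ?Q \<omega>" if "k \<in> N.\<F>" "\<omega> \<in> N.\<Omega>" for k \<omega>
      using M'.D_scale(2)[OF smooth_comp[OF that(1)] \<alpha> pull_back_in[OF that(2)]] N'.D_scale(2)[OF that(1) \<beta> that(2)]
        related[OF that(1)]
      by (simp add: pull_back_add pull_back_scale) (simp add: form_add_def form_scale_def algebra_simps)
    show "?Q (differential N F) = 0" if "F \<in> N.\<F>" for F
      using exact[OF that] by (simp add: pull_back_differential[OF that])
  qed
  then show "D \<alpha> (pull_back M N \<pi> \<eta>) p v = pull_back M N \<pi> (D' \<beta> \<eta>) p v" by simp
qed

section \<open>Product manifolds\<close>

locale mfd_product = M1: smooth_mfd M1 + M2: smooth_mfd M2 + M: smooth_mfd M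
  for M1 :: "('a, 'e::euclidean_space) manifold" and M2 :: "('b, 'f::euclidean_space) manifold"
    and M :: "('a \<times> 'b, 'e \<times> 'f) manifold" +
  assumes M_eq: "M = product_manifold M1 M2"
begin

lemma points_M: "points M = points M1 \<times> points M2"
  by (simp add: M_eq product_manifold_def)

lemma atlas_M: "T \<in> atlas M \<longleftrightarrow>
    (\<exists>U \<phi> V \<psi>. T = (U \<times> V, map_prod \<phi> \<psi>) \<and> (U, \<phi>) \<in> atlas M1 \<and> (V, \<psi>) \<in> atlas M2)"
  by (auto simp: M_eq product_manifold_def)

lemma product_chart:
  assumes U: "(U, \<phi>) \<in> atlas M1" and V: "(V, \<psi>) \<in> atlas M2"
  shows "(U \<times> V, map_prod \<phi> \<psi>) \<in> atlas M"
    and "map_prod \<phi> \<psi> ` (U \<times> V) = \<phi> ` U \<times> \<psi> ` V"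
    and "open (\<phi> ` U \<times> \<psi> ` V)"
    and "y \<in> \<phi> ` U \<times> \<psi> ` V \<Longrightarrow> inv_into (U \<times> V) (map_prod \<phi> \<psi>) y = (inv_into U \<phi> (fst y), inv_into V \<psi> (snd y))"
proof -
  show UV: "(U \<times> V, map_prod \<phi> \<psi>) \<in> atlas M" using U V by (auto simp: atlas_M)
  show "map_prod \<phi> \<psi> ` (U \<times> V) = \<phi> ` U \<times> \<psi> ` V" by force
  show "open (\<phi> ` U \<times> \<psi> ` V)" by (rule open_Times[OF M1.chart_open[OF U] M2.chart_open[OF V]])
  show "inv_into (U \<times> V) (map_prod \<phi> \<psi>) y = (inv_into U \<phi> (fst y), inv_into V \<psi> (snd y))"
    if "y \<in> \<phi> ` U \<times> \<psi> ` V"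
  proof (rule inv_into_f_eq[OF M.chart_inj[OF UV]])
    have "fst y \<in> \<phi> ` U" "snd y \<in> \<psi> ` V" using that by auto
    then show "(inv_into U \<phi> (fst y), inv_into V \<psi> (snd y)) \<in> U \<times> V"
      and "map_prod \<phi> \<psi> (inv_into U \<phi> (fst y), inv_into V \<psi> (snd y)) = y"
      by (simp_all add: inv_into_into f_inv_into_f)
  qed
qed

lemma smooth_comp_fst:
  assumes "F \<in> M1.\<F>"
  shows "F \<circ> fst \<in> M.\<F>"
proof (rule M.smooth_functionsI)
  fix T \<theta> assume "(T, \<theta>) \<in> atlas M"
  then obtain U \<phi> V \<psi> where T: "T = U \<times> V" "\<theta> = map_prod \<phi> \<psi>" and U: "(U, \<phi>) \<in> atlas M1" and V: "(V, \<psi>) \<in> atlas M2"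
    by (auto simp: atlas_M)
  note op = product_chart(3)[OF U V]
  have "smooth_on (\<phi> ` U \<times> \<psi> ` V) (\<lambda>y. F (inv_into U \<phi> (fst y)))"
    by (rule smooth_on_compose[OF op M1.chart_open[OF U] _ smooth_on_bounded_linear[OF bounded_linear_fst]
        M1.smooth_functionsD[OF assms U]]) auto
  then show "smooth_on (\<theta> ` T) (\<lambda>y. (F \<circ> fst) (inv_into T \<theta> y))"
    unfolding T product_chart(2)[OF U V]
    by (rule smooth_on_cong[OF op, rotated]) (simp only: product_chart(4)[OF U V] o_apply fst_conv)
qed

lemma smooth_comp_snd:
  assumes "F \<in> M2.\<F>"
  shows "F \<circ> snd \<in> M.\<F>"
proof (rule M.smooth_functionsI)
  fix T \<theta> assume "(T, \<theta>) \<in> atlas M"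
  then obtain U \<phi> V \<psi> where T: "T = U \<times> V" "\<theta> = map_prod \<phi> \<psi>" and U: "(U, \<phi>) \<in> atlas M1" and V: "(V, \<psi>) \<in> atlas M2"
    by (auto simp: atlas_M)
  note op = product_chart(3)[OF U V]
  have "smooth_on (\<phi> ` U \<times> \<psi> ` V) (\<lambda>y. F (inv_into V \<psi> (snd y)))"
    by (rule smooth_on_compose[OF op M2.chart_open[OF V] _ smooth_on_bounded_linear[OF bounded_linear_snd]
        M2.smooth_functionsD[OF assms V]]) auto
  then show "smooth_on (\<theta> ` T) (\<lambda>y. (F \<circ> snd) (inv_into T \<theta> y))"
    unfolding T product_chart(2)[OF U V]
    by (rule smooth_on_cong[OF op, rotated]) (simp only: product_chart(4)[OF U V] o_apply snd_conv)
qed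

lemma smooth_comp_slice_h:
  assumes "q \<in> points M2" "h \<in> M.\<F>"
  shows "h \<circ> (\<lambda>x. (x, q)) \<in> M1.\<F>"
proof (rule M1.smooth_functionsI)
  fix U \<phi> assume U: "(U, \<phi>) \<in> atlas M1"
  obtain V \<psi> where V: "(V, \<psi>) \<in> atlas M2" "q \<in> V" using M2.chart_cover[OF assms(1)] by blast
  let ?h = "\<lambda>y. h (inv_into (U \<times> V) (map_prod \<phi> \<psi>) y)"
  note op = product_chart(3)[OF U V(1)]
  note h = M.smooth_functionsD[OF assms(2) product_chart(1)[OF U V(1)], unfolded product_chart(2)[OF U V(1)]]
  have "smooth_on (\<phi> ` U) (\<lambda>y. (y, 0) + (0, \<psi> q))"
    by (intro smooth_on_add M1.chart_open[OF U] smooth_on_const smooth_on_bounded_linear bounded_linear_Pair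
        bounded_linear_ident bounded_linear_zero)
  then have "smooth_on (\<phi> ` U) (\<lambda>y. (y, \<psi> q))" by simp
  then have "smooth_on (\<phi> ` U) (\<lambda>y. ?h (y, \<psi> q))"
    by (rule smooth_on_compose[OF M1.chart_open[OF U] op _ _ h, rotated]) (use V(2) in auto)
  then show "smooth_on (\<phi> ` U) (\<lambda>y. (h \<circ> (\<lambda>x. (x, q))) (inv_into U \<phi> y))"
    by (rule smooth_on_cong[OF M1.chart_open[OF U], rotated])
      (use V(2) in \<open>simp add: product_chart(4)[OF U V(1)] M2.chart_inv[OF V(1)]\<close>)
qed

lemma smooth_comp_slice_v:
  assumes "p \<in> points M1" "h \<in> M.\<F>"
  shows "h \<circ> (\<lambda>y. (p, y)) \<in> M2.\<F>"
proof (rule M2.smooth_functionsI)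
  fix V \<psi> assume V: "(V, \<psi>) \<in> atlas M2"
  obtain U \<phi> where U: "(U, \<phi>) \<in> atlas M1" "p \<in> U" using M1.chart_cover[OF assms(1)] by blast
  let ?h = "\<lambda>y. h (inv_into (U \<times> V) (map_prod \<phi> \<psi>) y)"
  note op = product_chart(3)[OF U(1) V]
  note h = M.smooth_functionsD[OF assms(2) product_chart(1)[OF U(1) V], unfolded product_chart(2)[OF U(1) V]]
  have "smooth_on (\<psi> ` V) (\<lambda>y. (0, y) + (\<phi> p, 0))"
    by (intro smooth_on_add M2.chart_open[OF V] smooth_on_const smooth_on_bounded_linear bounded_linear_Pair
        bounded_linear_ident bounded_linear_zero)
  then have "smooth_on (\<psi> ` V) (\<lambda>y. (\<phi> p, y))" by simp
  then have "smooth_on (\<psi> ` V) (\<lambda>y. ?h (\<phi> p, y))"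
    by (rule smooth_on_compose[OF M2.chart_open[OF V] op _ _ h, rotated]) (use U(2) in auto)
  then show "smooth_on (\<psi> ` V) (\<lambda>y. (h \<circ> (\<lambda>y. (p, y))) (inv_into V \<psi> y))"
    by (rule smooth_on_cong[OF M2.chart_open[OF V], rotated])
      (use U(2) in \<open>simp add: product_chart(4)[OF U(1) V] M1.chart_inv[OF U(1)]\<close>)
qed

sublocale H: smooth_mfd_map M M1 fst
  by unfold_locales (auto simp: smooth_comp_fst, simp add: M_eq product_manifold_def continuous_map_fst)

sublocale V: smooth_mfd_map M M2 snd
  by unfold_locales (auto simp: smooth_comp_snd, simp add: M_eq product_manifold_def continuous_map_snd)

lemma slice_h: "q \<in> points M2 \<Longrightarrow> smooth_mfd_map M1 M (\<lambda>x. (x, q))"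
  by unfold_locales (auto simp: smooth_comp_slice_h M_eq product_manifold_def intro!: continuous_map_pairedI)

lemma slice_v: "p \<in> points M1 \<Longrightarrow> smooth_mfd_map M2 M (\<lambda>y. (p, y))"
  by unfold_locales (auto simp: smooth_comp_slice_v M_eq product_manifold_def intro!: continuous_map_pairedI)

text \<open>In a product chart the derivative of \<open>h\<close> in a direction is the sum of its
  derivatives in the two component directions. These are the derivatives of \<open>h\<close> with
  one variable frozen at \<open>q\<close> or at \<open>p\<close>.\<close>

lemma tangent_split:
  assumes p: "p \<in> points M1" and q: "q \<in> points M2" and w: "w \<in> M.\<T> (p, q)"
  shows "w = (\<lambda>h. push_forward M (\<lambda>x. (x, q)) (H.push w) h + push_forward M (\<lambda>y. (p, y)) (V.push w) h)"
proof
  fix h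
  show "w h = push_forward M (\<lambda>x. (x, q)) (H.push w) h + push_forward M (\<lambda>y. (p, y)) (V.push w) h"
  proof (cases "h \<in> M.\<F>")
    case True
    obtain U \<phi> where U: "(U, \<phi>) \<in> atlas M1" "p \<in> U" using M1.chart_cover[OF p] by blast
    obtain V \<psi> where V: "(V, \<psi>) \<in> atlas M2" "q \<in> V" using M2.chart_cover[OF q] by blast
    let ?inv = "inv_into (U \<times> V) (map_prod \<phi> \<psi>)"
    let ?a = "(\<phi> p, \<psi> q)"
    define h1 :: "'a \<times> 'b \<Rightarrow> real" where "h1 = h \<circ> (\<lambda>x. (x, q)) \<circ> fst"
    define h2 :: "'a \<times> 'b \<Rightarrow> real" where "h2 = h \<circ> (\<lambda>y. (p, y)) \<circ> snd"
    have h12: "h1 \<in> M.\<F>" "h2 \<in> M.\<F>"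
      unfolding h1_def h2_def using smooth_comp_fst[OF smooth_comp_slice_h[OF q True]]
        smooth_comp_snd[OF smooth_comp_slice_v[OF p True]] by simp_all
  note op = product_chart(3)[OF U(1) V(1)]
    have pq: "(p, q) \<in> U \<times> V" and a: "?a \<in> \<phi> ` U \<times> \<psi> ` V" using U V by auto
    obtain c where c: "\<And>h. h \<in> M.\<F> \<Longrightarrow> w h = (\<Sum>i\<in>Basis. c i * frechet_derivative (\<lambda>y. h (?inv y)) (at ?a) i)"
      by (rule M.chart_tangent[OF product_chart(1)[OF U(1) V(1)] pq w, unfolded map_prod_simp], rule that)
    let ?D = "frechet_derivative (\<lambda>y. h (?inv y)) (at ?a)"
    have D: "((\<lambda>y. h (?inv y)) has_derivative ?D) (at ?a)"
      using M.chart_smooth_derivative[OF product_chart(1)[OF U(1) V(1)] pq True] by simp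
    have D1: "frechet_derivative (\<lambda>y. h1 (?inv y)) (at ?a) i = ?D (fst i, 0)" for i
    proof (rule frechet_derivative_eqI)
      have "((\<lambda>y. h (?inv (fst y, \<psi> q))) has_derivative (\<lambda>i. ?D (fst i, 0))) (at ?a)"
        by (rule has_derivative_compose[of "\<lambda>y. (fst y, \<psi> q)" _ ?a UNIV "\<lambda>y. h (?inv y)"])
          (auto intro!: derivative_eq_intros D)
      then show "((\<lambda>y. h1 (?inv y)) has_derivative (\<lambda>i. ?D (fst i, 0))) (at ?a)"
        by (rule has_derivative_transform_within_open[OF _ op a])
          (use V in \<open>auto simp: product_chart(4)[OF U(1) V(1)] M2.chart_inv[OF V(1)] h1_def\<close>)
    qed
    have D2: "frechet_derivative (\<lambda>y. h2 (?inv y)) (at ?a) i = ?D (0, snd i)" for i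
    proof (rule frechet_derivative_eqI)
      have "((\<lambda>y. h (?inv (\<phi> p, snd y))) has_derivative (\<lambda>i. ?D (0, snd i))) (at ?a)"
        by (rule has_derivative_compose[of "\<lambda>y. (\<phi> p, snd y)" _ ?a UNIV "\<lambda>y. h (?inv y)"])
          (auto intro!: derivative_eq_intros D)
      then show "((\<lambda>y. h2 (?inv y)) has_derivative (\<lambda>i. ?D (0, snd i))) (at ?a)"
        by (rule has_derivative_transform_within_open[OF _ op a])
          (use U in \<open>auto simp: product_chart(4)[OF U(1) V(1)] M1.chart_inv[OF U(1)] h2_def\<close>)
    qed
    have split: "?D i = ?D (fst i, 0) + ?D (0, snd i)" for i
      using linear_add[OF has_derivative_linear[OF D], of "(fst i, 0)" "(0, snd i)"] by simp
    have "w h = (\<Sum>i\<in>Basis. c i * ?D (fst i, 0) + c i * ?D (0, snd i))"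
      unfolding c[OF True] by (subst split) (simp only: distrib_left)
    then have "w h = w h1 + w h2"
      unfolding c[OF h12(1)] c[OF h12(2)] D1 D2 by (simp only: sum.distrib)
    then show ?thesis
      using True smooth_comp_slice_h[OF q True] smooth_comp_slice_v[OF p True]
      by (simp add: push_forward_def h1_def h2_def)
  next
    case False
    then show ?thesis using M.tangent_out[OF w] by (simp add: push_forward_def)
  qed
qed

lemma push_slice:
  shows "p \<in> points M1 \<Longrightarrow> q \<in> points M2 \<Longrightarrow> v \<in> M1.\<T> p \<Longrightarrow> H.push (push_forward M (\<lambda>x. (x, q)) v) = v"
    and "p \<in> points M1 \<Longrightarrow> q \<in> points M2 \<Longrightarrow> v \<in> M1.\<T> p \<Longrightarrow> V.push (push_forward M (\<lambda>x. (x, q)) v) = (\<lambda>h. 0)"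
    and "p \<in> points M1 \<Longrightarrow> q \<in> points M2 \<Longrightarrow> w \<in> M2.\<T> q \<Longrightarrow> V.push (push_forward M (\<lambda>y. (p, y)) w) = w"
    and "p \<in> points M1 \<Longrightarrow> q \<in> points M2 \<Longrightarrow> w \<in> M2.\<T> q \<Longrightarrow> H.push (push_forward M (\<lambda>y. (p, y)) w) = (\<lambda>h. 0)"
  by (auto simp: push_forward_def fun_eq_iff comp_def M1.tangent_out M2.tangent_out
      M1.tangent_const M2.tangent_const smooth_comp_fst[unfolded comp_def] smooth_comp_snd[unfolded comp_def])

end

section \<open>Warped products\<close>

locale warped_product = mfd_product M1 M2 M + M1: levi_civita_mfd M1 gt1 P1 D1 +
    M2: levi_civita_mfd M2 gt2 P2 D2 + M: levi_civita_mfd M gt P D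
  for M1 :: "('a, 'e::euclidean_space) manifold" and M2 :: "('b, 'f::euclidean_space) manifold"
    and M :: "('a \<times> 'b, 'e \<times> 'f) manifold" and gt1 gt2 gt P1 P2 P D1 D2 D +
  fixes f :: "'a \<Rightarrow> real"
  assumes gt_eq: "gt = warped_metric M1 M2 gt1 gt2 f" and P_eq: "P = product_bivector M1 M2 P1 P2"
    and f_pos: "\<And>p. p \<in> points M1 \<Longrightarrow> f p > 0" and casimir: "casimir M1 P1 f"
begin

abbreviation "lh \<equiv> pull_back M M1 fst"
abbreviation "lv \<equiv> pull_back M M2 snd"
abbreviation "d1 \<equiv> differential M1"
abbreviation "d2 \<equiv> differential M2"

context
  fixes p q
  assumes p: "p \<in> points M1" and q: "q \<in> points M2"
begin

interpretation SH: smooth_mfd_map M1 M "\<lambda>x. (x, q)" by (rule slice_h[OF q])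
interpretation SV: smooth_mfd_map M2 M "\<lambda>y. (p, y)" by (rule slice_v[OF p])

abbreviation "sh \<equiv> pull_back_at M1 M (\<lambda>x. (x, q)) p"
abbreviation "sv \<equiv> pull_back_at M2 M (\<lambda>y. (p, y)) q"

lemma pq: "(p, q) \<in> points M" using p q by (simp add: points_M)

lemma slice_lh:
  assumes "\<omega> \<in> M1.\<Omega>"
  shows "sh (lh \<omega> (p, q)) = \<omega> p" and "sv (lh \<omega> (p, q)) = (\<lambda>v. 0)"
proof -
  note \<omega> = M1.forms_cotangent[OF assms]
  show "sh (lh \<omega> (p, q)) = \<omega> p"
    using M1.cotangent_out[OF \<omega>] H.pull_back_apply[OF SH.push_tangent] push_slice(1)[OF p q]
    by (auto simp: pull_back_at_def)
  show "sv (lh \<omega> (p, q)) = (\<lambda>v. 0)"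
    using M1.cotangent_at_zero[OF \<omega>] H.pull_back_apply[OF SV.push_tangent] push_slice(4)[OF p q]
    by (auto simp: pull_back_at_def)
qed

lemma slice_lv:
  assumes "\<omega> \<in> M2.\<Omega>"
  shows "sv (lv \<omega> (p, q)) = \<omega> q" and "sh (lv \<omega> (p, q)) = (\<lambda>v. 0)"
proof -
  note \<omega> = M2.forms_cotangent[OF assms]
  show "sv (lv \<omega> (p, q)) = \<omega> q"
    using M2.cotangent_out[OF \<omega>] V.pull_back_apply[OF SV.push_tangent] push_slice(3)[OF p q]
    by (auto simp: pull_back_at_def)
  show "sh (lv \<omega> (p, q)) = (\<lambda>v. 0)"
    using M2.cotangent_at_zero[OF \<omega>] V.pull_back_apply[OF SH.push_tangent] push_slice(2)[OF p q]
    by (auto simp: pull_back_at_def)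
qed

text \<open>Restrict the covector to the two slices, represent each restriction by a differential,
  and lift back. Hence tests on lifts of exact forms detect everything at a point.\<close>

lemma cotangent_split:
  assumes \<zeta>: "\<zeta> \<in> M.\<C> (p, q)"
  obtains F G where "F \<in> M1.\<F>" "G \<in> M2.\<F>" "\<zeta> = form_add (lh (d1 F)) (lv (d2 G)) (p, q)"
proof -
  obtain F where F: "F \<in> M1.\<F>" "sh \<zeta> = d1 F p"
    by (rule M1.cotangent_exact[OF p SH.pull_back_at_cotangent[OF \<zeta>]])
  obtain G where G: "G \<in> M2.\<F>" "sv \<zeta> = d2 G q"
    by (rule M2.cotangent_exact[OF q SV.pull_back_at_cotangent[OF \<zeta>]])
  note in_\<Omega> = H.pull_back_in[OF M1.differential_in[OF F(1)]] V.pull_back_in[OF M2.differential_in[OF G(1)]]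
  have "\<zeta> = form_add (lh (d1 F)) (lv (d2 G)) (p, q)"
  proof (rule M.cotangent_eqI[OF \<zeta> M.forms_cotangent[OF M.form_add_in[OF in_\<Omega>]]])
    fix w assume w: "w \<in> M.\<T> (p, q)"
    have wH: "H.push w \<in> M1.\<T> p" and wV: "V.push w \<in> M2.\<T> q"
      using H.push_tangent[OF w] V.push_tangent[OF w] by simp_all
    have "\<zeta> w = \<zeta> (\<lambda>h. 1 * SH.push (H.push w) h + 1 * SV.push (V.push w) h)"
      using tangent_split[OF p q w] by simp
    also have "\<dots> = 1 * \<zeta> (SH.push (H.push w)) + 1 * \<zeta> (SV.push (V.push w))"
      by (rule M.cotangent_lincomb[OF \<zeta> SH.push_tangent[OF wH] SV.push_tangent[OF wV]])
    also have "\<dots> = sh \<zeta> (H.push w) + sv \<zeta> (V.push w)"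
      by (simp add: SH.pull_back_at_apply[OF wH] SV.pull_back_at_apply[OF wV])
    also have "\<dots> = form_add (lh (d1 F)) (lv (d2 G)) (p, q) w"
      by (simp add: F(2) G(2) form_add_def H.pull_back_apply[OF w] V.pull_back_apply[OF w])
    finally show "\<zeta> w = form_add (lh (d1 F)) (lv (d2 G)) (p, q) w" .
  qed
  then show ?thesis using that F(1) G(1) by blast
qed

text \<open>The Riesz vector of a horizontal lift is the slice push-forward of the Riesz vector on
  \<open>M1\<close>, since the vertical part of the warped metric vanishes on it.\<close>

lemma cometric_lh:
  assumes \<zeta>: "\<zeta> \<in> M.\<C> (p, q)" and \<omega>: "\<omega> \<in> M1.\<Omega>"
  shows "M.g (p, q) \<zeta> (lh \<omega> (p, q)) = M1.g p (sh \<zeta>) (\<omega> p)"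
proof -
  note \<omega>p = M1.forms_cotangent[OF \<omega>]
  define r where "r = riesz M1 gt1 p (\<omega> p)"
  have r: "r \<in> M1.\<T> p" unfolding r_def by (rule M1.riesz_tangent[OF p \<omega>p])
  have "riesz M gt (p, q) (lh \<omega> (p, q)) = SH.push r"
  proof (rule M.riesz_eqI[OF pq SH.push_tangent[OF r]])
    fix w assume w: "w \<in> M.\<T> (p, q)"
    have wH: "H.push w \<in> M1.\<T> p" and wV: "V.push w \<in> M2.\<T> q"
      using H.push_tangent[OF w] V.push_tangent[OF w] by simp_all
    show "gt (p, q) (SH.push r) w = lh \<omega> (p, q) w"
      using M1.gt_riesz[OF p \<omega>p wH, folded r_def]
      by (simp add: gt_eq warped_metric_def push_slice(1,2)[OF p q r] M2.gt_zero[OF q wV] H.pull_back_apply[OF w])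
  qed
  then show ?thesis
    using M.cometric_riesz[OF pq \<zeta> M.forms_cotangent[OF H.pull_back_in[OF \<omega>]]]
      M1.cometric_riesz[OF p SH.pull_back_at_cotangent[OF \<zeta>] \<omega>p] SH.pull_back_at_apply[OF r]
    by (simp add: r_def)
qed

lemma cometric_lv:
  assumes \<zeta>: "\<zeta> \<in> M.\<C> (p, q)" and \<omega>: "\<omega> \<in> M2.\<Omega>"
  shows "M.g (p, q) \<zeta> (lv \<omega> (p, q)) = inverse ((f p)\<^sup>2) * M2.g q (sv \<zeta>) (\<omega> q)"
proof -
  note \<omega>q = M2.forms_cotangent[OF \<omega>]
  define r where "r = riesz M2 gt2 q (\<omega> q)"
  \<comment> \<open>Compensates the factor f^2 that the warped metric puts on vertical vectors, and
    thus becomes the factor of the cometric.\<close>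
  define c where "c = inverse ((f p)\<^sup>2)"
  have c: "(f p)\<^sup>2 * c = 1" using f_pos[OF p] by (simp add: c_def)
  have r: "r \<in> M2.\<T> q" unfolding r_def by (rule M2.riesz_tangent[OF q \<omega>q])
  note pr = SV.push_tangent[OF r]
  let ?s = "\<lambda>h. c * SV.push r h + 0 * SV.push r h"
  have "riesz M gt (p, q) (lv \<omega> (p, q)) = ?s"
  proof (rule M.riesz_eqI[OF pq M.tangent_closed_lincomb[OF pr pr]])
    fix w assume w: "w \<in> M.\<T> (p, q)"
    have wH: "H.push w \<in> M1.\<T> p" and wV: "V.push w \<in> M2.\<T> q"
      using H.push_tangent[OF w] V.push_tangent[OF w] by simp_all
    have "gt (p, q) ?s w = c * gt (p, q) (SV.push r) w"
      using M.gt_lincomb(1)[OF pq pr pr w, of c 0] by simp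
    also have "\<dots> = c * ((f p)\<^sup>2 * \<omega> q (V.push w))"
      using M2.gt_riesz[OF q \<omega>q wV, folded r_def]
      by (simp add: gt_eq warped_metric_def push_slice(3,4)[OF p q r] M1.gt_zero[OF p wH])
    also have "\<dots> = lv \<omega> (p, q) w"
      using c by (simp add: V.pull_back_apply[OF w] mult.assoc[symmetric] mult.commute)
    finally show "gt (p, q) ?s w = lv \<omega> (p, q) w" .
  qed
  then show ?thesis
    using M.cometric_riesz[OF pq \<zeta> M.forms_cotangent[OF V.pull_back_in[OF \<omega>]]]
      M.cotangent_lincomb[OF \<zeta> pr pr, of c 0]
      M2.cometric_riesz[OF q SV.pull_back_at_cotangent[OF \<zeta>] \<omega>q] SV.pull_back_at_apply[OF r]
    by (simp add: r_def c_def)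
qed

lemma cometric_lift:
  "\<omega> \<in> M1.\<Omega> \<Longrightarrow> \<eta> \<in> M1.\<Omega> \<Longrightarrow> app2 M.g (lh \<omega>) (lh \<eta>) (p, q) = app2 M1.g \<omega> \<eta> p"
  "\<omega> \<in> M1.\<Omega> \<Longrightarrow> \<theta> \<in> M2.\<Omega> \<Longrightarrow> app2 M.g (lh \<omega>) (lv \<theta>) (p, q) = 0"
  "\<omega> \<in> M1.\<Omega> \<Longrightarrow> \<theta> \<in> M2.\<Omega> \<Longrightarrow> app2 M.g (lv \<theta>) (lh \<omega>) (p, q) = 0"
  "\<theta> \<in> M2.\<Omega> \<Longrightarrow> \<kappa> \<in> M2.\<Omega> \<Longrightarrow>
    app2 M.g (lv \<theta>) (lv \<kappa>) (p, q) = inverse ((f p)\<^sup>2) * app2 M2.g \<theta> \<kappa> q"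
  by (simp_all add: app2_def cometric_lh cometric_lv slice_lh slice_lv M1.cometric_zero[OF p] M2.cometric_zero[OF q]
      M1.forms_cotangent M2.forms_cotangent M.forms_cotangent[OF H.pull_back_in] M.forms_cotangent[OF V.pull_back_in])

lemma P_slice: "P (p, q) \<xi> \<zeta> = P1 p (sh \<xi>) (sh \<zeta>) + P2 q (sv \<xi>) (sv \<zeta>)"
  by (simp add: P_eq product_bivector_def M_eq Let_def)

lemma P_lift:
  "\<omega> \<in> M1.\<Omega> \<Longrightarrow> \<eta> \<in> M1.\<Omega> \<Longrightarrow> app2 P (lh \<omega>) (lh \<eta>) (p, q) = app2 P1 \<omega> \<eta> p"
  "\<omega> \<in> M1.\<Omega> \<Longrightarrow> \<theta> \<in> M2.\<Omega> \<Longrightarrow> app2 P (lh \<omega>) (lv \<theta>) (p, q) = 0"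
  "\<omega> \<in> M1.\<Omega> \<Longrightarrow> \<theta> \<in> M2.\<Omega> \<Longrightarrow> app2 P (lv \<theta>) (lh \<omega>) (p, q) = 0"
  "\<theta> \<in> M2.\<Omega> \<Longrightarrow> \<kappa> \<in> M2.\<Omega> \<Longrightarrow> app2 P (lv \<theta>) (lv \<kappa>) (p, q) = app2 P2 \<theta> \<kappa> q"
  by (simp_all add: app2_def P_slice slice_lh slice_lv M1.P_zero[OF p] M2.P_zero[OF q]
      M1.forms_cotangent M2.forms_cotangent M1.cotangent_zero M2.cotangent_zero)

lemma sharp_lift:
  "\<omega> \<in> M1.\<Omega> \<Longrightarrow> F \<in> M1.\<F> \<Longrightarrow> M.sharp_map (lh \<omega>) (p, q) (F \<circ> fst) = M1.sharp_map \<omega> p F"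
  "\<omega> \<in> M1.\<Omega> \<Longrightarrow> G \<in> M2.\<F> \<Longrightarrow> M.sharp_map (lh \<omega>) (p, q) (G \<circ> snd) = 0"
  "\<theta> \<in> M2.\<Omega> \<Longrightarrow> F \<in> M1.\<F> \<Longrightarrow> M.sharp_map (lv \<theta>) (p, q) (F \<circ> fst) = 0"
  "\<theta> \<in> M2.\<Omega> \<Longrightarrow> G \<in> M2.\<F> \<Longrightarrow> M.sharp_map (lv \<theta>) (p, q) (G \<circ> snd) = M2.sharp_map \<theta> q G"
  using P_lift[unfolded app2_def]
  by (simp_all add: M.sharp_apply[OF _ pq] H.pull_back_in V.pull_back_in smooth_comp_fst smooth_comp_snd
      M1.sharp_apply[OF _ p] M2.sharp_apply[OF _ q] M1.differential_in M2.differential_in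
      flip: H.pull_back_differential V.pull_back_differential)

end

section \<open>The warping function and the Casimir condition\<close>

lemma f_smooth: "f \<in> M1.\<F>"
  using casimir unfolding casimir_def by blast

lemma inverse_square_smooth: "(\<lambda>p. inverse ((f p)\<^sup>2)) \<in> M1.\<F>"
proof -
  have "(\<lambda>p. inverse (f p * f p)) \<in> M1.\<F>"
    by (rule M1.smooth_compose[OF M1.smooth_mult[OF f_smooth f_smooth] _ _ smooth_on_inverse])
      (use f_pos in fastforce)+
  then show ?thesis by (simp add: power2_eq_square)
qed

text \<open>Differentiate f^2 f^-2 = 1. The sharp of \<omega> kills f: at \<open>p\<close> the form
  \<omega> agrees with a differential, for which this is the Casimir condition.\<close>

lemma sharp_inverse_square:
  assumes p: "p \<in> points M1" and \<omega>: "\<omega> \<in> M1.\<Omega>"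
  shows "M1.sharp_map \<omega> p (\<lambda>p. inverse ((f p)\<^sup>2)) = 0"
proof -
  let ?k = "\<lambda>p. inverse ((f p)\<^sup>2)" and ?v = "M1.sharp_map \<omega> p"
  note v = M1.sharp_tangent[OF \<omega>, of p] and f = f_smooth and k = inverse_square_smooth
  obtain F where F: "F \<in> M1.\<F>" "\<omega> p = d1 F p"
    by (rule M1.cotangent_exact[OF p M1.forms_cotangent[OF \<omega>]])
  have "?v f = 0"
    using casimir F p unfolding casimir_def by (simp add: M1.sharp_apply[OF \<omega> p f] app2_def)
  then have "?v (\<lambda>x. (f x * f x) * ?k x) = (f p * f p) * ?v ?k"
    by (simp add: M1.tangent_mult[OF v M1.smooth_mult[OF f f] k] M1.tangent_mult[OF v f f])
  moreover have "?v (\<lambda>x. 1) = ?v (\<lambda>x. (f x * f x) * ?k x)"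
  proof (rule M1.tangent_cong[OF v p M1.smooth_const])
    show "1 = (f x * f x) * ?k x" if "x \<in> points M1" for x
      using f_pos[OF that] by (simp add: power2_eq_square field_simps)
  qed
  moreover have "?v (\<lambda>x. 1) = 0" by (rule M1.tangent_const[OF v])
  ultimately show ?thesis using f_pos[OF p] by simp
qed

context
  fixes p q
  assumes p: "p \<in> points M1" and q: "q \<in> points M2"
begin

lemma tangent_cometric_lift:
  assumes u: "u \<in> M.\<T> (p, q)"
  shows "\<alpha> \<in> M1.\<Omega> \<Longrightarrow> \<beta> \<in> M1.\<Omega> \<Longrightarrow> u (app2 M.g (lh \<alpha>) (lh \<beta>)) = u (app2 M1.g \<alpha> \<beta> \<circ> fst)"
    and "\<alpha> \<in> M1.\<Omega> \<Longrightarrow> \<kappa> \<in> M2.\<Omega> \<Longrightarrow> u (app2 M.g (lh \<alpha>) (lv \<kappa>)) = 0"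
    and "\<alpha> \<in> M1.\<Omega> \<Longrightarrow> \<kappa> \<in> M2.\<Omega> \<Longrightarrow> u (app2 M.g (lv \<kappa>) (lh \<alpha>)) = 0"
    and "\<kappa> \<in> M2.\<Omega> \<Longrightarrow> \<mu> \<in> M2.\<Omega> \<Longrightarrow> u (app2 M.g (lv \<kappa>) (lv \<mu>)) =
      inverse ((f p)\<^sup>2) * u (app2 M2.g \<kappa> \<mu> \<circ> snd) + app2 M2.g \<kappa> \<mu> q * u ((\<lambda>p. inverse ((f p)\<^sup>2)) \<circ> fst)"
proof -
  note cong = M.tangent_cong[OF u pq[OF p q], symmetric]
  have zero: "u h = 0" if "\<And>z. z \<in> points M \<Longrightarrow> 0 = h z" for h
    using cong[OF M.smooth_const that] M.tangent_const[OF u] by simp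
  show "u (app2 M.g (lh \<alpha>) (lh \<beta>)) = u (app2 M1.g \<alpha> \<beta> \<circ> fst)" if a: "\<alpha> \<in> M1.\<Omega>" "\<beta> \<in> M1.\<Omega>"
    by (rule cong[OF smooth_comp_fst[OF M1.cometric_smooth[OF a]]])
      (auto simp: points_M cometric_lift(1)[OF _ _ a])
  show "u (app2 M.g (lh \<alpha>) (lv \<kappa>)) = 0" "u (app2 M.g (lv \<kappa>) (lh \<alpha>)) = 0"
    if a: "\<alpha> \<in> M1.\<Omega>" "\<kappa> \<in> M2.\<Omega>"
    using zero cometric_lift(2)[OF _ _ a] cometric_lift(3)[OF _ _ a] by (auto simp: points_M)
  show "u (app2 M.g (lv \<kappa>) (lv \<mu>)) =
      inverse ((f p)\<^sup>2) * u (app2 M2.g \<kappa> \<mu> \<circ> snd) + app2 M2.g \<kappa> \<mu> q * u ((\<lambda>p. inverse ((f p)\<^sup>2)) \<circ> fst)"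
    if b: "\<kappa> \<in> M2.\<Omega>" "\<mu> \<in> M2.\<Omega>"
  proof -
    note s = smooth_comp_fst[OF inverse_square_smooth] smooth_comp_snd[OF M2.cometric_smooth[OF b]]
    have "u (app2 M.g (lv \<kappa>) (lv \<mu>)) = u (\<lambda>x. ((\<lambda>p. inverse ((f p)\<^sup>2)) \<circ> fst) x * (app2 M2.g \<kappa> \<mu> \<circ> snd) x)"
      by (rule cong[OF M.smooth_mult[OF s]]) (auto simp: points_M cometric_lift(4)[OF _ _ b])
    then show ?thesis using M.tangent_mult[OF u s] by simp
  qed
qed

text \<open>Horizontal sharps see only functions lifted from \<open>M1\<close>, vertical ones only
  those from \<open>M2\<close>. The factor f^-2 on two vertical lifts is therefore constant for a
  vertical sharp, and a horizontal sharp annihilates it by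
  \<open>sharp_inverse_square\<close>.\<close>

lemma sharp_cometric_lift:
  "\<omega> \<in> M1.\<Omega> \<Longrightarrow> \<alpha> \<in> M1.\<Omega> \<Longrightarrow> \<beta> \<in> M1.\<Omega> \<Longrightarrow>
    M.sharp_map (lh \<omega>) (p, q) (app2 M.g (lh \<alpha>) (lh \<beta>)) = M1.sharp_map \<omega> p (app2 M1.g \<alpha> \<beta>)"
  "\<omega> \<in> M1.\<Omega> \<Longrightarrow> \<kappa> \<in> M2.\<Omega> \<Longrightarrow> \<mu> \<in> M2.\<Omega> \<Longrightarrow> M.sharp_map (lh \<omega>) (p, q) (app2 M.g (lv \<kappa>) (lv \<mu>)) = 0"
  "\<theta> \<in> M2.\<Omega> \<Longrightarrow> \<alpha> \<in> M1.\<Omega> \<Longrightarrow> \<beta> \<in> M1.\<Omega> \<Longrightarrow> M.sharp_map (lv \<theta>) (p, q) (app2 M.g (lh \<alpha>) (lh \<beta>)) = 0"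
  "\<theta> \<in> M2.\<Omega> \<Longrightarrow> \<kappa> \<in> M2.\<Omega> \<Longrightarrow> \<mu> \<in> M2.\<Omega> \<Longrightarrow> M.sharp_map (lv \<theta>) (p, q) (app2 M.g (lv \<kappa>) (lv \<mu>)) =
    inverse ((f p)\<^sup>2) * M2.sharp_map \<theta> q (app2 M2.g \<kappa> \<mu>)"
  "\<gamma> \<in> M.\<Omega> \<Longrightarrow> \<alpha> \<in> M1.\<Omega> \<Longrightarrow> \<kappa> \<in> M2.\<Omega> \<Longrightarrow> M.sharp_map \<gamma> (p, q) (app2 M.g (lh \<alpha>) (lv \<kappa>)) = 0"
  "\<gamma> \<in> M.\<Omega> \<Longrightarrow> \<alpha> \<in> M1.\<Omega> \<Longrightarrow> \<kappa> \<in> M2.\<Omega> \<Longrightarrow> M.sharp_map \<gamma> (p, q) (app2 M.g (lv \<kappa>) (lh \<alpha>)) = 0"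
  by (simp_all add: tangent_cometric_lift M.sharp_tangent H.pull_back_in V.pull_back_in sharp_lift[OF p q]
      inverse_square_smooth M1.cometric_smooth M2.cometric_smooth sharp_inverse_square[OF p])

end

text \<open>For exact forms the bracket is d{F, G}. Lifting commutes with the Poisson bracket on
  each factor, and functions from different factors commute.\<close>

lemma koszul_lift:
  shows "F \<in> M1.\<F> \<Longrightarrow> F' \<in> M1.\<F> \<Longrightarrow> M.\<K> (lh (d1 F)) (lh (d1 F')) = lh (M1.\<K> (d1 F) (d1 F'))"
    and "G \<in> M2.\<F> \<Longrightarrow> G' \<in> M2.\<F> \<Longrightarrow> M.\<K> (lv (d2 G)) (lv (d2 G')) = lv (M2.\<K> (d2 G) (d2 G'))"
    and "F \<in> M1.\<F> \<Longrightarrow> G \<in> M2.\<F> \<Longrightarrow> M.\<K> (lh (d1 F)) (lv (d2 G)) = zero_form"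
    and "F \<in> M1.\<F> \<Longrightarrow> G \<in> M2.\<F> \<Longrightarrow> M.\<K> (lv (d2 G)) (lh (d1 F)) = zero_form"
proof -
  note M_\<K> = M.koszul_exact[OF smooth_comp_fst smooth_comp_fst] M.koszul_exact[OF smooth_comp_snd smooth_comp_snd]
    M.koszul_exact[OF smooth_comp_fst smooth_comp_snd] M.koszul_exact[OF smooth_comp_snd smooth_comp_fst]
  note simps = points_M biderivation_def P_lift M1.differential_in M2.differential_in
  have zero: "differential M (\<lambda>x. 0) = zero_form"
    using M.tangent_const by (force simp: differential_def zero_form_def)
  show "M.\<K> (lh (d1 F)) (lh (d1 F')) = lh (M1.\<K> (d1 F) (d1 F'))" if F: "F \<in> M1.\<F>" "F' \<in> M1.\<F>"
  proof -
    have B: "biderivation M1 P1 F F' \<in> M1.\<F>"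
      unfolding biderivation_def by (rule M1.P_smooth[OF F[THEN M1.differential_in]])
    have "differential M (biderivation M1 P1 F F' \<circ> fst) = differential M (biderivation M P (F \<circ> fst) (F' \<circ> fst))"
      by (rule M.differential_cong[OF smooth_comp_fst[OF B]])
        (auto simp: simps F simp flip: H.pull_back_differential)
    then show ?thesis
      by (simp add: H.pull_back_differential F B M1.koszul_exact M_\<K>)
  qed
  show "M.\<K> (lv (d2 G)) (lv (d2 G')) = lv (M2.\<K> (d2 G) (d2 G'))" if G: "G \<in> M2.\<F>" "G' \<in> M2.\<F>"
  proof -
    have B: "biderivation M2 P2 G G' \<in> M2.\<F>"
      unfolding biderivation_def by (rule M2.P_smooth[OF G[THEN M2.differential_in]])
    have "differential M (biderivation M2 P2 G G' \<circ> snd) = differential M (biderivation M P (G \<circ> snd) (G' \<circ> snd))"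
      by (rule M.differential_cong[OF smooth_comp_snd[OF B]])
        (auto simp: simps G simp flip: V.pull_back_differential)
    then show ?thesis
      by (simp add: V.pull_back_differential G B M2.koszul_exact M_\<K>)
  qed
  show "M.\<K> (lh (d1 F)) (lv (d2 G)) = zero_form" "M.\<K> (lv (d2 G)) (lh (d1 F)) = zero_form"
    if F: "F \<in> M1.\<F>" and G: "G \<in> M2.\<F>"
  proof -
    have "differential M (\<lambda>x. 0) = differential M (biderivation M P (F \<circ> fst) (G \<circ> snd))"
      by (rule M.differential_cong[OF M.smooth_const])
        (auto simp: simps F G simp flip: H.pull_back_differential V.pull_back_differential)
    moreover have "differential M (\<lambda>x. 0) = differential M (biderivation M P (G \<circ> snd) (F \<circ> fst))"
      by (rule M.differential_cong[OF M.smooth_const])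
        (auto simp: simps F G simp flip: H.pull_back_differential V.pull_back_differential)
    ultimately show "M.\<K> (lh (d1 F)) (lv (d2 G)) = zero_form" "M.\<K> (lv (d2 G)) (lh (d1 F)) = zero_form"
      by (simp_all add: H.pull_back_differential V.pull_back_differential F G M_\<K> zero)
  qed
qed

text \<open>The difference of the two forms agrees at the point with a sum of lifts of exact forms,
  so the hypotheses make its squared norm 0.\<close>

lemma cometric_test:
  assumes p: "p \<in> points M1" and q: "q \<in> points M2" and \<omega>: "\<omega> \<in> M.\<Omega>" "\<omega>' \<in> M.\<Omega>"
    and h: "\<And>F. F \<in> M1.\<F> \<Longrightarrow> app2 M.g \<omega> (lh (d1 F)) (p, q) = app2 M.g \<omega>' (lh (d1 F)) (p, q)"
    and v: "\<And>G. G \<in> M2.\<F> \<Longrightarrow> app2 M.g \<omega> (lv (d2 G)) (p, q) = app2 M.g \<omega>' (lv (d2 G)) (p, q)"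
  shows "\<omega> (p, q) = \<omega>' (p, q)"
proof -
  note z = pq[OF p q]
  let ?\<zeta> = "form_diff \<omega> \<omega>'"
  have \<zeta>: "?\<zeta> \<in> M.\<Omega>" by (rule M.form_diff_in[OF \<omega>])
  obtain F G where F: "F \<in> M1.\<F>" and G: "G \<in> M2.\<F>" and eq: "?\<zeta> (p, q) = form_add (lh (d1 F)) (lv (d2 G)) (p, q)"
    by (rule cotangent_split[OF p q M.forms_cotangent[OF \<zeta>]])
  note dF = H.pull_back_in[OF M1.differential_in[OF F]] and dG = V.pull_back_in[OF M2.differential_in[OF G]]
  have "M.g (p, q) (?\<zeta> (p, q)) (?\<zeta> (p, q)) = app2 M.g (form_add (lh (d1 F)) (lv (d2 G))) ?\<zeta> (p, q)"
    unfolding app2_def eq[symmetric] ..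
  also have "\<dots> = app2 M.g ?\<zeta> (lh (d1 F)) (p, q) + app2 M.g ?\<zeta> (lv (d2 G)) (p, q)"
    by (simp add: M.cometric_add(1)[OF dF dG \<zeta> z] M.cometric_commute[OF dF \<zeta> z] M.cometric_commute[OF dG \<zeta> z])
  also have "\<dots> = 0"
    using h[OF F] v[OF G] by (simp add: M.cometric_add(2)[OF \<omega> dF z] M.cometric_add(2)[OF \<omega> dG z])
  finally have "?\<zeta> (p, q) = (\<lambda>v. 0)" by (rule M.cometric_definite[OF z M.forms_cotangent[OF \<zeta>]])
  then show ?thesis by (simp add: form_diff_def fun_eq_iff)
qed

lemma cometric_zero_form: "z \<in> points M \<Longrightarrow> \<omega> \<in> M.\<Omega> \<Longrightarrow> app2 M.g zero_form \<omega> z = 0"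
  using M.cometric_zero[OF _ M.forms_cotangent] by (simp add: app2_def zero_form_def)

text \<open>All terms of the Koszul formula are known on lifts of exact forms, so both sides are
  compared by pairing them with horizontal and vertical exact lifts.\<close>

lemma D_lift_exact:
  assumes p: "p \<in> points M1" and q: "q \<in> points M2"
    and F: "F \<in> M1.\<F>" "F' \<in> M1.\<F>" and G: "G \<in> M2.\<F>" "G' \<in> M2.\<F>"
  shows "D (lh (d1 F)) (lh (d1 F')) (p, q) = lh (D1 (d1 F) (d1 F')) (p, q)"
    and "D (lv (d2 G)) (lv (d2 G')) (p, q) = lv (D2 (d2 G) (d2 G')) (p, q)"
    and "D (lh (d1 F)) (lv (d2 G)) (p, q) = zero_form (p, q)"
    and "D (lv (d2 G)) (lh (d1 F)) (p, q) = zero_form (p, q)"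
proof -
  note z = pq[OF p q]
  note d1 = M1.differential_in and d2 = M2.differential_in
  note L1 = H.pull_back_in[OF d1] and L2 = V.pull_back_in[OF d2]
  note DF = M1.D_in[OF d1[OF F(1)] d1[OF F(2)]] and DG = M2.D_in[OF d2[OF G(1)] d2[OF G(2)]]
  note simps = cometric_lift[OF p q] sharp_cometric_lift[OF p q] koszul_lift
    cometric_zero_form[OF z L1] cometric_zero_form[OF z L2] cometric_zero_form[OF z M.zero_form_in]
    d1 d2 L1 L2 M1.koszul_in[OF d1 d1] M2.koszul_in[OF d2 d2] DF DG F G
  show "D (lh (d1 F)) (lh (d1 F')) (p, q) = lh (D1 (d1 F) (d1 F')) (p, q)"
  proof (rule cometric_test[OF p q M.D_in[OF L1[OF F(1)] L1[OF F(2)]] H.pull_back_in[OF DF]], goal_cases)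
    case (1 H)
    then show ?case
      using M.koszul_formula[OF L1[OF F(1)] L1[OF F(2)] L1[OF 1] z]
        M1.koszul_formula[OF d1[OF F(1)] d1[OF F(2)] d1[OF 1] p] by (simp add: simps)
  next
    case (2 K)
    then show ?case using M.koszul_formula[OF L1[OF F(1)] L1[OF F(2)] L2[OF 2] z] by (simp add: simps)
  qed
  show "D (lv (d2 G)) (lv (d2 G')) (p, q) = lv (D2 (d2 G) (d2 G')) (p, q)"
  proof (rule cometric_test[OF p q M.D_in[OF L2[OF G(1)] L2[OF G(2)]] V.pull_back_in[OF DG]], goal_cases)
    case (1 H)
    \<comment> \<open>In an ordinary warped product the gradient of f would appear here, from the
      horizontal derivative of the norm of vertical lifts; the Casimir condition removes it.\<close>
    then show ?case using M.koszul_formula[OF L2[OF G(1)] L2[OF G(2)] L1[OF 1] z] by (simp add: simps)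
  next
    case (2 K)
    \<comment> \<open>Every term of the Koszul formula carries the same factor f^-2, which is pulled
      out.\<close>
    have "2 * app2 M.g (D (lv (d2 G)) (lv (d2 G'))) (lv (d2 K)) (p, q) =
        inverse ((f p)\<^sup>2) * (2 * app2 M2.g (D2 (d2 G) (d2 G')) (d2 K) q)"
      unfolding M.koszul_formula[OF L2[OF G(1)] L2[OF G(2)] L2[OF 2] z]
        M2.koszul_formula[OF d2[OF G(1)] d2[OF G(2)] d2[OF 2] q]
      by (simp add: simps 2 algebra_simps)
    then show ?case by (simp add: simps 2)
  qed
  show "D (lh (d1 F)) (lv (d2 G)) (p, q) = zero_form (p, q)"
  proof (rule cometric_test[OF p q M.D_in[OF L1[OF F(1)] L2[OF G(1)]] M.zero_form_in], goal_cases)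
    case (1 H)
    then show ?case using M.koszul_formula[OF L1[OF F(1)] L2[OF G(1)] L1[OF 1] z] by (simp add: simps)
  next
    case (2 K)
    then show ?case using M.koszul_formula[OF L1[OF F(1)] L2[OF G(1)] L2[OF 2] z] by (simp add: simps)
  qed
  show "D (lv (d2 G)) (lh (d1 F)) (p, q) = zero_form (p, q)"
  proof (rule cometric_test[OF p q M.D_in[OF L2[OF G(1)] L1[OF F(1)]] M.zero_form_in], goal_cases)
    case (1 H)
    then show ?case using M.koszul_formula[OF L2[OF G(1)] L1[OF F(1)] L1[OF 1] z] by (simp add: simps)
  next
    case (2 K)
    then show ?case using M.koszul_formula[OF L2[OF G(1)] L1[OF F(1)] L2[OF 2] z] by (simp add: simps)
  qed
qed

text \<open>Extends only the second argument to general forms, by \<open>D_pull_back\<close>; an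
  exact first argument is all that \<open>parallelI\<close> asks for.\<close>

lemma D_lift:
  assumes p: "p \<in> points M1" and q: "q \<in> points M2"
    and F: "F \<in> M1.\<F>" and G: "G \<in> M2.\<F>" and \<eta>1: "\<eta>1 \<in> M1.\<Omega>" and \<eta>2: "\<eta>2 \<in> M2.\<Omega>"
  shows "D (lh (d1 F)) (lh \<eta>1) (p, q) = lh (D1 (d1 F) \<eta>1) (p, q)"
    and "D (lv (d2 G)) (lv \<eta>2) (p, q) = lv (D2 (d2 G) \<eta>2) (p, q)"
    and "D (lh (d1 F)) (lv \<eta>2) (p, q) = zero_form (p, q)"
    and "D (lv (d2 G)) (lh \<eta>1) (p, q) = zero_form (p, q)"
proof -
  note z = pq[OF p q] and dF = M1.differential_in[OF F] and dG = M2.differential_in[OF G]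
  note L1 = H.pull_back_in[OF dF] and L2 = V.pull_back_in[OF dG]
  note exact = D_lift_exact[OF p q]
  have zero1: "D1 zero_form \<omega> = zero_form" if "\<omega> \<in> M1.\<Omega>" for \<omega>
    using M1.D_scale(1)[OF M1.smooth_const M1.zero_form_in that, of 0] by (simp add: form_scale_def zero_form_def)
  have zero2: "D2 zero_form \<omega> = zero_form" if "\<omega> \<in> M2.\<Omega>" for \<omega>
    using M2.D_scale(1)[OF M2.smooth_const M2.zero_form_in that, of 0] by (simp add: form_scale_def zero_form_def)
  have lh0: "lh zero_form = zero_form" and lv0: "lv zero_form = zero_form"
    by (simp_all add: pull_back_def pull_back_at_def zero_form_def fun_eq_iff)
  have sharp0: "M1.sharp_map zero_form p k = 0" "M2.sharp_map zero_form q k' = 0"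
    if "k \<in> M1.\<F>" "k' \<in> M2.\<F>" for k k'
    using that by (simp_all add: M1.sharp_apply M2.sharp_apply M1.zero_form_in M2.zero_form_in p q)
      (simp_all add: zero_form_def M1.P_zero[OF p M1.differential_cotangent] M2.P_zero[OF q M2.differential_cotangent])
  show "D (lh (d1 F)) (lh \<eta>1) (p, q) = lh (D1 (d1 F) \<eta>1) (p, q)"
    using exact(1)[OF F _ G G]
    by (intro H.D_pull_back[OF M.levi_civita_mfd_axioms M1.levi_civita_mfd_axioms z L1 _ _ _ \<eta>1])
      (simp_all add: dF sharp_lift(1)[OF p q dF] flip: H.pull_back_differential)
  show "D (lv (d2 G)) (lv \<eta>2) (p, q) = lv (D2 (d2 G) \<eta>2) (p, q)"
    using exact(2)[OF F F G]
    by (intro V.D_pull_back[OF M.levi_civita_mfd_axioms M2.levi_civita_mfd_axioms z L2 _ _ _ \<eta>2])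
      (simp_all add: dG sharp_lift(4)[OF p q dG] flip: V.pull_back_differential)
  \<comment> \<open>For a mixed term the partner form on the other factor is
    \<open>zero_form\<close>: a horizontal sharp annihilates functions lifted from
    \<open>M2\<close>, just as the sharp of 0 does.\<close>
  have "D (lh (d1 F)) (lv \<eta>2) (p, q) = lv (D2 zero_form \<eta>2) (p, q)"
    using exact(3)[OF F F _ G]
    by (intro V.D_pull_back[OF M.levi_civita_mfd_axioms M2.levi_civita_mfd_axioms z L1 M2.zero_form_in _ _ \<eta>2])
      (simp_all add: M2.differential_in zero2 lv0 sharp0[OF F] sharp_lift(2)[OF p q dF] flip: V.pull_back_differential)
  then show "D (lh (d1 F)) (lv \<eta>2) (p, q) = zero_form (p, q)" by (simp add: zero2 \<eta>2 lv0)
  have "D (lv (d2 G)) (lh \<eta>1) (p, q) = lh (D1 zero_form \<eta>1) (p, q)"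
    using exact(4)[OF _ F G G]
    by (intro H.D_pull_back[OF M.levi_civita_mfd_axioms M1.levi_civita_mfd_axioms z L2 M1.zero_form_in _ _ \<eta>1])
      (simp_all add: M1.differential_in zero1 lh0 sharp0[OF _ G] sharp_lift(3)[OF p q dG] flip: H.pull_back_differential)
  then show "D (lv (d2 G)) (lh \<eta>1) (p, q) = zero_form (p, q)" by (simp add: zero1 \<eta>1 lh0)
qed

text \<open>\<open>D\<close> is tensorial in its first argument, and by
  \<open>cotangent_split\<close> each form agrees at a point with a sum of lifts of exact
  forms.\<close>

lemma parallelI:
  assumes \<eta>: "\<eta> \<in> M.\<Omega>"
    and h: "\<And>p q F. p \<in> points M1 \<Longrightarrow> q \<in> points M2 \<Longrightarrow> F \<in> M1.\<F> \<Longrightarrow> D (lh (d1 F)) \<eta> (p, q) = zero_form (p, q)"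
    and v: "\<And>p q G. p \<in> points M1 \<Longrightarrow> q \<in> points M2 \<Longrightarrow> G \<in> M2.\<F> \<Longrightarrow> D (lv (d2 G)) \<eta> (p, q) = zero_form (p, q)"
  shows "parallel M D \<eta>"
  unfolding parallel_def
proof
  fix \<alpha> assume \<alpha>: "\<alpha> \<in> M.\<Omega>"
  show "D \<alpha> \<eta> = zero_form"
  proof (rule M.forms_zeroI[OF M.D_in[OF \<alpha> \<eta>]])
    fix z assume "z \<in> points M"
    then obtain p q where z: "z = (p, q)" "p \<in> points M1" "q \<in> points M2" by (auto simp: points_M)
    obtain F G where F: "F \<in> M1.\<F>" and G: "G \<in> M2.\<F>" and eq: "\<alpha> (p, q) = form_add (lh (d1 F)) (lv (d2 G)) (p, q)"
      by (rule cotangent_split[OF z(2,3) M.forms_cotangent[OF \<alpha>]])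
    note dF = H.pull_back_in[OF M1.differential_in[OF F]] and dG = V.pull_back_in[OF M2.differential_in[OF G]]
    have "D \<alpha> \<eta> (p, q) w = D (form_add (lh (d1 F)) (lv (d2 G))) \<eta> (p, q) w" for w
      by (rule M.tensorial[OF pq[OF z(2,3)] M.D_tensorial[OF \<eta>] \<alpha> M.form_add_in[OF dF dG] eq])
    also have "D (form_add (lh (d1 F)) (lv (d2 G))) \<eta> (p, q) w = 0" for w
      unfolding M.D_add(1)[OF dF dG \<eta>] using h[OF z(2,3) F] v[OF z(2,3) G] by (simp add: form_add_def zero_form_def)
    finally show "D \<alpha> \<eta> z = (\<lambda>v. 0)" unfolding z(1) by (rule ext)
  qed
qed

section \<open>Lifts of parallel forms\<close>

lemma parallel_lh:
  assumes \<eta>1: "\<eta>1 \<in> M1.\<Omega>" and par: "parallel M1 D1 \<eta>1"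
  shows "parallel M D (lh \<eta>1)"
proof (rule parallelI[OF H.pull_back_in[OF \<eta>1]])
  fix p q assume pq: "p \<in> points M1" "q \<in> points M2"
  show "D (lh (d1 F)) (lh \<eta>1) (p, q) = zero_form (p, q)" if F: "F \<in> M1.\<F>" for F
    \<comment> \<open>A constant function and the zero form fill the arguments of
      \<open>D_lift\<close> that belong to the other factor.\<close>
    using D_lift(1)[OF pq F M2.smooth_const \<eta>1 M2.zero_form_in] par M1.differential_in[OF F]
    by (simp add: parallel_def) (simp add: pull_back_def pull_back_at_def zero_form_def fun_eq_iff)
  show "D (lv (d2 G)) (lh \<eta>1) (p, q) = zero_form (p, q)" if G: "G \<in> M2.\<F>" for G
    by (rule D_lift(4)[OF pq M1.smooth_const G \<eta>1 M2.zero_form_in])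
qed

lemma parallel_lv:
  assumes \<eta>2: "\<eta>2 \<in> M2.\<Omega>" and par: "parallel M2 D2 \<eta>2"
  shows "parallel M D (lv \<eta>2)"
proof (rule parallelI[OF V.pull_back_in[OF \<eta>2]])
  fix p q assume pq: "p \<in> points M1" "q \<in> points M2"
  show "D (lv (d2 G)) (lv \<eta>2) (p, q) = zero_form (p, q)" if G: "G \<in> M2.\<F>" for G
    using D_lift(2)[OF pq M1.smooth_const G M1.zero_form_in \<eta>2] par M2.differential_in[OF G]
    by (simp add: parallel_def) (simp add: pull_back_def pull_back_at_def zero_form_def fun_eq_iff)
  show "D (lh (d1 F)) (lv \<eta>2) (p, q) = zero_form (p, q)" if F: "F \<in> M1.\<F>" for F
    by (rule D_lift(3)[OF pq F M2.smooth_const M1.zero_form_in \<eta>2])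
qed

lemma parallel_add:
  assumes "\<omega> \<in> M.\<Omega>" "\<eta> \<in> M.\<Omega>" "parallel M D \<omega>" "parallel M D \<eta>"
  shows "parallel M D (form_add \<omega> \<eta>)"
  using assms unfolding parallel_def by (simp add: M.D_add(2)) (simp add: form_add_def zero_form_def)

end

theorem theorem4p4:
  fixes M1 :: "('a, 'e::euclidean_space) manifold" and M2 :: "('b, 'f::euclidean_space) manifold"
    and M :: "('a \<times> 'b, 'e \<times> 'f) manifold"
    and gt1 :: "'a cov_tensor" and gt2 :: "'b cov_tensor"
    and g1 :: "'a contra_tensor" and g2 :: "'b contra_tensor"
    and P1 :: "'a contra_tensor" and P2 :: "'b contra_tensor" and P :: "('a \<times> 'b) contra_tensor"
    and D1 :: "'a form \<Rightarrow> 'a form \<Rightarrow> 'a form" and D2 :: "'b form \<Rightarrow> 'b form \<Rightarrow> 'b form"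
    and D :: "('a \<times> 'b) form \<Rightarrow> ('a \<times> 'b) form \<Rightarrow> ('a \<times> 'b) form"
    and f :: "'a \<Rightarrow> real" and \<eta>1 :: "'a form" and \<eta>2 :: "'b form"
  assumes "smooth_manifold M1" and "riemannian_metric M1 gt1" and "g1 = cometric M1 gt1"
    and "poisson_tensor M1 P1" and "contravariant_levi_civita M1 P1 g1 D1"
    and "smooth_manifold M2" and "riemannian_metric M2 gt2" and "g2 = cometric M2 gt2"
    and "poisson_tensor M2 P2" and "contravariant_levi_civita M2 P2 g2 D2"
    and "f \<in> smooth_functions M1" and "\<forall>p\<in>points M1. f p > 0"
    and "M = product_manifold M1 M2" and "P = product_bivector M1 M2 P1 P2"
    and "riemannian_poisson_manifold M (warped_metric M1 M2 gt1 gt2 f) P D"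
    and "compact_space (mtop M)"
    and "casimir M1 P1 f"
    and "\<eta>1 \<in> one_forms M1" and "\<eta>2 \<in> one_forms M2"
  shows
    "(two_killing M1 P1 g1 \<eta>1 \<and> (\<forall>p\<in>points M1. ricci M1 P1 g1 D1 \<eta>1 \<eta>1 p \<le> 0) \<and> D1 \<eta>1 \<eta>1 = zero_form \<and>
      two_killing M2 P2 g2 \<eta>2 \<and> (\<forall>q\<in>points M2. ricci M2 P2 g2 D2 \<eta>2 \<eta>2 q \<le> 0) \<and> D2 \<eta>2 \<eta>2 = zero_form
      \<longrightarrow> parallel M D (form_add (lift_h M1 M2 \<eta>1) (lift_v M1 M2 \<eta>2))) \<and>
     (two_killing M1 P1 g1 \<eta>1 \<and> (\<forall>p\<in>points M1. ricci M1 P1 g1 D1 \<eta>1 \<eta>1 p \<le> 0) \<and> D1 \<eta>1 \<eta>1 = zero_form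
      \<longrightarrow> parallel M D (lift_h M1 M2 \<eta>1)) \<and>
     (two_killing M2 P2 g2 \<eta>2 \<and> (\<forall>q\<in>points M2. ricci M2 P2 g2 D2 \<eta>2 \<eta>2 q \<le> 0) \<and> D2 \<eta>2 \<eta>2 = zero_form
      \<longrightarrow> parallel M D (lift_v M1 M2 \<eta>2))"
proof -
  have "smooth_manifold M" and metric: "riemannian_metric M (warped_metric M1 M2 gt1 gt2 f)"
    and "poisson_tensor M P" and "contravariant_levi_civita M P (cometric M (warped_metric M1 M2 gt1 gt2 f)) D"
    using assms(15) unfolding riemannian_poisson_manifold_def by auto
  \<comment> \<open>The facts about the product come from
    \<open>riemannian_poisson_manifold\<close>, those about the factors directly from the
    hypotheses.\<close>
  then interpret warped_product M1 M2 M gt1 gt2 "warped_metric M1 M2 gt1 gt2 f" P1 P2 P D1 D2 D f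
    using assms by unfold_locales auto
  note par1 = M1.two_killing_parallel[OF assms(18)] and par2 = M2.two_killing_parallel[OF assms(19)]
  note lift1 = parallel_lh[OF assms(18) par1] and lift2 = parallel_lv[OF assms(19) par2]
  have lifts: "lift_h M1 M2 \<eta>1 = lh \<eta>1" "lift_v M1 M2 \<eta>2 = lv \<eta>2"
    by (simp_all add: lift_h_def lift_v_def M_eq)
  show ?thesis
    unfolding lifts assms(3,8)
    using lift1 lift2 parallel_add[OF H.pull_back_in[OF assms(18)] V.pull_back_in[OF assms(19)]] by blast
qed

end
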